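(* Let $p$ be a prime and fix $n\geq1$. For all $2\leq N\leq p^n$: (i) If $p=2$, the class $\chi_{y^d}^{(N)}\in H^d(GL_N(\mathbb{F}_2);\mathbb{F}_2)$ is a non-nilpotent element whenever the sum of the binary digits of $d$ is at least $n$. (ii) If $p$ is odd, the class $\chi_{y^d}^{(N)}\in H^{2d}(GL_N(\mathbb{F}_p);\mathbb{F}_p)$ is a non-nilpotent element whenever the sum of the $p$-ary digits of $d$ is $k(p-1)$ for some $k\geq n$. (iii) If $p$ is odd, the class $\chi_{xy^d}^{(N)}\in H^{2d+1}(GL_N(\mathbb{F}_p);\mathbb{F}_p)$ is a nonzero element whenever the sum of the $p$-ary digits of $d$ is $k(p-1)-1$ for some $k\geq n$.
   Context: Cohomology is taken with coefficients in $\mathbb{F}_p$. Classes. For $N\geq2$ let $P\leq GL_N(\mathbb{F}_p)$ be the subgroup of block matrices $\begin{bmatrix}A&*\\0&B\end{bmatrix}$ with $A\in GL_2(\mathbb{F}_p)$, $B\in GL_{N-2}(\mathbb{F}_p)$; let $i\colon P\to GL_N(\mathbb{F}_p)$ be the inclusion and $\pi\colon P\to GL_2(\mathbb{F}_p)$ the projection onto the block $A$. For $\alpha\in H^{>0}(GL_2(\mathbb{F}_p))$ put $\chi_\alpha^{(N)}=i_!(\pi^\ast\alpha)\in H^\ast(GL_N(\mathbb{F}_p))$, where $i_!$ is the transfer map. Cohomology of $GL_2(\mathbb{F}_p)$. Regard the additive group $\mathbb{F}_p$ as the subgroup $\begin{bmatrix}1&*\\&1\end{bmatrix}$ of $GL_2(\mathbb{F}_p)$.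 For $p$ odd, $H^\ast(\mathbb{F}_p)$ is the tensor product of the exterior algebra on a generator $x$ of degree $1$ and the polynomial algebra on a generator $y$ of degree $2$; for $p=2$, $H^\ast(\mathbb{F}_2)=\mathbb{F}_2[y]$ with $\deg y=1$. Restriction identifies $H^\ast(GL_2(\mathbb{F}_p))$ with the subring of $H^\ast(\mathbb{F}_p)$ spanned by the monomials $x^ay^b$ ($a\in\{0,1\}$, $b\geq 0$; no $x$ for $p=2$) with $(p-1)\mid a+b$; such monomials are regarded as elements of $H^\ast(GL_2(\mathbb{F}_p))$. *)

theory Defs
  imports
    "HOL-Algebra.QuotRing"
    "Jordan_Normal_Form.Matrix"
    "Berlekamp_Zassenhaus.Finite_Field"
begin

text \<open>
  A homogeneous \<open>n\<close>-cochain is a function on the \<open>(n+1)\<close>-tuples of group elements. We keep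
  all degrees together: an inhomogeneous element of the direct sum of the cochain groups is one
  function on lists whose support consists of nonempty lists (over the carrier) of bounded length;
  its degree-\<open>n\<close> component is the restriction to lists of length \<open>n + 1\<close>.

  \<open>cochains G H\<close> are the cochains on \<open>G\<close> invariant under left translation by \<open>H\<close>, i.e.
  the complex of \<open>H\<close>-equivariant maps from the standard resolution of \<open>G\<close> to the trivial
  module. The cochains of the group \<open>G\<close> itself are \<open>cochains G (carrier G)\<close>.
\<close>

type_synonym ('g, 'a) cochain = "'g list \<Rightarrow> 'a"

definition cochains ::
  "('g, 'b) monoid_scheme \<Rightarrow> 'g set \<Rightarrow> ('g, 'a::comm_ring_1) cochain set" where
  "cochains G H =
     {f. (\<forall>xs. f xs \<noteq> 0 \<longrightarrow> xs \<noteq> [] \<and> set xs \<subseteq> carrier G) \<and>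
         (\<exists>n. \<forall>xs. f xs \<noteq> 0 \<longrightarrow> length xs \<le> n) \<and>
         (\<forall>h\<in>H. \<forall>xs. set xs \<subseteq> carrier G \<longrightarrow> f (map (\<lambda>x. h \<otimes>\<^bsub>G\<^esub> x) xs) = f xs)}"

definition coboundary ::
  "('g, 'b) monoid_scheme \<Rightarrow> ('g, 'a::comm_ring_1) cochain \<Rightarrow> ('g, 'a) cochain" where
  "coboundary G f =
     (\<lambda>xs. if set xs \<subseteq> carrier G
           then (\<Sum>i<length xs. (- 1) ^ i * f (take i xs @ drop (Suc i) xs)) else 0)"

text \<open>Alexander--Whitney product: the two factors share the vertex \<open>xs ! i\<close>.\<close>

definition cup ::
  "('g, 'a::comm_ring_1) cochain \<Rightarrow> ('g, 'a) cochain \<Rightarrow> ('g, 'a) cochain" where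
  "cup f g = (\<lambda>xs. \<Sum>i<length xs. f (take (Suc i) xs) * g (drop i xs))"

definition cochain_const ::
  "('g, 'b) monoid_scheme \<Rightarrow> 'a::comm_ring_1 \<Rightarrow> ('g, 'a) cochain" where
  "cochain_const G c = (\<lambda>xs. if length xs = 1 \<and> set xs \<subseteq> carrier G then c else 0)"

definition cocycle_ring ::
  "('g, 'b) monoid_scheme \<Rightarrow> ('g, 'a::comm_ring_1) cochain ring" where
  "cocycle_ring G =
     \<lparr>carrier = {f \<in> cochains G (carrier G). coboundary G f = (\<lambda>_. 0)},
      monoid.mult = cup, one = cochain_const G 1,
      zero = (\<lambda>_. 0), add = (\<lambda>f g xs. f xs + g xs)\<rparr>"

definition coboundaries ::
  "('g, 'b) monoid_scheme \<Rightarrow> ('g, 'a::comm_ring_1) cochain set" where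
  "coboundaries G = coboundary G ` cochains G (carrier G)"

type_synonym ('g, 'a) cohom_class = "('g, 'a) cochain set"

definition cohom_class ::
  "('g, 'b) monoid_scheme \<Rightarrow> ('g, 'a::comm_ring_1) cochain \<Rightarrow> ('g, 'a) cohom_class" where
  "cohom_class G f = coboundaries G +>\<^bsub>cocycle_ring G\<^esub> f"

definition cohom_ring ::
  "('g, 'b) monoid_scheme \<Rightarrow> ('g, 'a::comm_ring_1) cohom_class ring" where
  "cohom_ring G = cocycle_ring G Quot coboundaries G"

definition cohom_degree ::
  "('g, 'b) monoid_scheme \<Rightarrow> nat \<Rightarrow> ('g, 'a::comm_ring_1) cohom_class set" where
  "cohom_degree G n =
     {cohom_class G f | f. f \<in> carrier (cocycle_ring G) \<and> (\<forall>xs. f xs \<noteq> 0 \<longrightarrow> length xs = Suc n)}"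

text \<open>
  The map induced by a homomorphism \<open>\<phi>\<close> from \<open>G\<close> to another group, defined on the
  cohomology of the target with values in the cohomology of \<open>G\<close>.
\<close>

definition cochain_pullback ::
  "('g, 'b) monoid_scheme \<Rightarrow> ('g \<Rightarrow> 'h) \<Rightarrow> ('h, 'a::comm_ring_1) cochain \<Rightarrow> ('g, 'a) cochain" where
  "cochain_pullback G \<phi> f = (\<lambda>xs. if set xs \<subseteq> carrier G then f (map \<phi> xs) else 0)"

definition cohom_map ::
  "('g, 'b) monoid_scheme \<Rightarrow> ('g \<Rightarrow> 'h) \<Rightarrow> ('h, 'a::comm_ring_1) cohom_class
     \<Rightarrow> ('g, 'a) cohom_class" where
  "cohom_map G \<phi> K = the_elem ((\<lambda>f. cohom_class G (cochain_pullback G \<phi> f)) ` K)"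

text \<open>
  Transfer from a subgroup \<open>H\<close> of finite index. The standard resolution of \<open>G\<close> is also a free
  resolution over \<open>H\<close>, and restricting \<open>H\<close>-invariant cochains on \<open>G\<close> to tuples in \<open>H\<close>
  identifies the two models for the cohomology of \<open>H\<close>. On \<open>H\<close>-invariant cochains on \<open>G\<close>
  the transfer is the sum of the translates over representatives of the right cosets \<open>Ht\<close>.
\<close>

definition cochain_transfer ::
  "('g, 'b) monoid_scheme \<Rightarrow> 'g set \<Rightarrow> ('g, 'a::comm_ring_1) cochain \<Rightarrow> ('g, 'a) cochain" where
  "cochain_transfer G H u =
     (\<lambda>xs. if set xs \<subseteq> carrier G
           then (\<Sum>K\<in>rcosets\<^bsub>G\<^esub> H. u (map (\<lambda>x. (SOME t. t \<in> K) \<otimes>\<^bsub>G\<^esub> x) xs)) else 0)"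

definition transfer ::
  "('g, 'b) monoid_scheme \<Rightarrow> 'g set \<Rightarrow> ('g, 'a::comm_ring_1) cohom_class
     \<Rightarrow> ('g, 'a) cohom_class" where
  "transfer G H K =
     the_elem {cohom_class G (cochain_transfer G H u) | u.
       u \<in> cochains G H \<and> coboundary G u = (\<lambda>_. 0) \<and>
       cochain_pullback (G\<lparr>carrier := H\<rparr>) (\<lambda>x. x) u \<in> K}"

text \<open>
  Scalars act on the cohomology ring through constant \<open>0\<close>-cochains. A family is a basis if every
  class is a unique finite linear combination of its members.
\<close>

definition cohom_scalar ::
  "('g, 'b) monoid_scheme \<Rightarrow> 'a::comm_ring_1 \<Rightarrow> ('g, 'a) cohom_class" where
  "cohom_scalar G c = cohom_class G (cochain_const G c)"

definition cohom_basis ::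
  "('g, 'b) monoid_scheme \<Rightarrow> 'i set \<Rightarrow> ('i \<Rightarrow> ('g, 'a::comm_ring_1) cohom_class) \<Rightarrow> bool" where
  "cohom_basis G I e \<longleftrightarrow>
     (\<forall>i\<in>I. e i \<in> carrier (cohom_ring G)) \<and>
     (\<forall>z\<in>carrier (cohom_ring G). \<exists>!c. finite {i. c i \<noteq> 0} \<and> {i. c i \<noteq> 0} \<subseteq> I \<and>
        z = (\<Oplus>\<^bsub>cohom_ring G\<^esub>i\<in>{i. c i \<noteq> 0}. cohom_scalar G (c i) \<otimes>\<^bsub>cohom_ring G\<^esub> e i))"

definition nilpotent_elem :: "('r, 'b) ring_scheme \<Rightarrow> 'r \<Rightarrow> bool" where
  "nilpotent_elem R x \<longleftrightarrow> (\<exists>m::nat. x [^]\<^bsub>R\<^esub> m = \<zero>\<^bsub>R\<^esub>)"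

text \<open>The field with \<open>p\<close> elements is \<open>'p mod_ring\<close> for a type \<open>'p\<close> of prime cardinality \<open>p\<close>.\<close>

definition GL :: "nat \<Rightarrow> 'p::prime_card mod_ring mat monoid" where
  "GL N = units_of (ring_mat TYPE('p mod_ring) N ())"

definition parabolic :: "nat \<Rightarrow> 'p::prime_card mod_ring mat set" where
  "parabolic N =
     {four_block_mat A C (0\<^sub>m (N - 2) 2) B | A B C.
        A \<in> carrier (GL 2) \<and> B \<in> carrier (GL (N - 2)) \<and> C \<in> carrier_mat 2 (N - 2)}"

definition upper_left :: "'p::prime_card mod_ring mat \<Rightarrow> 'p mod_ring mat" where
  "upper_left M = mat 2 2 (\<lambda>(i, j). M $$ (i, j))"

definition chi ::
  "nat \<Rightarrow> ('p::prime_card mod_ring mat, 'p mod_ring) cohom_class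
     \<Rightarrow> ('p mod_ring mat, 'p mod_ring) cohom_class" where
  "chi N \<alpha> =
     transfer (GL N) (parabolic N) (cohom_map ((GL N)\<lparr>carrier := parabolic N\<rparr>) upper_left \<alpha>)"

definition Fp_group :: "'p::prime_card mod_ring monoid" where
  "Fp_group = \<lparr>carrier = UNIV, monoid.mult = (+), one = 0\<rparr>"

definition unipotent :: "'p::prime_card mod_ring \<Rightarrow> 'p mod_ring mat" where
  "unipotent c = mat_of_rows_list 2 [[1, c], [0, 1]]"

abbreviation H_Fp :: "('p::prime_card mod_ring, 'p mod_ring) cohom_class ring" where
  "H_Fp \<equiv> cohom_ring Fp_group"

abbreviation H_GL ::
  "nat \<Rightarrow> ('p::prime_card mod_ring mat, 'p mod_ring) cohom_class ring" where
  "H_GL N \<equiv> cohom_ring (GL N)"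

definition res_GL2 ::
  "('p::prime_card mod_ring mat, 'p mod_ring) cohom_class
     \<Rightarrow> ('p mod_ring, 'p mod_ring) cohom_class" where
  "res_GL2 = cohom_map Fp_group unipotent"

text \<open>
  Restriction is injective on the cohomology of \<open>GL 2\<close>; \<open>GL2_class z\<close> is the unique class
  restricting to \<open>z\<close>.
\<close>

definition GL2_class ::
  "('p::prime_card mod_ring, 'p mod_ring) cohom_class
     \<Rightarrow> ('p mod_ring mat, 'p mod_ring) cohom_class" where
  "GL2_class = the_inv_into (carrier (H_GL 2)) res_GL2"

definition polynomial_generator ::
  "('p::prime_card mod_ring, 'p mod_ring) cohom_class \<Rightarrow> bool" where
  "polynomial_generator y \<longleftrightarrow>
     y \<in> cohom_degree Fp_group 1 \<and>
     cohom_basis Fp_group UNIV (\<lambda>b::nat. y [^]\<^bsub>H_Fp\<^esub> b)"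

text \<open>
  The cohomology ring is the tensor product of the exterior algebra on \<open>x\<close> and the polynomial
  algebra on \<open>y\<close>: the defining relations hold and the monomials form a basis.
\<close>

definition exterior_polynomial_generators ::
  "('p::prime_card mod_ring, 'p mod_ring) cohom_class
     \<Rightarrow> ('p mod_ring, 'p mod_ring) cohom_class \<Rightarrow> bool" where
  "exterior_polynomial_generators x y \<longleftrightarrow>
     x \<in> cohom_degree Fp_group 1 \<and> y \<in> cohom_degree Fp_group 2 \<and>
     x \<otimes>\<^bsub>H_Fp\<^esub> x = \<zero>\<^bsub>H_Fp\<^esub> \<and> x \<otimes>\<^bsub>H_Fp\<^esub> y = y \<otimes>\<^bsub>H_Fp\<^esub> x \<and>
     cohom_basis Fp_group ({0, 1} \<times> UNIV)
       (\<lambda>(a::nat, b::nat). x [^]\<^bsub>H_Fp\<^esub> a \<otimes>\<^bsub>H_Fp\<^esub> y [^]\<^bsub>H_Fp\<^esub> b)"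

text \<open>For \<open>p \<ge> 2\<close> the digits with index above \<open>d\<close> vanish.\<close>

definition digit_sum :: "nat \<Rightarrow> nat \<Rightarrow> nat" where
  "digit_sum p d = (\<Sum>i\<le>d. d div p ^ i mod p)"

end

theory Submission
  imports
    Defs
    "HOL-Computational_Algebra.Formal_Power_Series"
    "HOL-Library.Poly_Mapping"
    "Jordan_Normal_Form.Determinant"
begin

text \<open>
  Let \<open>m\<close> be minimal with \<open>N \<le> p ^ m\<close>, and let the elementary abelian group \<open>E\<close> of rank \<open>m\<close>
  act by translation on the span of the first \<open>N\<close> products of binomial coefficients, a space of
  functions on \<open>E\<close>. By the double coset formula the restriction of \<open>\<chi>\<^sub>\<alpha>\<close> along \<open>E \<rightarrow> GL N\<close> is a sum
  over the invariant planes. Each of them is spanned by the constant function and a nonzero linear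
  form \<open>c\<close>, and is obtained from \<open>p - 1\<close> such forms, so the restriction is
  \<open>- (\<Sum>c. c\<^sup>* \<alpha>)\<close>.

  To see that this class is not nilpotent, extend scalars to polynomials and pull it back along a
  homomorphism from the group of order \<open>p\<close> to the units of the group algebra of \<open>E\<close>. This turns
  \<open>c\<^sup>* x\<close> into \<open>\<lambda> c * x\<close> and \<open>c\<^sup>* y\<close> into \<open>(\<lambda> c) ^ p * y\<close> (into \<open>\<lambda> c * y\<close> if \<open>p = 2\<close>), where
  the linear form \<open>\<lambda>\<close> has prescribed polynomial coefficients. The power sum \<open>\<Sum>c. (\<lambda> c) ^ d\<close>
  is nonzero for a suitable \<open>\<lambda>\<close> if the digit sum of \<open>d\<close> is \<open>k * (p - 1)\<close> with \<open>m \<le> k\<close>.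
\<close>

section \<open>Cochains as functions on lists\<close>

text \<open>Ordinary cyclic subgroups of \<open>E\<close> cannot detect the class: there \<lambda>
  takes values in the prime field, and for m \<ge> 2 each value of \<lambda>(c) is attained a
  multiple of p times, so the power sum vanishes. Hence the detour through units 1 + \<Sum> a_k (g_k
  - 1) of the group algebra over a larger ring: the Frobenius identity gives them order p for every
  choice of the a_k. Polynomials over the prime field serve as scalars because they form an infinite
  integral domain of characteristic p. Being infinite, they contain slopes a_k with nonzero power
  sum \<mu>; having no zero divisors, they keep every \<mu>^r nonzero, as non-nilpotence requires.
  The p-th power on y arises because y is a multiple of the class of the carry cocycle, which lives
  in degree p of a power series where Frobenius acts. For p odd, x y^d is thus multiplied by
  (\<lambda> c)^(1 + p d). Passing from d to p d keeps the digit sum and x adds one to it, which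
  explains the two digit conditions. Minimality of m puts every coordinate function of
  \<open>E\<close> among the first N basis functions.\<close>

fun cobd :: "('g list \<Rightarrow> 'a::comm_ring_1) \<Rightarrow> 'g list \<Rightarrow> 'a" where
  "cobd f [] = 0"
| "cobd f (x # xs) = f xs - cobd (\<lambda>ys. f (x # ys)) xs"

text \<open>Deleting the head gives the leading face; deleting a later vertex is the same operator
  on \<open>f\<close> with the head frozen and the opposite sign. In this recursive form the sign
  identities become list inductions with \<open>f\<close> arbitrary, without index shifts.\<close>

lemma cobd_eq_sum: "cobd f xs = (\<Sum>i<length xs. (- 1) ^ i * f (take i xs @ drop (Suc i) xs))"
proof (induction xs arbitrary: f)
  case (Cons x xs)
  then show ?case
    by (simp add: sum.lessThan_Suc_shift sum_negf del: sum.lessThan_Suc)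
qed simp

lemma coboundary_eq_cobd:
  "coboundary G f xs = (if set xs \<subseteq> carrier G then cobd f xs else 0)"
  by (simp add: coboundary_def cobd_eq_sum)

lemma cup_Nil [simp]: "cup f g [] = 0"
  by (simp add: cup_def)

lemma cup_Cons [simp]: "cup f g (x # xs) = f [x] * g (x # xs) + cup (\<lambda>ys. f (x # ys)) g xs"
  unfolding cup_def list.size(4) add_Suc_right add_0_right sum.lessThan_Suc_shift by simp

lemma cobd_cong:
  assumes "\<And>ys. set ys \<subseteq> set xs \<Longrightarrow> Suc (length ys) = length xs \<Longrightarrow> f ys = g ys"
  shows "cobd f xs = cobd g xs"
  unfolding cobd_eq_sum
  by (intro sum.cong refl arg_cong2[where f = "(*)"] assms) (auto dest: in_set_takeD in_set_dropD)

lemma cup_cong: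
  assumes "\<And>ys. set ys \<subseteq> set xs \<Longrightarrow> f ys = f' ys"
    and "\<And>ys. set ys \<subseteq> set xs \<Longrightarrow> g ys = g' ys"
  shows "cup f g xs = cup f' g' xs"
  unfolding cup_def
  by (intro sum.cong refl arg_cong2[where f = "(*)"] assms) (auto dest: in_set_takeD in_set_dropD)

lemma cobd_add: "cobd (\<lambda>ys. f ys + g ys) xs = cobd f xs + cobd g xs"
  by (induction xs arbitrary: f g) (simp_all add: algebra_simps)

lemma cobd_diff: "cobd (\<lambda>ys. f ys - g ys) xs = cobd f xs - cobd g xs"
  by (induction xs arbitrary: f g) (simp_all add: algebra_simps)

lemma cobd_scale: "cobd (\<lambda>ys. c * f ys) xs = c * cobd f xs"
  by (induction xs arbitrary: f) (simp_all add: algebra_simps)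

lemma cobd_minus: "cobd (\<lambda>ys. - f ys) xs = - cobd f xs"
  using cobd_scale[of "-1" f xs] by simp

lemma cobd_zero [simp]: "cobd (\<lambda>_. 0) xs = 0"
  by (induction xs) simp_all

lemma cobd_sum: "cobd (\<lambda>ys. \<Sum>i\<in>I. f i ys) xs = (\<Sum>i\<in>I. cobd (f i) xs)"
  by (induction I rule: infinite_finite_induct) (simp_all add: cobd_add)

lemma cobd_map: "cobd (\<lambda>ys. f (map h ys)) xs = cobd f (map h xs)"
  by (induction xs arbitrary: f) simp_all

lemma cobd_additive:
  assumes "\<And>a b. h (a - b) = h a - h b"
  shows "cobd (\<lambda>ys. h (f ys)) xs = h (cobd f xs)"
proof -
  have "h 0 = 0" using assms[of 0 0] by simp
  then show ?thesis by (induction xs arbitrary: f) (simp_all add: assms)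
qed

lemma cobd_cobd: "cobd (cobd f) xs = 0"
  by (induction xs arbitrary: f) (simp_all add: cobd_diff)

lemma cup_add_left: "cup (\<lambda>ys. f ys + g ys) h xs = cup f h xs + cup g h xs"
  by (simp add: cup_def algebra_simps sum.distrib)

lemma cup_add_right: "cup f (\<lambda>ys. g ys + h ys) xs = cup f g xs + cup f h xs"
  by (simp add: cup_def algebra_simps sum.distrib)

lemma cup_scale_left: "cup (\<lambda>ys. c * f ys) g xs = c * cup f g xs"
  by (simp add: cup_def algebra_simps sum_distrib_left)

lemma cup_scale_right: "cup f (\<lambda>ys. c * g ys) xs = c * cup f g xs"
  by (simp add: cup_def algebra_simps sum_distrib_left)

lemma cup_minus_left: "cup (\<lambda>ys. - f ys) g xs = - cup f g xs"
  using cup_scale_left[of "-1" f g xs] by simp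

lemma cup_assoc: "cup (cup f g) h xs = cup f (cup g h) xs"
  by (induction xs arbitrary: f) (simp_all add: cup_add_left cup_scale_left algebra_simps)

lemma cup_map: "cup (\<lambda>ys. f (map h ys)) (\<lambda>ys. g (map h ys)) xs = cup f g (map h xs)"
  by (simp add: cup_def take_map drop_map)

lemma cup_hom:
  assumes "\<And>a b. h (a + b) = h a + h b" "\<And>a b. h (a * b) = h a * h b" "h 0 = 0"
  shows "cup (\<lambda>ys. h (f ys)) (\<lambda>ys. h (g ys)) xs = h (cup f g xs)"
  by (induction xs arbitrary: f) (simp_all add: assms)

text \<open>The sign \<open>(-1) ^ n\<close> in degree \<open>n\<close>, i.e. on lists of length \<open>n + 1\<close>.\<close>

definition sgn_cochain :: "('g list \<Rightarrow> 'a::comm_ring_1) \<Rightarrow> 'g list \<Rightarrow> 'a" where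
  "sgn_cochain f xs = - ((- 1) ^ length xs * f xs)"

lemma sgn_cochain_Cons:
  "(\<lambda>ys. sgn_cochain f (x # ys)) = (\<lambda>ys. - sgn_cochain (\<lambda>zs. f (x # zs)) ys)"
  by (simp add: sgn_cochain_def)

lemma sgn_cochain_sgn_cochain [simp]: "sgn_cochain (sgn_cochain f) = f"
proof
  fix xs :: "'a list"
  have "(- 1 :: 'b) ^ length xs * (- 1) ^ length xs = 1"
    by (simp flip: power_mult_distrib)
  then show "sgn_cochain (sgn_cochain f) xs = f xs"
    by (simp add: sgn_cochain_def flip: mult.assoc)
qed

lemma cobd_sgn_cochain: "cobd (sgn_cochain f) xs = - sgn_cochain (cobd f) xs"
proof (induction xs arbitrary: f)
  case (Cons x xs)
  then show ?case
    by (simp add: sgn_cochain_Cons cobd_minus) (simp add: sgn_cochain_def algebra_simps)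
qed (simp add: sgn_cochain_def)

text \<open>The graded Leibniz rule for arbitrary functions on lists. The term
  \<open>f [] * g xs\<close> disappears for cochains, but the induction depends on it: the
  hypothesis is applied to \<open>\<lambda>ys. f (x # ys)\<close>, whose value at \<open>[]\<close>
  is \<open>f [x]\<close>.\<close>

lemma cobd_cup:
  assumes "g [] = 0"
  shows "cobd (cup f g) xs
    = cup (cobd f) g xs - f [] * g xs + cup (sgn_cochain f) (cobd g) xs"
proof (induction xs arbitrary: f)
  case (Cons x xs)
  have "cup (\<lambda>ys. f ys + - cobd (\<lambda>zs. f (x # zs)) ys) g xs
      = cup f g xs - cup (cobd (\<lambda>zs. f (x # zs))) g xs"
    by (simp only: cup_add_left cup_minus_left) simp
  then have *: "cup (\<lambda>ys. f ys - cobd (\<lambda>zs. f (x # zs)) ys) g xs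
      = cup f g xs - cup (cobd (\<lambda>zs. f (x # zs))) g xs" by simp
  have "sgn_cochain f [x] = f [x]" by (simp add: sgn_cochain_def)
  then show ?case
    by (simp add: cobd_add cobd_scale sgn_cochain_Cons cup_minus_left Cons.IH * algebra_simps)
qed (simp add: assms)

section \<open>The prism operator\<close>

text \<open>The classical prism operator, the alternating sum of f(\<alpha> x_0, ..., \<alpha> x_i,
  \<beta> x_i, ..., \<beta> x_n) over i, in the same recursive style as \<open>cobd\<close>.\<close>

fun prism :: "('h \<Rightarrow> 'g) \<Rightarrow> ('h \<Rightarrow> 'g) \<Rightarrow> ('g list \<Rightarrow> 'a::comm_ring_1) \<Rightarrow> 'h list \<Rightarrow> 'a" where
  "prism \<alpha> \<beta> f [] = 0"
| "prism \<alpha> \<beta> f (x # xs) = f (\<alpha> x # map \<beta> (x # xs)) - prism \<alpha> \<beta> (\<lambda>ys. f (\<alpha> x # ys)) xs"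

lemma prism_diff: "prism \<alpha> \<beta> (\<lambda>ys. f ys - g ys) xs = prism \<alpha> \<beta> f xs - prism \<alpha> \<beta> g xs"
  by (induction xs arbitrary: f g) (simp_all add: algebra_simps)

lemma cobd_prism:
  "cobd (prism \<alpha> \<beta> f) xs + prism \<alpha> \<beta> (cobd f) xs = f (map \<beta> xs) - f (map \<alpha> xs)"
proof (induction xs arbitrary: f)
  case (Cons x xs)
  have "cobd (\<lambda>ys. f (\<alpha> x # \<beta> x # map \<beta> ys)) xs = cobd (\<lambda>ys. f (\<alpha> x # \<beta> x # ys)) (map \<beta> xs)"
    by (rule cobd_map)
  then show ?case
    using Cons.IH[of "\<lambda>ys. f (\<alpha> x # ys)"]
    by (simp add: cobd_diff prism_diff algebra_simps)
qed simp

lemma prism_cong: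
  assumes "\<And>ys. set ys \<subseteq> \<alpha> ` set xs \<union> \<beta> ` set xs \<Longrightarrow> f ys = g ys"
  shows "prism \<alpha> \<beta> f xs = prism \<alpha> \<beta> g xs"
  using assms
proof (induction xs arbitrary: f g)
  case (Cons x xs)
  have "prism \<alpha> \<beta> (\<lambda>ys. f (\<alpha> x # ys)) xs = prism \<alpha> \<beta> (\<lambda>ys. g (\<alpha> x # ys)) xs"
    by (rule Cons.IH, rule Cons.prems) auto
  moreover have "f (\<alpha> x # map \<beta> (x # xs)) = g (\<alpha> x # map \<beta> (x # xs))"
    by (rule Cons.prems) auto
  ultimately show ?case by simp
qed simp

lemma prism_equivariant:
  assumes "\<And>ys. set ys \<subseteq> \<alpha> ` set xs \<union> \<beta> ` set xs \<Longrightarrow> f (map h ys) = f ys"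
    and "\<And>x. x \<in> set xs \<Longrightarrow> \<alpha> (k x) = h (\<alpha> x)" "\<And>x. x \<in> set xs \<Longrightarrow> \<beta> (k x) = h (\<beta> x)"
  shows "prism \<alpha> \<beta> f (map k xs) = prism \<alpha> \<beta> f xs"
proof -
  have "prism \<alpha> \<beta> f (map k xs) = prism \<alpha> \<beta> (\<lambda>ys. f (map h ys)) xs"
    using assms(2,3)
  proof (induction xs arbitrary: f)
    case (Cons x xs)
    show ?case
      using Cons.IH[of "\<lambda>ys. f (h (\<alpha> x) # ys)"] Cons.prems
      by (simp, intro arg_cong[where f = f], simp)
  qed simp
  also have "\<dots> = prism \<alpha> \<beta> f xs" by (rule prism_cong) (rule assms(1))
  finally show ?thesis .
qed

lemma prism_bounded:
  fixes f :: "'b list \<Rightarrow> 'c::comm_ring_1" and \<alpha> \<beta> :: "'a \<Rightarrow> 'b"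
  assumes "\<And>ys. f ys \<noteq> 0 \<Longrightarrow> length ys \<le> n" "prism \<alpha> \<beta> f xs \<noteq> 0"
  shows "length xs \<le> n"
proof (rule ccontr)
  assume *: "\<not> length xs \<le> n"
  have "(\<And>ys. length ys > length xs \<Longrightarrow> f ys = 0) \<Longrightarrow> prism \<alpha> \<beta> f xs = 0" for f :: "'b list \<Rightarrow> 'c" and xs
    by (induction xs arbitrary: f) simp_all
  moreover have "f ys = 0" if "length ys > length xs" for ys
    using assms(1)[of ys] * that by linarith
  ultimately show False using assms(2) by blast
qed

section \<open>The cohomology ring\<close>

lemma cochainsI:
  assumes "\<And>xs. f xs \<noteq> 0 \<Longrightarrow> xs \<noteq> [] \<and> set xs \<subseteq> carrier G"
    and "\<And>xs. f xs \<noteq> 0 \<Longrightarrow> length xs \<le> n"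
    and "\<And>h xs. h \<in> H \<Longrightarrow> set xs \<subseteq> carrier G \<Longrightarrow> f (map (\<lambda>x. h \<otimes>\<^bsub>G\<^esub> x) xs) = f xs"
  shows "f \<in> cochains G H"
  using assms unfolding cochains_def by blast

lemma cochains_support: "f \<in> cochains G H \<Longrightarrow> f xs \<noteq> 0 \<Longrightarrow> xs \<noteq> [] \<and> set xs \<subseteq> carrier G"
  by (auto simp: cochains_def)

lemma cochains_Nil [simp]: "f \<in> cochains G H \<Longrightarrow> f [] = 0"
  using cochains_support by blast

lemma cochains_bounded:
  assumes "f \<in> cochains G H"
  obtains n where "\<And>xs. f xs \<noteq> 0 \<Longrightarrow> length xs \<le> n"
  using assms unfolding cochains_def by blast

lemma cochains_invariant:
  "f \<in> cochains G H \<Longrightarrow> h \<in> H \<Longrightarrow> set xs \<subseteq> carrier G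
    \<Longrightarrow> f (map (\<lambda>x. h \<otimes>\<^bsub>G\<^esub> x) xs) = f xs"
  by (auto simp: cochains_def)

lemma cochains_mono: "H \<subseteq> K \<Longrightarrow> cochains G K \<subseteq> cochains G H"
  by (auto simp: cochains_def)

lemma cochains_zero [simp]: "(\<lambda>_. 0) \<in> cochains G H"
  by (auto simp: cochains_def)

lemma cochains_add:
  assumes f: "f \<in> cochains G H" and g: "g \<in> cochains G H"
  shows "(\<lambda>xs. f xs + g xs) \<in> cochains G H"
proof -
  obtain n m where "\<And>xs. f xs \<noteq> 0 \<Longrightarrow> length xs \<le> n" "\<And>xs. g xs \<noteq> 0 \<Longrightarrow> length xs \<le> m"
    using f g by (metis cochains_bounded)
  then have "length xs \<le> max n m" if "f xs + g xs \<noteq> 0" for xs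
    using that by (metis add.right_neutral max.coboundedI1 max.coboundedI2)
  then show ?thesis
    using cochains_support[OF f] cochains_support[OF g] cochains_invariant[OF f] cochains_invariant[OF g]
    by (intro cochainsI[where n = "max n m"]) (metis add.right_neutral, auto)
qed

lemma cochains_scale:
  assumes "f \<in> cochains G H"
  shows "(\<lambda>xs. c * f xs) \<in> cochains G H"
proof -
  obtain n where "\<And>xs. f xs \<noteq> 0 \<Longrightarrow> length xs \<le> n"
    using assms by (metis cochains_bounded)
  then show ?thesis
    using cochains_support[OF assms] cochains_invariant[OF assms]
    by (intro cochainsI[where n = n]) (blast dest: mult_not_zero, blast dest: mult_not_zero, simp)
qed

lemma cochains_minus: "f \<in> cochains G H \<Longrightarrow> (\<lambda>xs. - f xs) \<in> cochains G H"
  using cochains_scale[of f G H "-1"] by simp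

lemma cochains_diff:
  "f \<in> cochains G H \<Longrightarrow> g \<in> cochains G H \<Longrightarrow> (\<lambda>xs. f xs - g xs) \<in> cochains G H"
  using cochains_add[OF _ cochains_minus] by simp

lemma cochains_sum:
  "(\<And>i. i \<in> I \<Longrightarrow> f i \<in> cochains G H) \<Longrightarrow> (\<lambda>xs. \<Sum>i\<in>I. f i xs) \<in> cochains G H"
  by (induction I rule: infinite_finite_induct) (auto intro: cochains_add)

lemma sgn_cochain_zero [simp]: "sgn_cochain (\<lambda>_. 0) = (\<lambda>_. 0)"
  by (simp add: sgn_cochain_def fun_eq_iff)

lemma sgn_cochain_in_cochains:
  assumes "f \<in> cochains G H"
  shows "sgn_cochain f \<in> cochains G H"
proof -
  obtain n where "\<And>xs. f xs \<noteq> 0 \<Longrightarrow> length xs \<le> n"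
    using assms by (metis cochains_bounded)
  then show ?thesis
    using cochains_support[OF assms] cochains_invariant[OF assms]
    by (intro cochainsI[where n = n]) (unfold sgn_cochain_def neg_equal_0_iff_equal,
        blast dest: mult_not_zero, blast dest: mult_not_zero, simp)
qed

lemma coboundary_in_cochains:
  assumes G: "group G" and H: "H \<subseteq> carrier G" and f: "f \<in> cochains G H"
  shows "coboundary G f \<in> cochains G H"
proof -
  obtain n where n: "\<And>xs. f xs \<noteq> 0 \<Longrightarrow> length xs \<le> n"
    using f by (metis cochains_bounded)
  show ?thesis
  proof (rule cochainsI)
    show "xs \<noteq> [] \<and> set xs \<subseteq> carrier G" if "coboundary G f xs \<noteq> 0" for xs
      using that by (auto simp: coboundary_eq_cobd split: if_splits)
    show "length xs \<le> Suc n" if "coboundary G f xs \<noteq> 0" for xs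
    proof (rule ccontr)
      assume "\<not> length xs \<le> Suc n"
      then have "cobd f xs = cobd (\<lambda>_. 0) xs"
        by (intro cobd_cong) (use n in force)
      then show False using that by (simp add: coboundary_eq_cobd split: if_splits)
    qed
    show "coboundary G f (map (\<lambda>x. h \<otimes>\<^bsub>G\<^esub> x) xs) = coboundary G f xs"
      if "h \<in> H" "set xs \<subseteq> carrier G" for h xs
    proof -
      have "set (map (\<lambda>x. h \<otimes>\<^bsub>G\<^esub> x) xs) \<subseteq> carrier G"
        using that H group.is_monoid[OF G] by (auto intro: monoid.m_closed)
      moreover have "cobd (\<lambda>ys. f (map (\<lambda>x. h \<otimes>\<^bsub>G\<^esub> x) ys)) xs = cobd f xs"
        by (rule cobd_cong) (use that cochains_invariant[OF f] in blast)
      ultimately show ?thesis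
        using that by (simp add: coboundary_eq_cobd cobd_map)
    qed
  qed
qed

lemma coboundary_coboundary: "coboundary G (coboundary G f) = (\<lambda>_. 0)"
proof
  fix xs
  have "cobd (coboundary G f) xs = cobd (cobd f) xs" if "set xs \<subseteq> carrier G"
    by (rule cobd_cong) (use that in \<open>auto simp: coboundary_eq_cobd\<close>)
  then show "coboundary G (coboundary G f) xs = 0"
    by (auto simp: coboundary_eq_cobd[of G "coboundary G f"] cobd_cobd)
qed

lemma coboundary_add:
  "coboundary G (\<lambda>xs. f xs + g xs) = (\<lambda>xs. coboundary G f xs + coboundary G g xs)"
  by (auto simp: coboundary_eq_cobd cobd_add fun_eq_iff)

lemma coboundary_diff:
  "coboundary G (\<lambda>xs. f xs - g xs) = (\<lambda>xs. coboundary G f xs - coboundary G g xs)"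
  by (auto simp: coboundary_eq_cobd cobd_diff fun_eq_iff)

lemma coboundary_scale: "coboundary G (\<lambda>xs. c * f xs) = (\<lambda>xs. c * coboundary G f xs)"
  by (auto simp: coboundary_eq_cobd cobd_scale fun_eq_iff)

lemma coboundary_minus: "coboundary G (\<lambda>xs. - f xs) = (\<lambda>xs. - coboundary G f xs)"
  by (auto simp: coboundary_eq_cobd cobd_minus fun_eq_iff)

lemma coboundary_zero [simp]: "coboundary G (\<lambda>_. 0) = (\<lambda>_. 0)"
  by (auto simp: coboundary_eq_cobd fun_eq_iff)

lemma coboundary_sum:
  "coboundary G (\<lambda>xs. \<Sum>i\<in>I. f i xs) = (\<lambda>xs. \<Sum>i\<in>I. coboundary G (f i) xs)"
  by (auto simp: coboundary_eq_cobd cobd_sum fun_eq_iff)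

lemma coboundary_sgn_cochain:
  "coboundary G (sgn_cochain f) = (\<lambda>xs. - sgn_cochain (coboundary G f) xs)"
  by (auto simp: coboundary_eq_cobd cobd_sgn_cochain fun_eq_iff sgn_cochain_def)

lemma cup_zero [simp]: "cup (\<lambda>_. 0) g = (\<lambda>_. 0)" "cup f (\<lambda>_. 0) = (\<lambda>_. 0)"
  by (simp_all add: cup_def)

lemma cup_nonzeroE:
  assumes "cup f g xs \<noteq> 0"
  obtains i where "i < length xs" "f (take (Suc i) xs) \<noteq> 0" "g (drop i xs) \<noteq> 0"
proof -
  obtain i where "i < length xs" "f (take (Suc i) xs) * g (drop i xs) \<noteq> 0"
    using assms unfolding cup_def by (meson sum.not_neutral_contains_not_neutral lessThan_iff)
  then show ?thesis using that[of i] mult_not_zero by blast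
qed

lemma cup_support:
  assumes f: "f \<in> cochains G H" and g: "g \<in> cochains G H" and "cup f g xs \<noteq> 0"
  shows "xs \<noteq> [] \<and> set xs \<subseteq> carrier G"
proof -
  obtain i where i: "i < length xs" "f (take (Suc i) xs) \<noteq> 0" "g (drop i xs) \<noteq> 0"
    using cup_nonzeroE assms(3) by metis
  have "set (take i xs) \<subseteq> set (take (Suc i) xs)" by (rule set_take_subset_set_take) simp
  moreover have "set xs = set (take i xs) \<union> set (drop i xs)"
    by (metis append_take_drop_id set_append)
  ultimately show ?thesis
    using cochains_support[OF f i(2)] cochains_support[OF g i(3)] i(1) by auto
qed

lemma cup_in_cochains:
  assumes f: "f \<in> cochains G H" and g: "g \<in> cochains G H"
  shows "cup f g \<in> cochains G H"
proof -
  obtain n m where n: "\<And>xs. f xs \<noteq> 0 \<Longrightarrow> length xs \<le> n" and m: "\<And>xs. g xs \<noteq> 0 \<Longrightarrow> length xs \<le> m"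
    using f g by (metis cochains_bounded)
  show ?thesis
  proof (rule cochainsI)
    show "length xs \<le> n + m" if "cup f g xs \<noteq> 0" for xs
    proof -
      obtain i where "i < length xs" "f (take (Suc i) xs) \<noteq> 0" "g (drop i xs) \<noteq> 0"
        using cup_nonzeroE \<open>cup f g xs \<noteq> 0\<close> by metis
      then show ?thesis using n[of "take (Suc i) xs"] m[of "drop i xs"] by auto
    qed
    show "cup f g (map (\<lambda>x. h \<otimes>\<^bsub>G\<^esub> x) xs) = cup f g xs"
      if "h \<in> H" "set xs \<subseteq> carrier G" for h xs
      unfolding cup_map[symmetric]
      using that cochains_invariant[OF f] cochains_invariant[OF g] by (intro cup_cong) blast+
  qed (use cup_support[OF assms] in blast)
qed

lemma coboundary_cup:
  assumes f: "f \<in> cochains G H" and g: "g \<in> cochains G H" and G: "group G" and H: "H \<subseteq> carrier G"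
  shows "coboundary G (cup f g)
    = (\<lambda>xs. cup (coboundary G f) g xs + cup (sgn_cochain f) (coboundary G g) xs)"
proof
  fix xs
  show "coboundary G (cup f g) xs
    = cup (coboundary G f) g xs + cup (sgn_cochain f) (coboundary G g) xs"
  proof (cases "set xs \<subseteq> carrier G")
    case True
    then have "cup (coboundary G f) g xs = cup (cobd f) g xs"
      "cup (sgn_cochain f) (coboundary G g) xs = cup (sgn_cochain f) (cobd g) xs"
      by (auto intro!: cup_cong simp: coboundary_eq_cobd)
    then show ?thesis
      using True f by (simp add: coboundary_eq_cobd cobd_cup[where g = g, OF cochains_Nil[OF g]])
  next
    case False
    then have "cup (coboundary G f) g xs = 0" "cup (sgn_cochain f) (coboundary G g) xs = 0"
      using cup_support coboundary_in_cochains[OF G H] f g sgn_cochain_in_cochains by metis+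
    then show ?thesis using False by (simp add: coboundary_eq_cobd)
  qed
qed

lemma cochain_const_in_cochains:
  assumes "group G"
  shows "cochain_const G c \<in> cochains G (carrier G)"
  using assms
  by (intro cochainsI[where n = 1]) (auto simp: cochain_const_def split: if_splits
        intro: monoid.m_closed[OF group.is_monoid])

lemma cup_const_left: "f \<in> cochains G H \<Longrightarrow> cup (cochain_const G c) f = (\<lambda>xs. c * f xs)"
proof
  fix xs assume f: "f \<in> cochains G H"
  show "cup (cochain_const G c) f xs = c * f xs"
  proof (cases xs)
    case (Cons x ys)
    have "cup (\<lambda>zs. cochain_const G c (x # zs)) f ys = 0"
      unfolding cup_def by (rule sum.neutral) (auto simp: cochain_const_def)
    moreover have "x \<in> carrier G \<or> f xs = 0" using cochains_support[OF f, of xs] Cons by auto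
    ultimately show ?thesis using Cons by (auto simp: cochain_const_def)
  qed (use f in simp)
qed

lemma cup_const_right: "f \<in> cochains G H \<Longrightarrow> cup f (cochain_const G c) = (\<lambda>xs. f xs * c)"
proof
  fix xs assume f: "f \<in> cochains G H"
  have *: "cup f (cochain_const G c) ys = f ys * c" if "ys \<noteq> []" "set ys \<subseteq> carrier G" for f ys
    using that
  proof (induction ys arbitrary: f)
    case (Cons x ys)
    then show ?case by (cases ys) (auto simp: cochain_const_def)
  qed simp
  show "cup f (cochain_const G c) xs = f xs * c"
  proof (cases "xs \<noteq> [] \<and> set xs \<subseteq> carrier G")
    case True
    then show ?thesis using * by blast
  next
    case False
    have "f (take (Suc i) xs) * cochain_const G c (drop i xs) = 0" if "i < length xs" for i
    proof (rule ccontr)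
      assume "f (take (Suc i) xs) * cochain_const G c (drop i xs) \<noteq> 0"
      then have "f (take (Suc i) xs) \<noteq> 0" "length (drop i xs) = 1"
        by (auto simp: cochain_const_def split: if_splits)
      then show False using cochains_support[OF f, of "take (Suc i) xs"] False by auto
    qed
    then have "cup f (cochain_const G c) xs = 0"
      unfolding cup_def by (intro sum.neutral) auto
    moreover have "f xs = 0" using False cochains_support[OF f, of xs] by blast
    ultimately show ?thesis by simp
  qed
qed

lemma coboundary_const [simp]: "coboundary G (cochain_const G c) = (\<lambda>_. 0)"
proof
  fix xs
  show "coboundary G (cochain_const G c) xs = 0"
  proof (cases "set xs \<subseteq> carrier G")
    case True
    have "cobd (cochain_const G c) xs = 0"
    proof (cases "length xs = 2")
      case True
      then obtain x y where "xs = [x, y]" by (auto simp: length_Suc_conv numeral_2_eq_2)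
      then show ?thesis using \<open>set xs \<subseteq> carrier G\<close> by (simp add: cochain_const_def)
    next
      case False
      then have "cobd (cochain_const G c) xs = cobd (\<lambda>_. 0) xs"
        by (intro cobd_cong) (auto simp: cochain_const_def)
      then show ?thesis by simp
    qed
    then show ?thesis by (simp add: coboundary_eq_cobd)
  qed (simp add: coboundary_eq_cobd)
qed

lemma carrier_cocycle_ring:
  "f \<in> carrier (cocycle_ring G) \<longleftrightarrow> f \<in> cochains G (carrier G) \<and> coboundary G f = (\<lambda>_. 0)"
  by (simp add: cocycle_ring_def)

lemma cocycle_ring_simps [simp]:
  "f \<otimes>\<^bsub>cocycle_ring G\<^esub> g = cup f g" "\<one>\<^bsub>cocycle_ring G\<^esub> = cochain_const G 1"
  "\<zero>\<^bsub>cocycle_ring G\<^esub> = (\<lambda>_. 0)" "f \<oplus>\<^bsub>cocycle_ring G\<^esub> g = (\<lambda>xs. f xs + g xs)"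
  by (simp_all add: cocycle_ring_def)

lemma cup_cocycle:
  assumes "group G" "f \<in> carrier (cocycle_ring G)" "g \<in> carrier (cocycle_ring G)"
  shows "cup f g \<in> carrier (cocycle_ring G)"
  using assms
  by (auto simp: carrier_cocycle_ring cup_in_cochains coboundary_cup[OF _ _ assms(1)])

lemma ring_cocycle_ring:
  fixes G :: "('g, 'b) monoid_scheme"
  assumes G: "group G"
  shows "ring (cocycle_ring G :: ('g, 'a::comm_ring_1) cochain ring)"
proof (rule ringI)
  show "abelian_group (cocycle_ring G :: ('g, 'a) cochain ring)"
  proof (rule abelian_groupI)
    show "\<exists>y\<in>carrier (cocycle_ring G). y \<oplus>\<^bsub>cocycle_ring G\<^esub> x = \<zero>\<^bsub>cocycle_ring G\<^esub>"
      if "x \<in> carrier (cocycle_ring G)" for x :: "('g, 'a) cochain"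
      using that by (intro bexI[of _ "\<lambda>xs. - x xs"])
        (auto simp: carrier_cocycle_ring cochains_minus coboundary_minus)
  qed (auto simp: carrier_cocycle_ring cochains_add coboundary_add algebra_simps)
  show "Group.monoid (cocycle_ring G :: ('g, 'a) cochain ring)"
  proof (rule monoidI)
    show "\<one>\<^bsub>cocycle_ring G\<^esub> \<in> carrier (cocycle_ring G :: ('g, 'a) cochain ring)"
      using cochain_const_in_cochains[OF G] by (simp add: carrier_cocycle_ring)
    show "\<one>\<^bsub>cocycle_ring G\<^esub> \<otimes>\<^bsub>cocycle_ring G\<^esub> x = x" if "x \<in> carrier (cocycle_ring G)"
      for x :: "('g, 'a) cochain"
      using that cup_const_left by (fastforce simp: carrier_cocycle_ring)
    show "x \<otimes>\<^bsub>cocycle_ring G\<^esub> \<one>\<^bsub>cocycle_ring G\<^esub> = x" if "x \<in> carrier (cocycle_ring G)"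
      for x :: "('g, 'a) cochain"
      using that cup_const_right by (fastforce simp: carrier_cocycle_ring)
  qed (auto simp: cup_cocycle[OF G] cup_assoc fun_eq_iff)
qed (auto simp: cup_add_left cup_add_right fun_eq_iff)

lemma coboundariesI: "h \<in> cochains G (carrier G) \<Longrightarrow> f = coboundary G h \<Longrightarrow> f \<in> coboundaries G"
  by (auto simp: coboundaries_def)

lemma coboundariesE:
  assumes "f \<in> coboundaries G"
  obtains h where "h \<in> cochains G (carrier G)" "f = coboundary G h"
  using assms by (auto simp: coboundaries_def)

lemma coboundaries_add:
  "f \<in> coboundaries G \<Longrightarrow> g \<in> coboundaries G \<Longrightarrow> (\<lambda>xs. f xs + g xs) \<in> coboundaries G"
  by (auto simp: coboundaries_def simp flip: coboundary_add intro: cochains_add)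

lemma coboundaries_diff:
  "f \<in> coboundaries G \<Longrightarrow> g \<in> coboundaries G \<Longrightarrow> (\<lambda>xs. f xs - g xs) \<in> coboundaries G"
  by (auto simp: coboundaries_def simp flip: coboundary_diff intro: cochains_diff)

lemma coboundaries_minus: "f \<in> coboundaries G \<Longrightarrow> (\<lambda>xs. - f xs) \<in> coboundaries G"
  by (auto simp: coboundaries_def simp flip: coboundary_minus intro: cochains_minus)

lemma coboundaries_scale: "f \<in> coboundaries G \<Longrightarrow> (\<lambda>xs. c * f xs) \<in> coboundaries G"
  by (auto simp: coboundaries_def simp flip: coboundary_scale intro: cochains_scale)

lemma coboundaries_zero [simp]: "(\<lambda>_. 0) \<in> coboundaries G"
  by (auto intro!: coboundariesI[of "\<lambda>_. 0"])

lemma coboundaries_sum: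
  "(\<And>i. i \<in> I \<Longrightarrow> f i \<in> coboundaries G) \<Longrightarrow> (\<lambda>xs. \<Sum>i\<in>I. f i xs) \<in> coboundaries G"
  by (induction I rule: infinite_finite_induct) (auto intro: coboundaries_add)

lemma coboundaries_subset: "group G \<Longrightarrow> coboundaries G \<subseteq> carrier (cocycle_ring G)"
  by (auto simp: coboundaries_def carrier_cocycle_ring coboundary_coboundary coboundary_in_cochains)

lemma ideal_coboundaries:
  fixes G :: "('g, 'b) monoid_scheme"
  assumes G: "group G"
  shows "ideal (coboundaries G :: ('g, 'a::comm_ring_1) cochain set) (cocycle_ring G)"
proof (rule idealI)
  interpret ring "cocycle_ring G :: ('g, 'a) cochain ring" by (rule ring_cocycle_ring[OF G])
  have minus: "inv\<^bsub>add_monoid (cocycle_ring G)\<^esub> f = (\<lambda>xs. - f xs)"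
    if "f \<in> carrier (cocycle_ring G)" for f :: "('g, 'a) cochain"
  proof -
    have "(\<lambda>xs. - f xs) \<in> carrier (cocycle_ring G)"
      using that by (auto simp: carrier_cocycle_ring cochains_minus coboundary_minus)
    then have "\<ominus>\<^bsub>cocycle_ring G\<^esub> f = (\<lambda>xs. - f xs)"
      using that by (intro minus_equality) auto
    then show ?thesis by (simp add: a_inv_def)
  qed
  show "subgroup (coboundaries G) (add_monoid (cocycle_ring G :: ('g, 'a) cochain ring))"
    using coboundaries_subset[OF G] minus
    by unfold_locales (auto simp: coboundaries_add coboundaries_minus subset_iff)
  fix a f :: "('g, 'a) cochain"
  assume a: "a \<in> coboundaries G" and f: "f \<in> carrier (cocycle_ring G)"
  obtain h where h: "h \<in> cochains G (carrier G)" "a = coboundary G h"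
    using a by (rule coboundariesE)
  have f': "f \<in> cochains G (carrier G)" "coboundary G f = (\<lambda>_. 0)"
    using f by (auto simp: carrier_cocycle_ring)
  \<comment> \<open>A cochain may mix degrees, so no single sign can be factored out of the Leibniz
    rule; twisting the left factor by \<open>sgn_cochain\<close> absorbs it degree by
    degree.\<close>
  have "coboundary G (cup (sgn_cochain f) h) = cup f a"
    using coboundary_cup[OF sgn_cochain_in_cochains[OF f'(1)] h(1) G] f'(2) h(2)
    by (simp add: coboundary_sgn_cochain)
  then show "f \<otimes>\<^bsub>cocycle_ring G\<^esub> a \<in> coboundaries G"
    by (metis coboundariesI cocycle_ring_simps(1) cup_in_cochains f'(1) h(1) sgn_cochain_in_cochains)
  have "coboundary G (cup h f) = cup a f"
    using coboundary_cup[OF h(1) f'(1) G] f'(2) h(2) by simp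
  then show "a \<otimes>\<^bsub>cocycle_ring G\<^esub> f \<in> coboundaries G"
    by (metis coboundariesI cocycle_ring_simps(1) cup_in_cochains f'(1) h(1))
qed (rule ring_cocycle_ring[OF G])

lemma ring_cohom_ring: "group G \<Longrightarrow> ring (cohom_ring G)"
  unfolding cohom_ring_def by (rule ideal.quotient_is_ring[OF ideal_coboundaries])

lemma cohom_class_ring_hom:
  "group G \<Longrightarrow> ring_hom_ring (cocycle_ring G) (cohom_ring G) (cohom_class G)"
  unfolding cohom_ring_def cohom_class_def by (rule ideal.rcos_ring_hom_ring[OF ideal_coboundaries])

lemma cohom_class_mem:
  "g \<in> cohom_class G f \<longleftrightarrow> (\<lambda>xs. g xs - f xs) \<in> coboundaries G"
proof -
  have "g = (\<lambda>xs. h xs + f xs) \<longleftrightarrow> h = (\<lambda>xs. g xs - f xs)" for h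
    by (auto simp: fun_eq_iff algebra_simps)
  then show ?thesis
    by (auto simp: cohom_class_def a_r_coset_def r_coset_def)
qed

lemma cohom_class_eq_iff:
  "cohom_class G f = cohom_class G g \<longleftrightarrow> (\<lambda>xs. f xs - g xs) \<in> coboundaries G"
proof
  assume "cohom_class G f = cohom_class G g"
  moreover have "f \<in> cohom_class G f" by (simp add: cohom_class_mem)
  ultimately show "(\<lambda>xs. f xs - g xs) \<in> coboundaries G"
    by (simp add: cohom_class_mem)
next
  assume *: "(\<lambda>xs. f xs - g xs) \<in> coboundaries G"
  have "(\<lambda>xs. h xs - f xs) \<in> coboundaries G \<longleftrightarrow> (\<lambda>xs. h xs - g xs) \<in> coboundaries G" for h
    using coboundaries_add[OF * , of "\<lambda>xs. h xs - f xs"] coboundaries_diff[OF _ *, of "\<lambda>xs. h xs - g xs"]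
    by auto
  then show "cohom_class G f = cohom_class G g"
    by (auto simp: cohom_class_mem)
qed

lemma carrier_cohom_ring: "carrier (cohom_ring G) = cohom_class G ` carrier (cocycle_ring G)"
  by (auto simp: cohom_ring_def FactRing_def A_RCOSETS_def RCOSETS_def cohom_class_def a_r_coset_def)

lemma zero_cohom_ring: "\<zero>\<^bsub>cohom_ring G\<^esub> = coboundaries G"
  by (simp add: cohom_ring_def FactRing_def)

lemma cohom_class_eq_zero_iff:
  fixes G :: "('g, 'b) monoid_scheme" and f :: "('g, 'a::comm_ring_1) cochain"
  shows "cohom_class G f = \<zero>\<^bsub>cohom_ring G\<^esub> \<longleftrightarrow> f \<in> coboundaries G"
proof -
  have "\<zero>\<^bsub>cohom_ring G\<^esub> = cohom_class G (\<lambda>_::'g list. 0::'a)"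
    by (auto simp: zero_cohom_ring cohom_class_mem)
  then show ?thesis by (simp add: cohom_class_eq_iff)
qed

section \<open>Change of groups and homotopy invariance\<close>

lemma cochain_pullback_in_cochains:
  assumes f: "f \<in> cochains G H" and \<phi>: "\<phi> \<in> carrier E \<rightarrow> carrier G"
    and E: "group E" "S \<subseteq> carrier E"
    and eq: "\<And>e. e \<in> S \<Longrightarrow> \<exists>h\<in>H. \<forall>x\<in>carrier E. \<phi> (e \<otimes>\<^bsub>E\<^esub> x) = h \<otimes>\<^bsub>G\<^esub> \<phi> x"
  shows "cochain_pullback E \<phi> f \<in> cochains E S"
proof -
  obtain n where n: "\<And>xs. f xs \<noteq> 0 \<Longrightarrow> length xs \<le> n"
    using f by (metis cochains_bounded)
  show ?thesis
  proof (rule cochainsI)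
    show "xs \<noteq> [] \<and> set xs \<subseteq> carrier E" if "cochain_pullback E \<phi> f xs \<noteq> 0" for xs
      using that f by (auto simp: cochain_pullback_def split: if_splits)
    show "length xs \<le> n" if "cochain_pullback E \<phi> f xs \<noteq> 0" for xs
      using that n[of "map \<phi> xs"] by (auto simp: cochain_pullback_def split: if_splits)
    show "cochain_pullback E \<phi> f (map (\<lambda>x. e \<otimes>\<^bsub>E\<^esub> x) xs) = cochain_pullback E \<phi> f xs"
      if e: "e \<in> S" and xs: "set xs \<subseteq> carrier E" for e xs
    proof -
      obtain h where h: "h \<in> H" "\<And>x. x \<in> carrier E \<Longrightarrow> \<phi> (e \<otimes>\<^bsub>E\<^esub> x) = h \<otimes>\<^bsub>G\<^esub> \<phi> x"
        using eq[OF e] by blast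
      have "set (map (\<lambda>x. e \<otimes>\<^bsub>E\<^esub> x) xs) \<subseteq> carrier E"
        using e xs E monoid.m_closed[OF group.is_monoid[OF E(1)]] by auto
      moreover have "map \<phi> (map (\<lambda>x. e \<otimes>\<^bsub>E\<^esub> x) xs) = map (\<lambda>x. h \<otimes>\<^bsub>G\<^esub> x) (map \<phi> xs)"
        using xs h(2) by auto
      moreover have "set (map \<phi> xs) \<subseteq> carrier G" using xs \<phi> by auto
      ultimately show ?thesis
        using cochains_invariant[OF f h(1), of "map \<phi> xs"] xs
        by (simp add: cochain_pullback_def del: map_map)
    qed
  qed
qed

lemma coboundary_pullback:
  assumes \<phi>: "\<phi> \<in> carrier E \<rightarrow> carrier G"
  shows "coboundary E (cochain_pullback E \<phi> f) = cochain_pullback E \<phi> (coboundary G f)"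
proof
  fix xs
  show "coboundary E (cochain_pullback E \<phi> f) xs = cochain_pullback E \<phi> (coboundary G f) xs"
  proof (cases "set xs \<subseteq> carrier E")
    case True
    have "cobd (cochain_pullback E \<phi> f) xs = cobd (\<lambda>ys. f (map \<phi> ys)) xs"
      by (rule cobd_cong) (use True in \<open>auto simp: cochain_pullback_def\<close>)
    moreover have "set (map \<phi> xs) \<subseteq> carrier G" using True \<phi> by auto
    ultimately show ?thesis
      using True by (simp add: coboundary_eq_cobd cobd_map cochain_pullback_def)
  qed (simp add: coboundary_eq_cobd cochain_pullback_def)
qed

lemma cochain_pullback_zero [simp]: "cochain_pullback E \<phi> (\<lambda>_. 0) = (\<lambda>_. 0)"
  by (simp add: cochain_pullback_def)

lemma cochain_pullback_diff:
  "cochain_pullback E \<phi> (\<lambda>xs. f xs - g xs)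
    = (\<lambda>xs. cochain_pullback E \<phi> f xs - cochain_pullback E \<phi> g xs)"
  by (auto simp: cochain_pullback_def)

lemma cochain_pullback_cong:
  "(\<And>x. x \<in> carrier E \<Longrightarrow> \<phi> x = \<psi> x) \<Longrightarrow> cochain_pullback E \<phi> f = cochain_pullback E \<psi> f"
  unfolding cochain_pullback_def by (intro ext if_cong refl arg_cong[where f = f]) auto

lemma cochain_pullback_comp:
  "\<phi> \<in> carrier E \<rightarrow> carrier G
    \<Longrightarrow> cochain_pullback E \<phi> (cochain_pullback G \<psi> f) = cochain_pullback E (\<lambda>x. \<psi> (\<phi> x)) f"
  by (auto simp: cochain_pullback_def fun_eq_iff comp_def)

lemma cochain_pullback_hom:
  assumes "group E" "group G" "\<phi> \<in> hom E G" "f \<in> cochains G (carrier G)"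
  shows "cochain_pullback E \<phi> f \<in> cochains E (carrier E)"
  using assms by (intro cochain_pullback_in_cochains[OF assms(4)]) (auto simp: hom_def)

lemma cochain_pullback_cocycle:
  assumes "group E" "group G" "\<phi> \<in> hom E G" "f \<in> carrier (cocycle_ring G)"
  shows "cochain_pullback E \<phi> f \<in> carrier (cocycle_ring E)"
proof -
  have "\<phi> \<in> carrier E \<rightarrow> carrier G" using assms(3) by (simp add: hom_def)
  then show ?thesis
    using assms cochain_pullback_hom[OF assms(1-3)]
    by (auto simp: carrier_cocycle_ring coboundary_pullback[where G = G])
qed

lemma cochain_pullback_coboundaries:
  assumes "group E" "group G" "\<phi> \<in> hom E G" "f \<in> coboundaries G"
  shows "cochain_pullback E \<phi> f \<in> coboundaries E"
proof -
  obtain h where "h \<in> cochains G (carrier G)" "f = coboundary G h"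
    using assms(4) by (rule coboundariesE)
  moreover have "\<phi> \<in> carrier E \<rightarrow> carrier G" using assms(3) by (simp add: hom_def)
  ultimately show ?thesis
    using cochain_pullback_hom[OF assms(1-3)]
    by (auto intro!: coboundariesI simp: coboundary_pullback[where G = G])
qed

lemma cohom_map_class:
  assumes "group E" "group G" "\<phi> \<in> hom E G"
  shows "cohom_map E \<phi> (cohom_class G f) = cohom_class E (cochain_pullback E \<phi> f)"
proof -
  have "cohom_class E (cochain_pullback E \<phi> g) = cohom_class E (cochain_pullback E \<phi> f)"
    if "g \<in> cohom_class G f" for g
    using cochain_pullback_coboundaries[OF assms] that
    by (simp add: cohom_class_eq_iff cohom_class_mem flip: cochain_pullback_diff)
  moreover have "f \<in> cohom_class G f" by (simp add: cohom_class_mem)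
  ultimately have "(\<lambda>g. cohom_class E (cochain_pullback E \<phi> g)) ` cohom_class G f
      = {cohom_class E (cochain_pullback E \<phi> f)}" by blast
  then show ?thesis by (simp add: cohom_map_def)
qed

text \<open>The prism operator preserves invariance because the same h in \<open>H\<close> governs
  both maps for a given e. The maps need not be homomorphisms: the lemma is applied to a coset
  retraction, to a linear projection and to a left translate of a homomorphism.\<close>

lemma cochain_pullback_homotopy:
  assumes u: "u \<in> cochains G H" "coboundary G u = (\<lambda>_. 0)"
    and \<alpha>: "\<alpha> \<in> carrier E \<rightarrow> carrier G" and \<beta>: "\<beta> \<in> carrier E \<rightarrow> carrier G"
    and E: "group E" "S \<subseteq> carrier E"
    and eq: "\<And>e. e \<in> S \<Longrightarrow> \<exists>h\<in>H. \<forall>x\<in>carrier E.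
      \<alpha> (e \<otimes>\<^bsub>E\<^esub> x) = h \<otimes>\<^bsub>G\<^esub> \<alpha> x \<and> \<beta> (e \<otimes>\<^bsub>E\<^esub> x) = h \<otimes>\<^bsub>G\<^esub> \<beta> x"
  obtains k where "k \<in> cochains E S"
    "\<And>xs. cochain_pullback E \<beta> u xs - cochain_pullback E \<alpha> u xs = coboundary E k xs"
proof -
  define k where "k = (\<lambda>xs. if set xs \<subseteq> carrier E then prism \<alpha> \<beta> u xs else 0)"
  obtain n where n: "\<And>xs. u xs \<noteq> 0 \<Longrightarrow> length xs \<le> n"
    using u(1) by (metis cochains_bounded)
  have "k \<in> cochains E S"
  proof (rule cochainsI)
    show "xs \<noteq> [] \<and> set xs \<subseteq> carrier E" if "k xs \<noteq> 0" for xs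
      using that by (cases xs) (auto simp: k_def split: if_splits)
    show "length xs \<le> n" if "k xs \<noteq> 0" for xs
      using that prism_bounded[where f = u and xs = xs and n = n, OF n] by (auto simp: k_def split: if_splits)
    show "k (map (\<lambda>x. e \<otimes>\<^bsub>E\<^esub> x) xs) = k xs" if e: "e \<in> S" and xs: "set xs \<subseteq> carrier E" for e xs
    proof -
      obtain h where h: "h \<in> H" "\<And>x. x \<in> carrier E \<Longrightarrow>
        \<alpha> (e \<otimes>\<^bsub>E\<^esub> x) = h \<otimes>\<^bsub>G\<^esub> \<alpha> x \<and> \<beta> (e \<otimes>\<^bsub>E\<^esub> x) = h \<otimes>\<^bsub>G\<^esub> \<beta> x"
        using eq[OF e] by blast
      have "set (map (\<lambda>x. e \<otimes>\<^bsub>E\<^esub> x) xs) \<subseteq> carrier E"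
        using e xs E monoid.m_closed[OF group.is_monoid[OF E(1)]] by auto
      moreover have "prism \<alpha> \<beta> u (map (\<lambda>x. e \<otimes>\<^bsub>E\<^esub> x) xs) = prism \<alpha> \<beta> u xs"
      proof (rule prism_equivariant)
        show "u (map (\<lambda>x. h \<otimes>\<^bsub>G\<^esub> x) ys) = u ys" if "set ys \<subseteq> \<alpha> ` set xs \<union> \<beta> ` set xs" for ys
          using cochains_invariant[OF u(1) h(1)] that xs \<alpha> \<beta> by blast
      qed (use h xs in auto)
      ultimately show ?thesis using xs by (simp add: k_def)
    qed
  qed
  moreover have "cochain_pullback E \<beta> u xs - cochain_pullback E \<alpha> u xs = coboundary E k xs" for xs
  proof (cases "set xs \<subseteq> carrier E")
    case True
    have "cobd k xs = cobd (prism \<alpha> \<beta> u) xs"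
      by (rule cobd_cong) (use True in \<open>auto simp: k_def\<close>)
    moreover have "prism \<alpha> \<beta> (cobd u) xs = prism \<alpha> \<beta> (\<lambda>ys. u ys - u ys) xs"
    proof (rule prism_cong)
      fix ys assume "set ys \<subseteq> \<alpha> ` set xs \<union> \<beta> ` set xs"
      then have "set ys \<subseteq> carrier G" using True \<alpha> \<beta> by blast
      then show "cobd u ys = u ys - u ys"
        using fun_cong[OF u(2), of ys] by (simp add: coboundary_eq_cobd)
    qed
    ultimately show ?thesis
      using True cobd_prism[of \<alpha> \<beta> u xs] by (simp only: prism_diff) (simp add: coboundary_eq_cobd cochain_pullback_def)
  qed (simp add: coboundary_eq_cobd cochain_pullback_def)
  ultimately show ?thesis using that by blast
qed

section \<open>The transfer\<close>

text \<open>As a left \<open>H\<close>-set, \<open>G\<close> is free on coset representatives, so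
  dividing x by the representative of its right coset is an equivariant map onto \<open>H\<close>.
  Pullback along it links the two cochain models for the cohomology of \<open>H\<close>.\<close>

lemma subgroup_retraction:
  assumes G: "group G" and H: "subgroup H G"
  obtains r where "r \<in> carrier G \<rightarrow> H" "\<And>h x. h \<in> H \<Longrightarrow> x \<in> carrier G \<Longrightarrow> r (h \<otimes>\<^bsub>G\<^esub> x) = h \<otimes>\<^bsub>G\<^esub> r x"
    "\<And>h. h \<in> H \<Longrightarrow> r h = h"
proof -
  interpret group G by fact
  interpret subgroup H G by fact
  \<comment> \<open>Representing \<open>H\<close> itself by the unit makes the retraction the
    identity on \<open>H\<close>.\<close>
  define rep where "rep K = (if K = H then \<one>\<^bsub>G\<^esub> else SOME t. t \<in> K)" for K
  define r where "r x = x \<otimes>\<^bsub>G\<^esub> inv\<^bsub>G\<^esub> (rep (H #>\<^bsub>G\<^esub> x))" for x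
  have rep: "rep (H #>\<^bsub>G\<^esub> x) \<in> H #>\<^bsub>G\<^esub> x" if "x \<in> carrier G" for x
    using that rcos_self[OF that H] by (auto simp: rep_def intro: someI)
  show ?thesis
  proof
    show "r \<in> carrier G \<rightarrow> H"
    proof
      fix x assume x: "x \<in> carrier G"
      then obtain h where h: "h \<in> H" "rep (H #>\<^bsub>G\<^esub> x) = h \<otimes>\<^bsub>G\<^esub> x"
        using rep[OF x] by (auto simp: r_coset_def)
      then have "r x = inv\<^bsub>G\<^esub> h"
        using x by (simp add: r_def inv_mult_group flip: m_assoc)
      then show "r x \<in> H" using h by simp
    qed
    show "r (h \<otimes>\<^bsub>G\<^esub> x) = h \<otimes>\<^bsub>G\<^esub> r x" if "h \<in> H" "x \<in> carrier G" for h x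
    proof -
      have "H #>\<^bsub>G\<^esub> (h \<otimes>\<^bsub>G\<^esub> x) = H #>\<^bsub>G\<^esub> x"
        using that coset_mult_assoc[OF subset, of h x] rcos_const[OF G] by simp
      moreover have "rep (H #>\<^bsub>G\<^esub> x) \<in> carrier G"
        using rep[OF that(2)] r_coset_subset_G[OF subset that(2)] by blast
      ultimately show ?thesis using that by (simp add: r_def m_assoc)
    qed
    show "r h = h" if "h \<in> H" for h
      using that rcos_const[OF G that] by (simp add: r_def rep_def)
  qed
qed

text \<open>Surjectivity of the comparison of the two models, already for cocycles and with the
  degree preserved: the extension is the pullback along the retraction.\<close>

lemma cocycle_extension:
  assumes G: "group G" and H: "subgroup H G"
    and f: "f \<in> carrier (cocycle_ring (G\<lparr>carrier := H\<rparr>))"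
    and len: "\<And>xs. f xs \<noteq> 0 \<Longrightarrow> length xs = n"
  obtains u where "u \<in> cochains G H" "coboundary G u = (\<lambda>_. 0)"
    "cochain_pullback (G\<lparr>carrier := H\<rparr>) (\<lambda>x. x) u = f"
    "\<And>xs. u xs \<noteq> 0 \<Longrightarrow> length xs = n"
proof -
  obtain r where r: "r \<in> carrier G \<rightarrow> H" "\<And>h x. h \<in> H \<Longrightarrow> x \<in> carrier G \<Longrightarrow> r (h \<otimes>\<^bsub>G\<^esub> x) = h \<otimes>\<^bsub>G\<^esub> r x"
    "\<And>h. h \<in> H \<Longrightarrow> r h = h"
    using subgroup_retraction[OF G H] by blast
  have f': "f \<in> cochains (G\<lparr>carrier := H\<rparr>) H" "coboundary (G\<lparr>carrier := H\<rparr>) f = (\<lambda>_. 0)"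
    using f by (auto simp: carrier_cocycle_ring)
  have HG: "H \<subseteq> carrier G" using H by (rule subgroup.subset)
  have r': "r \<in> carrier G \<rightarrow> carrier (G\<lparr>carrier := H\<rparr>)" using r(1) by simp
  show ?thesis
  proof
    show "cochain_pullback G r f \<in> cochains G H"
      by (rule cochain_pullback_in_cochains[OF f'(1) r' G HG]) (use r(2) in auto)
    show "coboundary G (cochain_pullback G r f) = (\<lambda>_. 0)"
      by (simp add: coboundary_pullback[OF r'] f'(2))
    show "cochain_pullback (G\<lparr>carrier := H\<rparr>) (\<lambda>x. x) (cochain_pullback G r f) = f"
    proof
      fix xs
      have "map r xs = xs" if "set xs \<subseteq> H" using that r(3) by (intro map_idI) auto
      then show "cochain_pullback (G\<lparr>carrier := H\<rparr>) (\<lambda>x. x) (cochain_pullback G r f) xs = f xs"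
        using HG cochains_support[OF f'(1), of xs] by (auto simp: cochain_pullback_def)
    qed
  next
    fix xs assume "cochain_pullback G r f xs \<noteq> 0"
    then show "length xs = n" using len[of "map r xs"] by (auto simp: cochain_pullback_def split: if_splits)
  qed
qed

text \<open>Injectivity of the comparison of the two models: the identity of \<open>G\<close> and
  the retraction are both \<open>H\<close>-equivariant, so u is homotopic to the pullback of its own
  restriction to \<open>H\<close>.\<close>

lemma coboundary_if_restriction_coboundary:
  assumes G: "group G" and H: "subgroup H G"
    and u: "u \<in> cochains G H" "coboundary G u = (\<lambda>_. 0)"
    and res: "cochain_pullback (G\<lparr>carrier := H\<rparr>) (\<lambda>x. x) u \<in> coboundaries (G\<lparr>carrier := H\<rparr>)"
  obtains k where "k \<in> cochains G H" "u = coboundary G k"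
proof -
  obtain r where r: "r \<in> carrier G \<rightarrow> H" "\<And>h x. h \<in> H \<Longrightarrow> x \<in> carrier G \<Longrightarrow> r (h \<otimes>\<^bsub>G\<^esub> x) = h \<otimes>\<^bsub>G\<^esub> r x"
    using subgroup_retraction[OF G H] by metis
  have HG: "H \<subseteq> carrier G" using H by (rule subgroup.subset)
  have r': "r \<in> carrier G \<rightarrow> carrier (G\<lparr>carrier := H\<rparr>)" using r(1) by simp
  obtain w where w: "w \<in> cochains (G\<lparr>carrier := H\<rparr>) H"
    "cochain_pullback (G\<lparr>carrier := H\<rparr>) (\<lambda>x. x) u = coboundary (G\<lparr>carrier := H\<rparr>) w"
    using res by (auto elim: coboundariesE)
  have "cochain_pullback G r u
    = cochain_pullback G r (cochain_pullback (G\<lparr>carrier := H\<rparr>) (\<lambda>x. x) u)"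
    using r' by (simp add: cochain_pullback_comp[OF r'])
  also have "\<dots> = coboundary G (cochain_pullback G r w)"
    by (simp add: w(2) coboundary_pullback[OF r'])
  finally have 1: "cochain_pullback G r u = coboundary G (cochain_pullback G r w)" .
  have 2: "cochain_pullback G r w \<in> cochains G H"
    by (rule cochain_pullback_in_cochains[OF w(1) r' G HG]) (use r(2) in auto)
  have rG: "r \<in> carrier G \<rightarrow> carrier G" using r(1) HG by auto
  have "\<exists>h'\<in>H. \<forall>x\<in>carrier G. r (h \<otimes>\<^bsub>G\<^esub> x) = h' \<otimes>\<^bsub>G\<^esub> r x \<and> h \<otimes>\<^bsub>G\<^esub> x = h' \<otimes>\<^bsub>G\<^esub> x"
    if "h \<in> H" for h using that r(2) by blast
  then obtain k where k: "k \<in> cochains G H"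
    "\<And>xs. cochain_pullback G (\<lambda>x. x) u xs - cochain_pullback G r u xs = coboundary G k xs"
    using cochain_pullback_homotopy[OF u rG, of "\<lambda>x. x" H] G HG by auto
  have "cochain_pullback G (\<lambda>x. x) u = u"
    using cochains_support[OF u(1)] by (fastforce simp: cochain_pullback_def)
  then have "u = coboundary G (\<lambda>xs. cochain_pullback G r w xs + k xs)"
    using k(2) 1 by (auto simp: coboundary_add fun_eq_iff algebra_simps)
  then show ?thesis using that cochains_add[OF 2 k(1)] by blast
qed

lemma cochain_coset_rep:
  assumes G: "group G" and H: "subgroup H G" and u: "u \<in> cochains G H"
    and t: "t \<in> carrier G" and s: "s \<in> H #>\<^bsub>G\<^esub> t" and xs: "set xs \<subseteq> carrier G"
  shows "u (map (\<lambda>x. s \<otimes>\<^bsub>G\<^esub> x) xs) = u (map (\<lambda>x. t \<otimes>\<^bsub>G\<^esub> x) xs)"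
proof -
  interpret group G by fact
  obtain h where h: "h \<in> H" "s = h \<otimes>\<^bsub>G\<^esub> t" using s by (auto simp: r_coset_def)
  have "h \<in> carrier G" using h H subgroup.subset by blast
  then have "map (\<lambda>x. s \<otimes>\<^bsub>G\<^esub> x) xs = map (\<lambda>x. h \<otimes>\<^bsub>G\<^esub> x) (map (\<lambda>x. t \<otimes>\<^bsub>G\<^esub> x) xs)"
    using h t xs by (auto simp: m_assoc)
  moreover have "set (map (\<lambda>x. t \<otimes>\<^bsub>G\<^esub> x) xs) \<subseteq> carrier G" using xs t by auto
  ultimately show ?thesis using cochains_invariant[OF u h(1)] by metis
qed

lemma some_in_rcoset:
  assumes "group G" "subgroup H G" "K \<in> rcosets\<^bsub>G\<^esub> H"
  shows "(SOME t. t \<in> K) \<in> K" "(SOME t. t \<in> K) \<in> carrier G" "K = H #>\<^bsub>G\<^esub> (SOME t. t \<in> K)"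
proof -
  interpret group G by fact
  show *: "(SOME t. t \<in> K) \<in> K"
    using subgroup.rcosets_non_empty[OF assms(2,3)] by (simp add: some_in_eq)
  then show "(SOME t. t \<in> K) \<in> carrier G"
    using subgroup.rcosets_carrier[OF assms(2,1,3)] by blast
  obtain x where "x \<in> carrier G" "K = H #>\<^bsub>G\<^esub> x" using assms(3) by (auto simp: RCOSETS_def)
  then show "K = H #>\<^bsub>G\<^esub> (SOME t. t \<in> K)"
    using repr_independence[OF _ _ assms(2)] * by blast
qed

lemma rcosets_translate_bij:
  assumes "group G" "subgroup H G" "g \<in> carrier G"
  shows "bij_betw (\<lambda>K. K #>\<^bsub>G\<^esub> g) (rcosets\<^bsub>G\<^esub> H) (rcosets\<^bsub>G\<^esub> H)"
proof -
  interpret group G by fact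
  interpret subgroup H G by fact
  have cl: "K #>\<^bsub>G\<^esub> x \<in> rcosets\<^bsub>G\<^esub> H" if "K \<in> rcosets\<^bsub>G\<^esub> H" "x \<in> carrier G" for K x
    using that subset by (auto simp: RCOSETS_def coset_mult_assoc)
  have "K #>\<^bsub>G\<^esub> g #>\<^bsub>G\<^esub> inv\<^bsub>G\<^esub> g = K" "K #>\<^bsub>G\<^esub> inv\<^bsub>G\<^esub> g #>\<^bsub>G\<^esub> g = K" if "K \<in> rcosets\<^bsub>G\<^esub> H" for K
    using subgroup.rcosets_carrier[OF assms(2,1) that] assms(3) by (simp_all add: coset_mult_assoc)
  then show ?thesis
    using cl assms(3) by (intro bij_betw_byWitness[where f' = "\<lambda>K. K #>\<^bsub>G\<^esub> inv\<^bsub>G\<^esub> g"]) auto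
qed

lemma cochain_transfer_in_cochains:
  assumes G: "group G" and H: "subgroup H G" and u: "u \<in> cochains G H"
  shows "cochain_transfer G H u \<in> cochains G (carrier G)"
proof -
  interpret group G by fact
  obtain n where n: "\<And>xs. u xs \<noteq> 0 \<Longrightarrow> length xs \<le> n"
    using u by (metis cochains_bounded)
  show ?thesis
  proof (rule cochainsI)
    show "xs \<noteq> [] \<and> set xs \<subseteq> carrier G" if "cochain_transfer G H u xs \<noteq> 0" for xs
      using that u by (auto simp: cochain_transfer_def split: if_splits)
    show "length xs \<le> n" if "cochain_transfer G H u xs \<noteq> 0" for xs
    proof -
      obtain K where "u (map (\<lambda>x. (SOME t. t \<in> K) \<otimes>\<^bsub>G\<^esub> x) xs) \<noteq> 0"
        using \<open>cochain_transfer G H u xs \<noteq> 0\<close> unfolding cochain_transfer_def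
        by (metis (no_types, lifting) sum.neutral)
      then show ?thesis using n by fastforce
    qed
    show "cochain_transfer G H u (map (\<lambda>x. g \<otimes>\<^bsub>G\<^esub> x) xs) = cochain_transfer G H u xs"
      if g: "g \<in> carrier G" and xs: "set xs \<subseteq> carrier G" for g xs
    proof -
      have 1: "u (map (\<lambda>x. (SOME t. t \<in> K) \<otimes>\<^bsub>G\<^esub> x) (map (\<lambda>x. g \<otimes>\<^bsub>G\<^esub> x) xs))
          = u (map (\<lambda>x. (SOME t. t \<in> K #>\<^bsub>G\<^esub> g) \<otimes>\<^bsub>G\<^esub> x) xs)" if K: "K \<in> rcosets\<^bsub>G\<^esub> H" for K
      proof -
        let ?t = "SOME t. t \<in> K"
        have t: "?t \<in> carrier G" "K = H #>\<^bsub>G\<^esub> ?t" using some_in_rcoset[OF G H K] by auto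
        have Kg: "K #>\<^bsub>G\<^esub> g \<in> rcosets\<^bsub>G\<^esub> H"
          using rcosets_translate_bij[OF G H g] K by (auto simp: bij_betw_def)
        have "K #>\<^bsub>G\<^esub> g = H #>\<^bsub>G\<^esub> (?t \<otimes>\<^bsub>G\<^esub> g)"
          using t g coset_mult_assoc[OF subgroup.subset[OF H] t(1) g] by simp
        then have "(SOME t. t \<in> K #>\<^bsub>G\<^esub> g) \<in> H #>\<^bsub>G\<^esub> (?t \<otimes>\<^bsub>G\<^esub> g)"
          using some_in_rcoset(1)[OF G H Kg] by simp
        then have "u (map (\<lambda>x. (SOME t. t \<in> K #>\<^bsub>G\<^esub> g) \<otimes>\<^bsub>G\<^esub> x) xs)
            = u (map (\<lambda>x. (?t \<otimes>\<^bsub>G\<^esub> g) \<otimes>\<^bsub>G\<^esub> x) xs)"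
          using cochain_coset_rep[OF G H u _ _ xs] t(1) g by blast
        also have "map (\<lambda>x. (?t \<otimes>\<^bsub>G\<^esub> g) \<otimes>\<^bsub>G\<^esub> x) xs = map (\<lambda>x. ?t \<otimes>\<^bsub>G\<^esub> x) (map (\<lambda>x. g \<otimes>\<^bsub>G\<^esub> x) xs)"
          using t(1) g xs by (auto simp: m_assoc)
        finally show ?thesis by simp
      qed
      have "(\<Sum>K\<in>rcosets\<^bsub>G\<^esub> H. u (map (\<lambda>x. (SOME t. t \<in> K) \<otimes>\<^bsub>G\<^esub> x) (map (\<lambda>x. g \<otimes>\<^bsub>G\<^esub> x) xs)))
        = (\<Sum>K\<in>rcosets\<^bsub>G\<^esub> H. u (map (\<lambda>x. (SOME t. t \<in> K) \<otimes>\<^bsub>G\<^esub> x) xs))"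
        using 1 sum.reindex_bij_betw[OF rcosets_translate_bij[OF G H g],
            of "\<lambda>K. u (map (\<lambda>x. (SOME t. t \<in> K) \<otimes>\<^bsub>G\<^esub> x) xs)"]
        by (simp del: map_map)
      moreover have "set (map (\<lambda>x. g \<otimes>\<^bsub>G\<^esub> x) xs) \<subseteq> carrier G" using g xs by auto
      ultimately show ?thesis
        using xs unfolding cochain_transfer_def by simp
    qed
  qed
qed

lemma coboundary_cochain_transfer:
  assumes G: "group G" and H: "subgroup H G"
  shows "coboundary G (cochain_transfer G H u) = cochain_transfer G H (coboundary G u)"
proof
  fix xs
  interpret group G by fact
  show "coboundary G (cochain_transfer G H u) xs = cochain_transfer G H (coboundary G u) xs"
  proof (cases "set xs \<subseteq> carrier G")
    case True
    have "cobd (cochain_transfer G H u) xs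
      = cobd (\<lambda>ys. \<Sum>K\<in>rcosets\<^bsub>G\<^esub> H. u (map (\<lambda>x. (SOME t. t \<in> K) \<otimes>\<^bsub>G\<^esub> x) ys)) xs"
      by (rule cobd_cong) (use True in \<open>auto simp: cochain_transfer_def\<close>)
    also have "\<dots> = (\<Sum>K\<in>rcosets\<^bsub>G\<^esub> H. coboundary G u (map (\<lambda>x. (SOME t. t \<in> K) \<otimes>\<^bsub>G\<^esub> x) xs))"
      unfolding cobd_sum cobd_map
    proof (rule sum.cong[OF refl])
      fix K assume "K \<in> rcosets\<^bsub>G\<^esub> H"
      then have "set (map (\<lambda>x. (SOME t. t \<in> K) \<otimes>\<^bsub>G\<^esub> x) xs) \<subseteq> carrier G"
        using some_in_rcoset[OF G H] True by auto
      then show "cobd u (map (\<lambda>x. (SOME t. t \<in> K) \<otimes>\<^bsub>G\<^esub> x) xs)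
        = coboundary G u (map (\<lambda>x. (SOME t. t \<in> K) \<otimes>\<^bsub>G\<^esub> x) xs)"
        by (simp add: coboundary_eq_cobd)
    qed
    finally show ?thesis using True by (simp add: coboundary_eq_cobd cochain_transfer_def)
  qed (simp add: coboundary_eq_cobd cochain_transfer_def)
qed

lemma cochain_transfer_cocycle:
  assumes "group G" "subgroup H G" "u \<in> cochains G H" "coboundary G u = (\<lambda>_. 0)"
  shows "cochain_transfer G H u \<in> carrier (cocycle_ring G)"
  using assms
  by (auto simp: carrier_cocycle_ring cochain_transfer_in_cochains coboundary_cochain_transfer)
     (simp add: cochain_transfer_def fun_eq_iff)

lemma cochain_transfer_invariant:
  assumes G: "group G" and H: "subgroup H G" and f: "f \<in> cochains G (carrier G)"
  shows "cochain_transfer G H f = (\<lambda>xs. of_nat (card (rcosets\<^bsub>G\<^esub> H)) * f xs)"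
proof
  fix xs
  show "cochain_transfer G H f xs = of_nat (card (rcosets\<^bsub>G\<^esub> H)) * f xs"
  proof (cases "set xs \<subseteq> carrier G")
    case True
    have "f (map (\<lambda>x. (SOME t. t \<in> K) \<otimes>\<^bsub>G\<^esub> x) xs) = f xs" if "K \<in> rcosets\<^bsub>G\<^esub> H" for K
      using cochains_invariant[OF f some_in_rcoset(2)[OF G H that] True] .
    then show ?thesis using True unfolding cochain_transfer_def by simp
  next
    case False
    then have "f xs = 0" using cochains_support[OF f] by blast
    then show ?thesis using False by (auto simp: cochain_transfer_def)
  qed
qed

lemma cochain_transfer_length:
  assumes "\<And>xs. u xs \<noteq> 0 \<Longrightarrow> length xs = n" "cochain_transfer G H u xs \<noteq> 0"
  shows "length xs = n"
proof -
  obtain K where "u (map (\<lambda>x. (SOME t. t \<in> K) \<otimes>\<^bsub>G\<^esub> x) xs) \<noteq> 0"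
    using assms(2) unfolding cochain_transfer_def by (metis (no_types, lifting) sum.neutral)
  then show ?thesis using assms(1) by fastforce
qed

lemma cochain_pullback_length:
  assumes "\<And>xs. f xs \<noteq> 0 \<Longrightarrow> length xs = n" "cochain_pullback E \<phi> f xs \<noteq> 0"
  shows "length xs = n"
  using assms(1)[of "map \<phi> xs"] assms(2) by (auto simp: cochain_pullback_def split: if_splits)

lemma cochain_transfer_diff:
  "cochain_transfer G H (\<lambda>xs. u xs - v xs)
    = (\<lambda>xs. cochain_transfer G H u xs - cochain_transfer G H v xs)"
  by (auto simp: cochain_transfer_def sum_subtractf)

text \<open>This shows that the set under \<open>the_elem\<close> in \<open>transfer\<close> is a
  singleton. Two admissible cocycles differ by one whose restriction to \<open>H\<close> is a
  coboundary, hence by the coboundary of an \<open>H\<close>-invariant cochain, and the transfer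
  commutes with the coboundary.\<close>

lemma transfer_class:
  assumes G: "group G" and H: "subgroup H G"
    and u: "u \<in> cochains G H" "coboundary G u = (\<lambda>_. 0)"
  shows "transfer G H (cohom_class (G\<lparr>carrier := H\<rparr>) (cochain_pullback (G\<lparr>carrier := H\<rparr>) (\<lambda>x. x) u))
    = cohom_class G (cochain_transfer G H u)" (is "transfer G H ?K = _")
proof -
  have "cohom_class G (cochain_transfer G H v) = cohom_class G (cochain_transfer G H u)"
    if v: "v \<in> cochains G H" "coboundary G v = (\<lambda>_. 0)"
      "cochain_pullback (G\<lparr>carrier := H\<rparr>) (\<lambda>x. x) v \<in> ?K" for v
  proof -
    have "(\<lambda>xs. v xs - u xs) \<in> cochains G H" "coboundary G (\<lambda>xs. v xs - u xs) = (\<lambda>_. 0)"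
      using u v by (simp_all add: cochains_diff coboundary_diff)
    moreover have "cochain_pullback (G\<lparr>carrier := H\<rparr>) (\<lambda>x. x) (\<lambda>xs. v xs - u xs)
        \<in> coboundaries (G\<lparr>carrier := H\<rparr>)"
      using v(3) by (simp add: cohom_class_mem cochain_pullback_diff)
    ultimately obtain k where "k \<in> cochains G H" "(\<lambda>xs. v xs - u xs) = coboundary G k"
      by (rule coboundary_if_restriction_coboundary[OF G H])
    then have "cochain_transfer G H (\<lambda>xs. v xs - u xs) \<in> coboundaries G"
      using coboundary_cochain_transfer[OF G H, of k] cochain_transfer_in_cochains[OF G H, of k]
      by (intro coboundariesI) auto
    then show ?thesis by (simp add: cohom_class_eq_iff cochain_transfer_diff)
  qed
  moreover have "cochain_pullback (G\<lparr>carrier := H\<rparr>) (\<lambda>x. x) u \<in> ?K"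
    by (simp add: cohom_class_mem)
  ultimately have "{cohom_class G (cochain_transfer G H v) | v.
       v \<in> cochains G H \<and> coboundary G v = (\<lambda>_. 0) \<and>
       cochain_pullback (G\<lparr>carrier := H\<rparr>) (\<lambda>x. x) v \<in> ?K} = {cohom_class G (cochain_transfer G H u)}"
    using u by blast
  then show ?thesis by (simp add: transfer_def)
qed

section \<open>Restriction of a transfer to an elementary abelian group\<close>

definition add_group :: "'e::ab_group_add monoid" where
  "add_group = \<lparr>carrier = UNIV, monoid.mult = (+), one = 0\<rparr>"

lemma add_group_simps [simp]:
  "carrier add_group = UNIV" "a \<otimes>\<^bsub>add_group\<^esub> b = a + b" "\<one>\<^bsub>add_group\<^esub> = 0"
  by (simp_all add: add_group_def)

lemma group_add_group: "group (add_group :: 'e::ab_group_add monoid)"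
proof (rule groupI)
  show "\<exists>y\<in>carrier add_group. y \<otimes>\<^bsub>add_group\<^esub> x = \<one>\<^bsub>add_group\<^esub>" for x :: 'e
    by (rule bexI[of _ "- x"]) simp_all
qed (simp_all add: add.assoc)

lemma Fp_group_eq: "Fp_group = add_group"
  by (simp add: Fp_group_def add_group_def)

lemma coboundary_add_group: "coboundary add_group f = cobd f"
  by (simp add: coboundary_eq_cobd fun_eq_iff)

lemma cochain_pullback_add_group: "cochain_pullback add_group \<phi> f xs = f (map \<phi> xs)"
  by (simp add: cochain_pullback_def)

text \<open>Supplies a retraction onto a stabilizer that is additive on the whole group. Additivity,
  which a retraction built from coset representatives lacks, is what makes all translates in
  \<open>orbit_sum_coboundary\<close> contribute the same term.\<close>

lemma (in vector_space) subspace_projection: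
  assumes "subspace S"
  obtains r where "\<And>x. r x \<in> S" "\<And>x y. r (x + y) = r x + r y" "\<And>x. x \<in> S \<Longrightarrow> r x = x"
proof -
  interpret vector_space_pair scale scale ..
  have "Vector_Spaces.linear scale scale (\<lambda>x. x)" by (rule linear_ident)
  then obtain g where "range g \<subseteq> S" "Vector_Spaces.linear scale scale g" "\<forall>x\<in>S. g x = x"
    using linear_exists_left_inverse_on[OF _ assms, of "\<lambda>x. x"] by auto
  then show ?thesis using that[of g] linear_add by blast
qed

text \<open>To be used for right translation on a set of cosets. The vector space structure of the
  acting group guarantees that stabilizers have complements.\<close>

locale elementary_action = vector_space scale
  for scale :: "'p::prime_card mod_ring \<Rightarrow> 'e::ab_group_add \<Rightarrow> 'e" +
  fixes X :: "'x set" and act :: "'x \<Rightarrow> 'e \<Rightarrow> 'x"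
  assumes finite_X: "finite X"
    and act_closed: "x \<in> X \<Longrightarrow> act x e \<in> X"
    and act_zero: "x \<in> X \<Longrightarrow> act x 0 = x"
    and act_add: "x \<in> X \<Longrightarrow> act x (e + e') = act (act x e) e'"
begin

definition stab :: "'x \<Rightarrow> 'e set" where "stab x = {e. act x e = x}"

lemma act_eq_iff: "x \<in> X \<Longrightarrow> act x e = act x e' \<longleftrightarrow> e - e' \<in> stab x"
proof -
  assume x: "x \<in> X"
  have "act x (e - e') = act (act x e) (- e')" using act_add[OF x, of e "- e'"] by simp
  moreover have "act (act x e') (- e') = x" using act_add[OF x, of e' "- e'"] act_zero[OF x] by simp
  moreover have "act (act x (e - e')) e' = act x e" using act_add[OF x, of "e - e'" e'] by simp
  ultimately show ?thesis unfolding stab_def by auto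
qed

lemma subspace_stab:
  assumes x: "x \<in> X"
  shows "subspace (stab x)"
proof -
  have add: "a + b \<in> stab x" if "a \<in> stab x" "b \<in> stab x" for a b
    using that act_add[OF x] by (simp add: stab_def)
  have zero: "0 \<in> stab x" using act_zero[OF x] by (simp add: stab_def)
  have "scale (of_nat n) a \<in> stab x" if "a \<in> stab x" for a n
    by (induction n) (simp_all add: scale_left_distrib add that zero)
  then have "scale c a \<in> stab x" if "a \<in> stab x" for a c
    using surj_of_nat_mod_ring[of c] that by auto
  then show ?thesis using add zero by (simp add: subspace_def)
qed

lemma stab_act: "x \<in> X \<Longrightarrow> stab (act x e) = stab x"
proof -
  assume x: "x \<in> X"
  have "act (act x e) a = act x e \<longleftrightarrow> act x a = x" for a
  proof -
    have "act (act x e) a = act x (e + a)" by (rule act_add[OF x, symmetric])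
    then have "act (act x e) a = act x e \<longleftrightarrow> a \<in> stab x"
      using act_eq_iff[OF x, of "e + a" e] by simp
    then show ?thesis by (simp add: stab_def)
  qed
  then show ?thesis by (simp add: stab_def)
qed

definition orbit :: "'x \<Rightarrow> 'x set" where "orbit x = range (act x)"

lemma orbit_act:
  assumes x: "x \<in> X"
  shows "orbit (act x e) = orbit x"
proof -
  have "act (act x e) a = act x (e + a)" for a by (rule act_add[OF x, symmetric])
  moreover have "act x a = act (act x e) (a - e)" for a using act_add[OF x, of e "a - e"] by simp
  ultimately show ?thesis unfolding orbit_def by blast
qed

lemma orbit_subset: "x \<in> X \<Longrightarrow> orbit x \<subseteq> X"
  using act_closed by (auto simp: orbit_def)

lemma self_in_orbit: "x \<in> X \<Longrightarrow> x \<in> orbit x"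
  using act_zero by (metis orbit_def rangeI)

lemma orbit_eqI: "x \<in> X \<Longrightarrow> y \<in> X \<Longrightarrow> z \<in> orbit x \<Longrightarrow> z \<in> orbit y \<Longrightarrow> orbit x = orbit y"
  using orbit_act unfolding orbit_def by (metis imageE)

text \<open>All points of the orbit share the stabilizer of x because the group is abelian, and a
  lies outside it. Hence the multiples of a act freely and cut the orbit into blocks
  \<open>b y\<close> of p points each.\<close>

lemma p_dvd_card_orbit:
  assumes x: "x \<in> X" and nonfixed: "act x a \<noteq> x"
  shows "CARD('p) dvd card (orbit x)"
proof -
  define b where "b y = range (\<lambda>c. act y (scale c a))" for y
  have O: "orbit x \<subseteq> X" by (rule orbit_subset[OF x])
  have b_closed: "b y \<subseteq> orbit x" if "y \<in> orbit x" for y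
  proof -
    have "orbit y = orbit x" using that orbit_act[OF x] by (auto simp: orbit_def)
    then show ?thesis by (auto simp: b_def orbit_def)
  qed
  have b_act: "b (act y (scale d a)) = b y" if "y \<in> X" for y d
  proof -
    have "act (act y (scale d a)) (scale c a) = act y (scale (d + c) a)" for c
      using act_add[OF that] by (simp add: scale_left_distrib)
    then have "b (act y (scale d a)) = range (\<lambda>c. act y (scale (d + c) a))"
      by (simp add: b_def)
    also have "\<dots> = (\<lambda>c. act y (scale c a)) ` range ((+) d)" by (simp only: image_image)
    also have "range ((+) d) = UNIV" by (rule surj_plus)
    finally show ?thesis by (simp add: b_def)
  qed
  have card_b: "card (b y) = CARD('p)" if yO: "y \<in> orbit x" for y
  proof -
    obtain e where e: "y = act x e" using yO by (auto simp: orbit_def)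
    have y: "y \<in> X" and st: "stab y = stab x" using e x act_closed stab_act by auto
    have "inj (\<lambda>c. act y (scale c a))"
    proof (rule injI, rule ccontr)
      fix c c' assume "act y (scale c a) = act y (scale c' a)" "c \<noteq> c'"
      then have "scale (c - c') a \<in> stab x"
        using act_eq_iff[OF y] st by (simp add: scale_left_diff_distrib)
      then have "scale (inverse (c - c')) (scale (c - c') a) \<in> stab x"
        using subspace_stab[OF x] subspace_scale by blast
      then show False using \<open>c \<noteq> c'\<close> nonfixed by (simp add: stab_def)
    qed
    then show ?thesis by (simp add: b_def card_image)
  qed
  have "CARD('p) * card (b ` orbit x) = card (\<Union>(b ` orbit x))"
  proof (rule card_partition)
    show fin: "finite (b ` orbit x)" using O finite_X finite_subset by blast
    show "finite (\<Union>(b ` orbit x))" using b_closed O finite_X by (meson UN_least finite_subset)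
    show "card c = CARD('p)" if "c \<in> b ` orbit x" for c using that card_b by auto
    show "c1 \<inter> c2 = {}" if c: "c1 \<in> b ` orbit x" "c2 \<in> b ` orbit x" "c1 \<noteq> c2" for c1 c2
    proof (rule ccontr)
      assume "c1 \<inter> c2 \<noteq> {}"
      then obtain z where "z \<in> c1" "z \<in> c2" by blast
      then obtain y1 y2 d1 d2 where "y1 \<in> X" "y2 \<in> X" "c1 = b y1" "c2 = b y2"
        "z = act y1 (scale d1 a)" "z = act y2 (scale d2 a)"
        using c O unfolding b_def by blast
      then show False using b_act c(3) by metis
    qed
  qed
  moreover have "y \<in> b y" if "y \<in> X" for y
  proof -
    have "act y (scale 0 a) = y" using act_zero[OF that] by simp
    then show ?thesis unfolding b_def by (metis rangeI)
  qed
  then have "\<Union>(b ` orbit x) = orbit x" using b_closed O by blast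
  ultimately show ?thesis by (metis dvd_triv_left)
qed

text \<open>The sum is a transfer from the stabilizer of x, a proper subgroup. Since r retracts the
  group onto the stabilizer, \<open>v x\<close> is cohomologous to its pullback along r, a class
  restricted from the whole group; transferring it back multiplies it by the orbit length, which is
  0 modulo p.\<close>

lemma orbit_sum_coboundary:
  fixes v :: "'x \<Rightarrow> ('e, 'a::comm_ring_1) cochain"
  assumes p: "of_nat CARD('p) = (0 :: 'a)"
    and v: "\<And>x. x \<in> X \<Longrightarrow> v x \<in> cochains add_group {}" "\<And>x. x \<in> X \<Longrightarrow> coboundary add_group (v x) = (\<lambda>_. 0)"
    and equiv: "\<And>x e xs. x \<in> X \<Longrightarrow> v (act x e) xs = v x (map ((+) e) xs)"
    and x: "x \<in> X" and nonfixed: "act x a \<noteq> x"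
  shows "(\<lambda>xs. \<Sum>y\<in>orbit x. v y xs) \<in> coboundaries add_group"
proof -
  obtain r where r: "\<And>z. r z \<in> stab x" "\<And>y z. r (y + z) = r y + r z" "\<And>z. z \<in> stab x \<Longrightarrow> r z = z"
    using subspace_projection[OF subspace_stab[OF x]] by blast
  have vS: "v x \<in> cochains add_group (stab x)"
  proof -
    obtain n where "\<And>xs. v x xs \<noteq> 0 \<Longrightarrow> length xs \<le> n"
      using v(1)[OF x] by (metis cochains_bounded)
    moreover have "v x (map (\<lambda>z. e \<otimes>\<^bsub>add_group\<^esub> z) xs) = v x xs" if "e \<in> stab x" for e xs
      using equiv[OF x, of e xs] that by (simp add: stab_def)
    ultimately show ?thesis
      using cochains_support[OF v(1)[OF x]] by (intro cochainsI) auto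
  qed
  have "\<exists>h\<in>stab x. \<forall>z\<in>carrier add_group. r (e \<otimes>\<^bsub>add_group\<^esub> z) = h \<otimes>\<^bsub>add_group\<^esub> r z
      \<and> e \<otimes>\<^bsub>add_group\<^esub> z = h \<otimes>\<^bsub>add_group\<^esub> z" if "e \<in> stab x" for e
    using that r by (intro bexI[of _ e]) auto
  then obtain k where k: "k \<in> cochains add_group (stab x)"
    "\<And>xs. cochain_pullback add_group (\<lambda>z. z) (v x) xs - cochain_pullback add_group r (v x) xs
      = coboundary add_group k xs"
    using cochain_pullback_homotopy[OF vS v(2)[OF x], of r add_group "\<lambda>z. z" "stab x"]
    by (auto simp: group_add_group)
  define s where "s y = (SOME e. act x e = y)" for y
  have s: "act x (s y) = y" if "y \<in> orbit x" for y
    using that unfolding s_def orbit_def by (metis (mono_tags, lifting) imageE someI)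
  \<comment> \<open>The primitive k is invariant only under the stabilizer; summing its translates
    over the orbit, which is its transfer, makes it invariant under the whole group.\<close>
  define k' where "k' = (\<lambda>xs. \<Sum>y\<in>orbit x. k (map ((+) (s y)) xs))"
  have k_inv: "k (map ((+) (d + e)) xs) = k (map ((+) e) xs)" if "d \<in> stab x" for d e xs
  proof -
    have "map ((+) (d + e)) xs = map ((+) d) (map ((+) e) xs)" by (simp add: add.assoc)
    then show ?thesis
      using cochains_invariant[OF k(1) that, of "map ((+) e) xs"] by (simp del: map_map)
  qed
  have k': "k' \<in> cochains add_group (carrier add_group)"
  proof -
    obtain n where n: "\<And>xs. k xs \<noteq> 0 \<Longrightarrow> length xs \<le> n" using k(1) by (metis cochains_bounded)
    have nz: "\<exists>y. k (map ((+) (s y)) xs) \<noteq> 0" if "k' xs \<noteq> 0" for xs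
      using that unfolding k'_def by (metis (no_types, lifting) sum.neutral)
    show ?thesis
    proof (rule cochainsI)
      show "length xs \<le> n" if "k' xs \<noteq> 0" for xs
        using nz[OF that] n by fastforce
      show "xs \<noteq> [] \<and> set xs \<subseteq> carrier add_group" if "k' xs \<noteq> 0" for xs
        using nz[OF that] k(1) by auto
      fix e xs
      have inj: "inj_on (\<lambda>y. act y e) (orbit x)"
      proof (rule inj_onI)
        fix y z assume "y \<in> orbit x" "z \<in> orbit x" "act y e = act z e"
        moreover from this have "y \<in> X" "z \<in> X" using orbit_subset[OF x] by auto
        ultimately show "y = z" using act_add[of _ e "- e"] act_zero by (metis add.right_inverse)
      qed
      have "(\<lambda>y. act y e) ` orbit x \<subseteq> orbit x"
        using act_add[OF x] by (auto simp: orbit_def intro!: image_eqI[of _ _ "_ + _"] )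
      then have bij: "bij_betw (\<lambda>y. act y e) (orbit x) (orbit x)"
        using inj finite_subset[OF orbit_subset[OF x] finite_X]
        by (simp add: bij_betw_def endo_inj_surj)
      have "k (map ((+) (s y)) (map ((+) e) xs)) = k (map ((+) (s (act y e))) xs)" if y: "y \<in> orbit x" for y
      proof -
        have y': "act y e \<in> orbit x" using bij y by (auto simp: bij_betw_def)
        have "act x (s y + e) = act x (s (act y e))"
          using s[OF y] s[OF y'] act_add[OF x] by simp
        then have "s y + e - s (act y e) \<in> stab x" using act_eq_iff[OF x] by blast
        moreover have "map ((+) (s y)) (map ((+) e) xs) = map ((+) (s y + e)) xs"
          by (simp add: add.assoc)
        ultimately show ?thesis
          using k_inv[of "s y + e - s (act y e)" "s (act y e)" xs] by (simp del: map_map)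
      qed
      then show "k' (map (\<lambda>z. e \<otimes>\<^bsub>add_group\<^esub> z) xs) = k' xs"
        using sum.reindex_bij_betw[OF bij, of "\<lambda>y. k (map ((+) (s y)) xs)"]
        by (simp add: k'_def del: map_map)
    qed
  qed
  have "(\<Sum>y\<in>orbit x. v y xs) = coboundary add_group k' xs" for xs
  proof -
    have "v y xs = v x (map r xs) + cobd (\<lambda>zs. k (map ((+) (s y)) zs)) xs" if y: "y \<in> orbit x" for y
    proof -
      have "v y xs = v x (map ((+) (s y)) xs)" using equiv[OF x, of "s y" xs] s[OF y] by simp
      also have "\<dots> = v x (map r (map ((+) (s y)) xs)) + cobd k (map ((+) (s y)) xs)"
        using k(2)[of "map ((+) (s y)) xs"]
        by (simp add: cochain_pullback_add_group coboundary_add_group algebra_simps)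
      also have "map r (map ((+) (s y)) xs) = map ((+) (r (s y))) (map r xs)"
        by (simp add: r(2))
      also have "v x (map ((+) (r (s y))) (map r xs)) = v x (map r xs)"
        using cochains_invariant[OF vS r(1)[of "s y"], of "map r xs"] by simp
      finally show ?thesis by (simp only: cobd_map)
    qed
    then have "(\<Sum>y\<in>orbit x. v y xs)
        = (\<Sum>y\<in>orbit x. v x (map r xs) + cobd (\<lambda>zs. k (map ((+) (s y)) zs)) xs)"
      by (rule sum.cong[OF refl])
    also have "\<dots> = of_nat (card (orbit x)) * v x (map r xs) + cobd k' xs"
      by (simp add: sum.distrib k'_def cobd_sum)
    also have "of_nat (card (orbit x)) = (0 :: 'a)"
      using p_dvd_card_orbit[OF x nonfixed] p by (auto elim!: dvdE)
    finally show ?thesis by (simp add: coboundary_add_group)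
  qed
  then show ?thesis using k' by (intro coboundariesI) auto
qed

lemma sum_minus_fixed_sum_coboundary:
  fixes v :: "'x \<Rightarrow> ('e, 'a::comm_ring_1) cochain"
  assumes p: "of_nat CARD('p) = (0 :: 'a)"
    and v: "\<And>x. x \<in> X \<Longrightarrow> v x \<in> cochains add_group {}" "\<And>x. x \<in> X \<Longrightarrow> coboundary add_group (v x) = (\<lambda>_. 0)"
    and equiv: "\<And>x e xs. x \<in> X \<Longrightarrow> v (act x e) xs = v x (map ((+) e) xs)"
  shows "(\<lambda>xs. (\<Sum>x\<in>X. v x xs) - (\<Sum>x\<in>{x \<in> X. \<forall>e. act x e = x}. v x xs)) \<in> coboundaries add_group"
proof -
  define Y where "Y = {x \<in> X. \<exists>e. act x e \<noteq> x}"
  have Y_orbit: "orbit y \<subseteq> Y" if "y \<in> Y" for y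
  proof
    fix z assume z: "z \<in> orbit y"
    have "y \<in> X" and "stab y \<noteq> UNIV" using that by (auto simp: Y_def stab_def)
    moreover from this z have "stab z = stab y" "z \<in> X"
      using stab_act act_closed by (auto simp: orbit_def)
    ultimately show "z \<in> Y" by (auto simp: Y_def stab_def)
  qed
  then have Un: "\<Union>(orbit ` Y) = Y"
    using self_in_orbit by (auto simp: Y_def)
  have finY: "finite Y" using finite_X by (simp add: Y_def)
  have "(\<Sum>x\<in>X. v x xs) - (\<Sum>x\<in>{x \<in> X. \<forall>e. act x e = x}. v x xs) = (\<Sum>C\<in>orbit ` Y. \<Sum>y\<in>C. v y xs)" for xs
  proof -
    have "X = {x \<in> X. \<forall>e. act x e = x} \<union> Y" "{x \<in> X. \<forall>e. act x e = x} \<inter> Y = {}"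
      by (auto simp: Y_def)
    then have "(\<Sum>x\<in>X. v x xs) = (\<Sum>x\<in>{x \<in> X. \<forall>e. act x e = x}. v x xs) + (\<Sum>y\<in>Y. v y xs)"
      using finite_X by (metis (no_types, lifting) finite_Un sum.union_disjoint)
    moreover have "(\<Sum>y\<in>\<Union>(orbit ` Y). v y xs) = (\<Sum>C\<in>orbit ` Y. \<Sum>y\<in>C. v y xs)"
    proof (rule sum.Union_disjoint[unfolded comp_def])
      show "\<forall>A\<in>orbit ` Y. finite A" using Y_orbit finY finite_subset by blast
      show "\<forall>A\<in>orbit ` Y. \<forall>B\<in>orbit ` Y. A \<noteq> B \<longrightarrow> A \<inter> B = {}"
        using orbit_eqI unfolding Y_def by blast
    qed
    ultimately show ?thesis by (simp add: Un)
  qed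
  moreover have "(\<lambda>xs. \<Sum>y\<in>C. v y xs) \<in> coboundaries add_group" if C: "C \<in> orbit ` Y" for C
    using C orbit_sum_coboundary[OF p v equiv] by (auto simp: Y_def)
  ultimately show ?thesis by (simp add: coboundaries_sum)
qed

end

text \<open>The double coset formula modulo p. Double cosets are the orbits of the elementary
  abelian group on the right cosets of \<open>H\<close>, and an orbit with more than one point
  contributes a coboundary.\<close>

lemma transfer_restriction_elementary:
  fixes scale :: "'p::prime_card mod_ring \<Rightarrow> 'e::ab_group_add \<Rightarrow> 'e"
    and u :: "('g, 'a::comm_ring_1) cochain" and G :: "('g, 'b) monoid_scheme" and \<rho> :: "'e \<Rightarrow> 'g"
  assumes p: "of_nat CARD('p) = (0 :: 'a)" and vs: "vector_space scale"
    and G: "group G" and H: "subgroup H G" and fin: "finite (rcosets\<^bsub>G\<^esub> H)"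
    and \<rho>: "\<rho> \<in> hom add_group G"
    and u: "u \<in> cochains G H" "coboundary G u = (\<lambda>_. 0)"
  shows "(\<lambda>xs. cochain_pullback add_group \<rho> (cochain_transfer G H u) xs
     - (\<Sum>K\<in>{K \<in> rcosets\<^bsub>G\<^esub> H. \<forall>e. K #>\<^bsub>G\<^esub> \<rho> e = K}.
          u (map (\<lambda>e. (SOME t. t \<in> K) \<otimes>\<^bsub>G\<^esub> \<rho> e) xs))) \<in> coboundaries add_group"
proof -
  interpret group G by fact
  interpret vector_space scale by fact
  have \<rho>_closed: "\<rho> e \<in> carrier G" and \<rho>_add: "\<rho> (e + e') = \<rho> e \<otimes>\<^bsub>G\<^esub> \<rho> e'" for e e'
    using \<rho> by (auto simp: hom_def)
  have \<rho>_zero: "\<rho> 0 = \<one>\<^bsub>G\<^esub>"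
    using \<rho>_add[of 0 0] \<rho>_closed[of 0] by simp
  have sub: "K \<subseteq> carrier G" if "K \<in> rcosets\<^bsub>G\<^esub> H" for K
    using subgroup.rcosets_carrier[OF H G that] .
  have cl: "K #>\<^bsub>G\<^esub> \<rho> e \<in> rcosets\<^bsub>G\<^esub> H" if "K \<in> rcosets\<^bsub>G\<^esub> H" for K e
    using rcosets_translate_bij[OF G H \<rho>_closed] that by (auto simp: bij_betw_def)
  interpret elementary_action scale "rcosets\<^bsub>G\<^esub> H" "\<lambda>K e. K #>\<^bsub>G\<^esub> \<rho> e"
    using fin cl sub \<rho>_closed \<rho>_zero
    by unfold_locales (auto simp: \<rho>_add coset_mult_assoc)
  define t where "t K = (SOME t. t \<in> K)" for K :: "'g set"
  have t: "t K \<in> carrier G" "t K \<in> K" "K = H #>\<^bsub>G\<^esub> t K" if "K \<in> rcosets\<^bsub>G\<^esub> H" for K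
    using some_in_rcoset[OF G H that] by (auto simp: t_def)
  define v where "v K = cochain_pullback add_group (\<lambda>e. t K \<otimes>\<^bsub>G\<^esub> \<rho> e) u" for K
  have v1: "v K \<in> cochains add_group {}" if "K \<in> rcosets\<^bsub>G\<^esub> H" for K
    unfolding v_def
    by (rule cochain_pullback_in_cochains[OF u(1)]) (use t that \<rho>_closed in \<open>auto simp: group_add_group\<close>)
  have v2: "coboundary add_group (v K) = (\<lambda>_. 0)" if "K \<in> rcosets\<^bsub>G\<^esub> H" for K
    unfolding v_def
    by (subst coboundary_pullback[where G = G]) (use t that \<rho>_closed u(2) in auto)
  have v3: "v (K #>\<^bsub>G\<^esub> \<rho> e) xs = v K (map ((+) e) xs)" if K: "K \<in> rcosets\<^bsub>G\<^esub> H" for K e xs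
  proof -
    have "t (K #>\<^bsub>G\<^esub> \<rho> e) \<in> H #>\<^bsub>G\<^esub> (t K \<otimes>\<^bsub>G\<^esub> \<rho> e)"
      using t(2)[OF cl[OF K]] t(1,3)[OF K] \<rho>_closed coset_mult_assoc[OF subgroup.subset[OF H]] by metis
    from cochain_coset_rep[OF G H u(1) _ this, of "map \<rho> xs"]
    have "u (map (\<lambda>x. t (K #>\<^bsub>G\<^esub> \<rho> e) \<otimes>\<^bsub>G\<^esub> \<rho> x) xs) = u (map (\<lambda>x. t K \<otimes>\<^bsub>G\<^esub> \<rho> e \<otimes>\<^bsub>G\<^esub> \<rho> x) xs)"
      using t(1)[OF K] \<rho>_closed by (auto simp: comp_def)
    also have "map (\<lambda>x. t K \<otimes>\<^bsub>G\<^esub> \<rho> e \<otimes>\<^bsub>G\<^esub> \<rho> x) xs = map (\<lambda>x. t K \<otimes>\<^bsub>G\<^esub> \<rho> x) (map ((+) e) xs)"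
      using t(1)[OF K] \<rho>_closed by (simp add: \<rho>_add m_assoc)
    finally show ?thesis by (simp add: v_def cochain_pullback_add_group del: map_map)
  qed
  have "cochain_pullback add_group \<rho> (cochain_transfer G H u) xs = (\<Sum>K\<in>rcosets\<^bsub>G\<^esub> H. v K xs)" for xs
    using \<rho>_closed
    by (auto simp: cochain_pullback_add_group cochain_transfer_def v_def t_def comp_def)
  then show ?thesis
    using sum_minus_fixed_sum_coboundary[OF p v1 v2 v3]
    by (simp add: v_def t_def cochain_pullback_add_group)
qed

text \<open>The two maps differ by right translation by the inverse of t, so both are moved by the
  same left factor t \<rho>(e) t^(-1), which lies in \<open>H\<close>; the prism homotopy applies.
  The conjugated map takes values in \<open>H\<close>, where u is known explicitly.\<close>

lemma fixed_coset_conjugate: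
  fixes \<rho> :: "'e::ab_group_add \<Rightarrow> 'g"
  assumes G: "group G" and H: "subgroup H G" and \<rho>: "\<rho> \<in> hom add_group G"
    and u: "u \<in> cochains G H" "coboundary G u = (\<lambda>_. 0)"
    and t: "t \<in> carrier G" and fixed: "\<And>e. t \<otimes>\<^bsub>G\<^esub> \<rho> e \<otimes>\<^bsub>G\<^esub> inv\<^bsub>G\<^esub> t \<in> H"
  shows "(\<lambda>xs. u (map (\<lambda>e. t \<otimes>\<^bsub>G\<^esub> \<rho> e) xs) - u (map (\<lambda>e. t \<otimes>\<^bsub>G\<^esub> \<rho> e \<otimes>\<^bsub>G\<^esub> inv\<^bsub>G\<^esub> t) xs))
    \<in> coboundaries add_group"
proof -
  interpret group G by fact
  have \<rho>_closed: "\<rho> e \<in> carrier G" and \<rho>_add: "\<rho> (e + e') = \<rho> e \<otimes>\<^bsub>G\<^esub> \<rho> e'" for e e'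
    using \<rho> by (auto simp: hom_def)
  have cancel: "inv\<^bsub>G\<^esub> t \<otimes>\<^bsub>G\<^esub> (t \<otimes>\<^bsub>G\<^esub> y) = y" if "y \<in> carrier G" for y
    using t that by (simp flip: m_assoc)
  obtain k where "k \<in> cochains add_group UNIV"
    "\<And>xs. cochain_pullback add_group (\<lambda>e. t \<otimes>\<^bsub>G\<^esub> \<rho> e) u xs
        - cochain_pullback add_group (\<lambda>e. t \<otimes>\<^bsub>G\<^esub> \<rho> e \<otimes>\<^bsub>G\<^esub> inv\<^bsub>G\<^esub> t) u xs = coboundary add_group k xs"
  proof (rule cochain_pullback_homotopy[OF u, of "\<lambda>e. t \<otimes>\<^bsub>G\<^esub> \<rho> e \<otimes>\<^bsub>G\<^esub> inv\<^bsub>G\<^esub> t" add_group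
        "\<lambda>e. t \<otimes>\<^bsub>G\<^esub> \<rho> e" UNIV])
    fix e :: 'e
    show "\<exists>h\<in>H. \<forall>x\<in>carrier add_group.
      t \<otimes>\<^bsub>G\<^esub> \<rho> (e \<otimes>\<^bsub>add_group\<^esub> x) \<otimes>\<^bsub>G\<^esub> inv\<^bsub>G\<^esub> t = h \<otimes>\<^bsub>G\<^esub> (t \<otimes>\<^bsub>G\<^esub> \<rho> x \<otimes>\<^bsub>G\<^esub> inv\<^bsub>G\<^esub> t)
      \<and> t \<otimes>\<^bsub>G\<^esub> \<rho> (e \<otimes>\<^bsub>add_group\<^esub> x) = h \<otimes>\<^bsub>G\<^esub> (t \<otimes>\<^bsub>G\<^esub> \<rho> x)"
      by (rule bexI[OF _ fixed[of e]]) (use t \<rho>_closed in \<open>simp add: \<rho>_add m_assoc cancel\<close>)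
  qed (use t \<rho>_closed group_add_group in auto)
  then show ?thesis
    by (intro coboundariesI) (auto simp: cochain_pullback_add_group fun_eq_iff)
qed

section \<open>Inhomogeneous cochains\<close>

text \<open>Passage between vertices and increments, i.e. between homogeneous and bar cochains. The
  group algebra acts on each increment separately and has no meaning on vertices, so the maps
  induced by units are available only in bar coordinates.\<close>

fun walk :: "'e::ab_group_add \<Rightarrow> 'e list \<Rightarrow> 'e list" where
  "walk x [] = [x]"
| "walk x (a # as) = x # walk (x + a) as"

fun steps :: "'e::ab_group_add \<Rightarrow> 'e list \<Rightarrow> 'e list" where
  "steps x [] = []"
| "steps x (y # ys) = (y - x) # steps y ys"

definition to_bar :: "('e::ab_group_add list \<Rightarrow> 'a) \<Rightarrow> 'e list \<Rightarrow> 'a" where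
  "to_bar f as = f (walk 0 as)"

fun of_bar :: "('e::ab_group_add list \<Rightarrow> 'a::comm_ring_1) \<Rightarrow> 'e list \<Rightarrow> 'a" where
  "of_bar \<phi> [] = 0"
| "of_bar \<phi> (x # xs) = \<phi> (steps x xs)"

text \<open>The bar differential \<open>\<phi>(a\<^sub>2, \<dots>) - \<phi>(a\<^sub>1 + a\<^sub>2, \<dots>) + \<dots>\<close>;
  \<open>bar_tail a\<close> collects the terms in which \<open>a = a\<^sub>1\<close> survives.\<close>

fun bar_tail :: "'e::ab_group_add \<Rightarrow> ('e list \<Rightarrow> 'a::comm_ring_1) \<Rightarrow> 'e list \<Rightarrow> 'a" where
  "bar_tail a \<phi> [] = \<phi> []"
| "bar_tail a \<phi> (b # bs) = \<phi> ((a + b) # bs) - bar_tail b (\<lambda>as. \<phi> (a # as)) bs"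

fun bar_cobd :: "('e::ab_group_add list \<Rightarrow> 'a::comm_ring_1) \<Rightarrow> 'e list \<Rightarrow> 'a" where
  "bar_cobd \<phi> [] = 0"
| "bar_cobd \<phi> (a # as) = \<phi> as - bar_tail a \<phi> as"

fun bar_cup :: "('e list \<Rightarrow> 'a::comm_ring_1) \<Rightarrow> ('e list \<Rightarrow> 'a) \<Rightarrow> 'e list \<Rightarrow> 'a" where
  "bar_cup \<phi> \<gamma> [] = \<phi> [] * \<gamma> []"
| "bar_cup \<phi> \<gamma> (a # as) = \<phi> [] * \<gamma> (a # as) + bar_cup (\<lambda>bs. \<phi> (a # bs)) \<gamma> as"

lemma length_walk [simp]: "length (walk x as) = Suc (length as)"
  by (induction as arbitrary: x) simp_all

lemma length_steps [simp]: "length (steps x ys) = length ys"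
  by (induction ys arbitrary: x) simp_all

lemma steps_walk: "steps x (walk y as) = (y - x) # as"
  by (induction as arbitrary: x y) simp_all

lemma walk_steps: "walk x (steps x xs) = x # xs"
  by (induction xs arbitrary: x) simp_all

lemma walk_shift: "walk (z + x) as = map ((+) z) (walk x as)"
  by (induction as arbitrary: x) (simp_all add: add.assoc)

lemma steps_shift: "steps (z + x) (map ((+) z) xs) = steps x xs"
  by (induction xs arbitrary: x) simp_all

lemma walk_map:
  assumes "\<And>a b. l (a + b) = l a + l b"
  shows "map l (walk x as) = walk (l x) (map l as)"
  by (induction as arbitrary: x) (simp_all add: assms)

lemma to_bar_of_bar: "to_bar (of_bar \<phi>) = \<phi>"
proof
  show "to_bar (of_bar \<phi>) as = \<phi> as" for as
    by (cases as) (simp_all add: to_bar_def steps_walk)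
qed

lemma cochain_walk:
  assumes "f \<in> cochains add_group UNIV"
  shows "f (walk x as) = f (walk 0 as)"
  using cochains_invariant[OF assms, of x "walk 0 as"] walk_shift[of x 0 as] by simp

lemma of_bar_to_bar:
  assumes "f \<in> cochains add_group UNIV"
  shows "of_bar (to_bar f) = f"
proof
  show "of_bar (to_bar f) xs = f xs" for xs
  proof (cases xs)
    case (Cons x ys)
    then show ?thesis
      using cochain_walk[OF assms, of x "steps x ys"] by (simp add: to_bar_def walk_steps)
  qed (use assms in simp)
qed

lemma of_bar_in_cochains:
  assumes "\<And>as. \<phi> as \<noteq> 0 \<Longrightarrow> length as \<le> n"
  shows "of_bar \<phi> \<in> cochains add_group UNIV"
proof (rule cochainsI)
  show "length xs \<le> Suc n" if "of_bar \<phi> xs \<noteq> 0" for xs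
    using that assms by (cases xs) fastforce+
  show "xs \<noteq> [] \<and> set xs \<subseteq> carrier add_group" if "of_bar \<phi> xs \<noteq> 0" for xs
    using that by (cases xs) auto
  show "of_bar \<phi> (map (\<lambda>x. h \<otimes>\<^bsub>add_group\<^esub> x) xs) = of_bar \<phi> xs" for h xs
    by (cases xs) (simp_all add: steps_shift)
qed

lemma cobd_of_bar:
  fixes \<phi> :: "'e::ab_group_add list \<Rightarrow> 'a::comm_ring_1"
  shows "cobd (of_bar \<phi>) xs = of_bar (bar_cobd \<phi>) xs"
proof -
  have tail: "cobd (\<lambda>zs. \<phi> (steps x zs)) (y # ys) = bar_tail (y - x) \<phi> (steps y ys)" 
    for \<phi> :: "'e list \<Rightarrow> 'a" and x y ys
  proof (induction ys arbitrary: \<phi> x y)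
    case (Cons z zs)
    from Cons.IH[of "\<lambda>as. \<phi> ((y - x) # as)" y z] show ?case by simp
  qed simp
  show ?thesis
  proof (cases xs)
    case (Cons x ys)
    then show ?thesis
      using tail[of \<phi> x] by (cases ys) (simp_all del: cobd.simps(2), simp_all)
  qed simp
qed

lemma bar_cobd_to_bar:
  assumes "f \<in> cochains add_group UNIV"
  shows "bar_cobd (to_bar f) = to_bar (cobd f)"
proof -
  have "of_bar (bar_cobd (to_bar f)) = cobd f"
    using cobd_of_bar[of "to_bar f"] by (simp add: of_bar_to_bar[OF assms] fun_eq_iff)
  then show ?thesis by (metis to_bar_of_bar)
qed

lemma to_bar_cup:
  assumes "g \<in> cochains add_group UNIV"
  shows "to_bar (cup f g) = bar_cup (to_bar f) (to_bar g)"
proof -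
  have "cup f g (walk x as) = bar_cup (\<lambda>bs. f (walk x bs)) (\<lambda>bs. g (walk 0 bs)) as" for f x as
  proof (induction as arbitrary: f x)
    case Nil
    then show ?case using cochain_walk[OF assms, of x "[]"] by simp
  next
    case (Cons a as)
    have "g (x # walk (x + a) as) = g (0 # walk a as)"
      using cochain_walk[OF assms, of x "a # as"] by simp
    then show ?case using Cons.IH[of "\<lambda>zs. f (x # zs)" "x + a"] by simp
  qed
  then show ?thesis unfolding to_bar_def by blast
qed

lemma of_bar_bar_cup: "of_bar (bar_cup \<phi> \<gamma>) = cup (of_bar \<phi>) (of_bar \<gamma>)"
proof
  have *: "cup (\<lambda>zs. \<phi> (steps x zs)) (of_bar \<gamma>) (y # ys) = bar_cup (\<lambda>as. \<phi> ((y - x) # as)) \<gamma> (steps y ys)"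
    for \<phi> x y ys
  proof (induction ys arbitrary: \<phi> x y)
    case (Cons z zs)
    from Cons.IH[of "\<lambda>as. \<phi> ((y - x) # as)" y z] show ?case by simp
  qed simp
  fix xs
  show "of_bar (bar_cup \<phi> \<gamma>) xs = cup (of_bar \<phi>) (of_bar \<gamma>) xs"
  proof (cases xs)
    case (Cons x ys)
    then show ?thesis
      using *[of \<phi> x] by (cases ys) (simp_all del: cup_Cons, simp_all)
  qed simp
qed

section \<open>Homomorphisms into the units of a group algebra\<close>

text \<open>
  A homomorphism \<open>w\<close> from the group \<open>'c\<close> to the units of augmentation one in the group algebra
  of \<open>'e\<close> over \<open>'k\<close>, given by the functionals \<open>L j F = (\<Sum>e. w j e * F e)\<close>. Inhomogeneous
  cochains with trivial coefficients only see the augmented group algebra, so \<open>w\<close> induces a map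
  in cohomology although it does not come from a group homomorphism.
\<close>

locale weighted_hom =
  fixes L :: "'c::ab_group_add \<Rightarrow> ('e::ab_group_add \<Rightarrow> 'k::comm_ring_1) \<Rightarrow> 'k"
  assumes L_add: "L j (\<lambda>e. F e + F' e) = L j F + L j F'"
    and L_scale: "L j (\<lambda>e. c * F e) = c * L j F"
    and L_one: "L j (\<lambda>_. 1) = 1"
    and L_zero: "L 0 F = F 0"
    and L_conv: "L (j + k) F = L j (\<lambda>e. L k (\<lambda>e'. F (e + e')))"

text \<open>With w(j) the group algebra element behind \<open>L j\<close>, this is the multilinear
  extension of \<phi> evaluated at w(j_1), ..., w(j_n).\<close>

fun weigh :: "('c \<Rightarrow> ('e \<Rightarrow> 'k::comm_ring_1) \<Rightarrow> 'k) \<Rightarrow> ('e list \<Rightarrow> 'k) \<Rightarrow> 'c list \<Rightarrow> 'k" where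
  "weigh L \<phi> [] = \<phi> []"
| "weigh L \<phi> (j # js) = L j (\<lambda>e. weigh L (\<lambda>as. \<phi> (e # as)) js)"

text \<open>On cochains, this is restriction to a shifted subgroup in the sense of Carlson.\<close>

definition shift ::
  "('c::ab_group_add \<Rightarrow> ('e::ab_group_add \<Rightarrow> 'k::comm_ring_1) \<Rightarrow> 'k)
    \<Rightarrow> ('e, 'k) cochain \<Rightarrow> ('c, 'k) cochain" where
  "shift L f = of_bar (weigh L (to_bar f))"

context weighted_hom
begin

lemma L_const: "L j (\<lambda>_. c) = c"
  using L_scale[of j c "\<lambda>_. 1"] by (simp add: L_one)

lemma L_scale_right: "L j (\<lambda>e. F e * c) = L j F * c"
  using L_scale[of j c F] by (simp add: mult.commute)

lemma L_diff: "L j (\<lambda>e. F e - F' e) = L j F - L j F'"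
  using L_add[of j F "\<lambda>e. - 1 * F' e"] L_scale[of j "- 1" F'] by simp

lemma L_sum: "L j (\<lambda>e. \<Sum>i\<in>I. F i e) = (\<Sum>i\<in>I. L j (F i))"
  by (induction I rule: infinite_finite_induct) (simp_all add: L_add L_const)

lemma weigh_add: "weigh L (\<lambda>as. \<phi> as + \<psi> as) js = weigh L \<phi> js + weigh L \<psi> js"
  by (induction js arbitrary: \<phi> \<psi>) (simp_all add: L_add)

lemma weigh_diff: "weigh L (\<lambda>as. \<phi> as - \<psi> as) js = weigh L \<phi> js - weigh L \<psi> js"
  by (induction js arbitrary: \<phi> \<psi>) (simp_all add: L_diff)

lemma weigh_scale: "weigh L (\<lambda>as. c * \<phi> as) js = c * weigh L \<phi> js"
  by (induction js arbitrary: \<phi>) (simp_all add: L_scale)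

lemma weigh_eq_zero:
  "(\<And>as. length as = length js \<Longrightarrow> \<phi> as = 0) \<Longrightarrow> weigh L \<phi> js = 0"
  by (induction js arbitrary: \<phi>) (simp_all add: L_const)

lemma bar_tail_L: "L j (\<lambda>e. bar_tail k (\<psi> e) ks) = bar_tail k (\<lambda>as. L j (\<lambda>e. \<psi> e as)) ks"
  by (induction ks arbitrary: k \<psi>) (simp_all add: L_diff)

lemma bar_cup_L: "L j (\<lambda>e. bar_cup (\<psi> e) \<gamma> ks) = bar_cup (\<lambda>as. L j (\<lambda>e. \<psi> e as)) \<gamma> ks"
  by (induction ks arbitrary: \<psi>) (simp_all add: L_add L_scale_right)

text \<open>The faces that merge two adjacent increments are matched by multiplicativity of the
  unit, \<open>L_conv\<close>; the last face, which drops an increment, is matched by augmentation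
  one, in the form of \<open>L_const\<close>.\<close>

lemma weigh_bar_tail: "L j (\<lambda>e. weigh L (bar_tail e \<phi>) js) = bar_tail j (weigh L \<phi>) js"
proof (induction js arbitrary: \<phi> j)
  case (Cons k ks)
  have "L j (\<lambda>e. weigh L (bar_tail e \<phi>) (k # ks))
    = L j (\<lambda>e. L k (\<lambda>e'. weigh L (\<lambda>as. \<phi> ((e + e') # as)) ks))
      - L j (\<lambda>e. L k (\<lambda>e'. weigh L (bar_tail e' (\<lambda>as. \<phi> (e # as))) ks))"
    by (simp add: weigh_diff L_diff)
  then show ?case
    by (simp add: Cons.IH bar_tail_L L_conv)
qed (simp add: L_const)

lemma weigh_bar_cobd: "weigh L (bar_cobd \<phi>) js = bar_cobd (weigh L \<phi>) js"
  by (cases js) (simp_all add: weigh_diff L_diff L_const weigh_bar_tail)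

text \<open>The unit need not be group-like for this. With trivial coefficients the product of bar
  cochains is concatenation, the Yoneda product, which depends on the augmented algebra alone and
  not on its coproduct.\<close>

lemma weigh_bar_cup: "weigh L (bar_cup \<phi> \<gamma>) js = bar_cup (weigh L \<phi>) (weigh L \<gamma>) js"
  by (induction js arbitrary: \<phi>)
     (simp_all add: weigh_add weigh_scale L_add L_scale bar_cup_L)

lemma shift_in_cochains:
  assumes "f \<in> cochains add_group UNIV"
  shows "shift L f \<in> cochains add_group UNIV"
proof -
  obtain n where n: "\<And>xs. f xs \<noteq> 0 \<Longrightarrow> length xs \<le> n" using assms by (metis cochains_bounded)
  have "length js \<le> n" if "weigh L (to_bar f) js \<noteq> 0" for js
  proof (rule ccontr)
    assume "\<not> length js \<le> n"
    then have "to_bar f as = 0" if "length as = length js" for as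
      using n[of "walk 0 as"] that by (auto simp: to_bar_def)
    then show False using weigh_eq_zero \<open>weigh L (to_bar f) js \<noteq> 0\<close> by blast
  qed
  then show ?thesis unfolding shift_def by (rule of_bar_in_cochains)
qed

lemma cobd_shift:
  assumes "f \<in> cochains add_group UNIV"
  shows "cobd (shift L f) = shift L (cobd f)"
proof -
  have "bar_cobd (weigh L (to_bar f)) = weigh L (to_bar (cobd f))"
    by (intro ext) (simp add: weigh_bar_cobd flip: bar_cobd_to_bar[OF assms])
  then show ?thesis by (intro ext) (simp add: shift_def cobd_of_bar)
qed

lemma shift_cup:
  assumes "g \<in> cochains add_group UNIV"
  shows "shift L (cup f g) = cup (shift L f) (shift L g)"
  unfolding shift_def to_bar_cup[OF assms] of_bar_bar_cup[symmetric]
  by (rule arg_cong[where f = of_bar]) (simp add: fun_eq_iff weigh_bar_cup)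

lemma shift_add: "shift L (\<lambda>xs. f xs + g xs) = (\<lambda>xs. shift L f xs + shift L g xs)"
proof
  show "shift L (\<lambda>xs. f xs + g xs) xs = shift L f xs + shift L g xs" for xs
    by (cases xs) (simp_all add: shift_def to_bar_def[abs_def] weigh_add)
qed

lemma shift_zero [simp]: "shift L (\<lambda>_. 0) = (\<lambda>_. 0)"
proof
  show "shift L (\<lambda>_. 0) xs = 0" for xs
    by (cases xs) (simp_all add: shift_def to_bar_def weigh_eq_zero)
qed

lemma shift_scale: "shift L (\<lambda>xs. c * f xs) = (\<lambda>xs. c * shift L f xs)"
proof
  show "shift L (\<lambda>xs. c * f xs) xs = c * shift L f xs" for xs
    by (cases xs) (simp_all add: shift_def to_bar_def[abs_def] weigh_scale)
qed

lemma shift_const: "shift L (cochain_const add_group c) = cochain_const add_group c"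
proof
  show "shift L (cochain_const add_group c) xs = cochain_const add_group c xs" for xs
  proof (cases xs)
    case (Cons x ys)
    show ?thesis
    proof (cases ys)
      case (Cons y zs)
      have "weigh L (to_bar (cochain_const add_group c)) (steps x ys) = 0"
        by (rule weigh_eq_zero) (auto simp: to_bar_def cochain_const_def Cons)
      then show ?thesis using \<open>xs = x # ys\<close> Cons by (simp add: shift_def cochain_const_def del: weigh.simps steps.simps)
    qed (simp add: \<open>xs = x # ys\<close> shift_def to_bar_def cochain_const_def)
  qed (simp add: shift_def cochain_const_def)
qed

lemma shift_cocycle:
  assumes "f \<in> carrier (cocycle_ring add_group)"
  shows "shift L f \<in> carrier (cocycle_ring add_group)"
  using assms by (simp add: carrier_cocycle_ring shift_in_cochains coboundary_add_group cobd_shift)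

lemma shift_coboundaries:
  assumes "f \<in> coboundaries add_group"
  shows "shift L f \<in> coboundaries add_group"
  using assms
  by (auto elim!: coboundariesE intro!: coboundariesI shift_in_cochains
      simp: coboundary_add_group cobd_shift)

lemma shift_ring_hom:
  "shift L \<in> Ring.ring_hom (cocycle_ring add_group) (cocycle_ring add_group)"
  by (rule Ring.ring_hom_memI)
     (auto intro: shift_cocycle simp: shift_add shift_const, simp add: carrier_cocycle_ring shift_cup)

end

lemma weighted_hom_pushforward:
  assumes "weighted_hom L" and l: "\<And>a b. l (a + b) = l a + (l b :: 'd::ab_group_add)"
  shows "weighted_hom (\<lambda>j F. L j (\<lambda>e. F (l e)))"
proof -
  interpret weighted_hom L by fact
  have "l 0 = 0" using l[of 0 0] by simp
  then show ?thesis
    by unfold_locales (simp_all add: L_add L_scale L_one L_zero L_conv l)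
qed

lemma shift_pullback:
  assumes l: "\<And>a b. l (a + b) = l a + l b"
  shows "shift L (cochain_pullback add_group l f) = shift (\<lambda>j F. L j (\<lambda>e. F (l e))) f"
proof -
  have "l 0 = 0" using l[of 0 0] by simp
  then have "to_bar (cochain_pullback add_group l f) = (\<lambda>as. to_bar f (map l as))"
    using walk_map[of l 0] l by (simp add: to_bar_def cochain_pullback_add_group fun_eq_iff)
  moreover have "weigh L (\<lambda>as. \<phi> (map l as)) js = weigh (\<lambda>j F. L j (\<lambda>e. F (l e))) \<phi> js" for \<phi> js
  proof (induction js arbitrary: \<phi>)
    case (Cons j js)
    show ?case using Cons.IH[of "\<lambda>as. \<phi> (l _ # as)"] by simp
  qed simp
  ultimately show ?thesis unfolding shift_def by presburger
qed

section \<open>Extension of scalars\<close>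

abbreviation const_poly :: "'a::comm_ring_1 \<Rightarrow> 'a poly" where
  "const_poly c \<equiv> [:c:]"

definition extend_scalars :: "('g, 'a::comm_ring_1) cochain \<Rightarrow> ('g, 'a poly) cochain" where
  "extend_scalars f xs = [:f xs:]"

lemma extend_scalars_in_cochains:
  "f \<in> cochains G H \<Longrightarrow> extend_scalars f \<in> cochains G H"
  by (auto simp: cochains_def extend_scalars_def)

lemma cobd_extend_scalars: "cobd (extend_scalars f) xs = [:cobd f xs:]"
  unfolding extend_scalars_def using cobd_additive[of "\<lambda>c. [:c:]" f xs] by simp

lemma coboundary_extend_scalars: "coboundary G (extend_scalars f) = extend_scalars (coboundary G f)"
  by (simp add: coboundary_eq_cobd cobd_extend_scalars extend_scalars_def fun_eq_iff)

lemma extend_scalars_cocycle: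
  "f \<in> carrier (cocycle_ring G) \<Longrightarrow> extend_scalars f \<in> carrier (cocycle_ring G)"
  by (simp add: carrier_cocycle_ring extend_scalars_in_cochains coboundary_extend_scalars)
     (simp add: extend_scalars_def fun_eq_iff)

lemma extend_scalars_coboundaries:
  "f \<in> coboundaries G \<Longrightarrow> extend_scalars f \<in> coboundaries G"
  by (auto elim!: coboundariesE intro!: coboundariesI extend_scalars_in_cochains
      simp: coboundary_extend_scalars)

lemma extend_scalars_ring_hom:
  "extend_scalars \<in> Ring.ring_hom (cocycle_ring G) (cocycle_ring G)"
proof (rule Ring.ring_hom_memI)
  show "extend_scalars (f \<otimes>\<^bsub>cocycle_ring G\<^esub> g)
      = extend_scalars f \<otimes>\<^bsub>cocycle_ring G\<^esub> extend_scalars g" for f g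
    using cup_hom[of "\<lambda>c. [:c:]" f g] by (intro ext) (simp add: extend_scalars_def[abs_def])
  show "extend_scalars \<one>\<^bsub>cocycle_ring G\<^esub> = \<one>\<^bsub>cocycle_ring G\<^esub>"
    by (auto simp: extend_scalars_def cochain_const_def fun_eq_iff)
qed (simp_all add: extend_scalars_cocycle, simp add: extend_scalars_def fun_eq_iff)

text \<open>Descent from polynomial coefficients: extracting a coefficient is additive, so it
  commutes with the coboundary and may be applied to a primitive.\<close>

lemma coefficient_coboundary:
  assumes "(\<lambda>xs. c * extend_scalars f xs) \<in> coboundaries G"
  shows "(\<lambda>xs. coeff c i * f xs) \<in> coboundaries G"
proof -
  obtain h where h: "h \<in> cochains G (carrier G)" "(\<lambda>xs. c * extend_scalars f xs) = coboundary G h"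
    using assms by (rule coboundariesE)
  have "coboundary G (\<lambda>xs. coeff (h xs) i) = (\<lambda>xs. coeff (coboundary G h xs) i)"
    using cobd_additive[of "\<lambda>q. coeff q i" h] by (auto simp: coboundary_eq_cobd fun_eq_iff)
  also have "\<dots> = (\<lambda>xs. coeff c i * f xs)"
    by (simp add: extend_scalars_def fun_eq_iff flip: h(2))
  finally have "coboundary G (\<lambda>xs. coeff (h xs) i) = (\<lambda>xs. coeff c i * f xs)" .
  moreover have "(\<lambda>xs. coeff (h xs) i) \<in> cochains G (carrier G)"
  proof -
    obtain n where n: "\<And>xs. h xs \<noteq> 0 \<Longrightarrow> length xs \<le> n" using h(1) by (metis cochains_bounded)
    have nz: "h xs \<noteq> 0" if "coeff (h xs) i \<noteq> 0" for xs using that by auto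
    show ?thesis
      by (rule cochainsI[where n = n])
         (use nz n cochains_support[OF h(1)] cochains_invariant[OF h(1)] in auto)
  qed
  ultimately show ?thesis by (intro coboundariesI) auto
qed

unbundle fps_syntax
no_notation vec_index (infixl \<open>$\<close> 100)

section \<open>Residues and binomial coefficients modulo \<open>p\<close>\<close>

definition residue :: "'p::prime_card mod_ring \<Rightarrow> nat" where
  "residue a = nat (to_int_mod_ring a)"

lemma residue_of_nat_less:
  assumes "m < CARD('p::prime_card)"
  shows "residue (of_nat m :: 'p mod_ring) = m"
  using assms by (simp add: residue_def of_nat_of_int_mod_ring)

lemma residue_less: "residue (a :: 'p::prime_card mod_ring) < CARD('p)"
  using surj_of_nat_mod_ring[of a] residue_of_nat_less by metis

lemma of_nat_residue [simp]: "of_nat (residue a) = (a :: 'p::prime_card mod_ring)"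
  using surj_of_nat_mod_ring[of a] residue_of_nat_less by metis

lemma residue_of_nat: "residue (of_nat m :: 'p::prime_card mod_ring) = m mod CARD('p)"
proof -
  have "(of_nat m :: 'p mod_ring) = of_nat (m mod CARD('p))"
    using of_nat_mod_CHAR[of m, where ?'a = "'p mod_ring"] by simp
  then show ?thesis by (simp add: residue_of_nat_less)
qed

lemma residue_0 [simp]: "residue (0 :: 'p::prime_card mod_ring) = 0"
  using residue_of_nat[of 0, where ?'p = 'p] by simp

lemma card_gt_1: "1 < CARD('p::prime_card)"
  using prime_card[where ?'a = 'p] prime_gt_1_nat by blast

lemma residue_1 [simp]: "residue (1 :: 'p::prime_card mod_ring) = 1"
  using residue_of_nat_less[of 1, where ?'p = 'p] card_gt_1[where ?'p = 'p] by simp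

lemma residue_add:
  fixes a b :: "'p::prime_card mod_ring"
  shows "residue (a + b) = (residue a + residue b) mod CARD('p)"
  using residue_of_nat[of "residue a + residue b", where ?'p = 'p] by simp

lemma residue_add_cases:
  fixes a b :: "'p::prime_card mod_ring"
  obtains "residue a + residue b < CARD('p)" "residue (a + b) = residue a + residue b"
  | "residue a + residue b = CARD('p) + residue (a + b)"
proof (cases "residue a + residue b < CARD('p)")
  case True
  then show ?thesis using that(1) by (simp add: residue_add)
next
  case False
  moreover have "residue a + residue b < 2 * CARD('p)"
    using residue_less[of a] residue_less[of b] by simp
  ultimately have "(residue a + residue b) mod CARD('p) = residue a + residue b - CARD('p)"
    using False by (simp add: le_mod_geq)
  then show ?thesis using False that(2) by (simp add: residue_add)
qed

lemma additive_mod_ring: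
  fixes g :: "'p::prime_card mod_ring \<Rightarrow> 'k::comm_ring_1"
  assumes "\<And>a b. g (a + b) = g a + g b"
  shows "g a = of_nat (residue a) * g 1"
proof -
  have "g 0 = 0" using assms[of 0 0] by simp
  have "g (of_nat n) = of_nat n * g 1" for n
    by (induction n) (simp_all add: \<open>g 0 = 0\<close> assms algebra_simps)
  from this[of "residue a"] show ?thesis by simp
qed

lemma one_plus_X_power_nth: "((1 + fps_X) ^ n :: 'k::comm_ring_1 fps) $ i = of_nat (n choose i)"
proof (induction n arbitrary: i)
  case 0
  then show ?case by (cases i) simp_all
next
  case (Suc n)
  then show ?case by (cases i) (simp_all add: distrib_right)
qed

text \<open>Compare coefficients in (1 + X)^(p + s) = (1 + X^p) (1 + X)^s.\<close>

lemma of_nat_choose_add_prime: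
  assumes "p = CHAR('k::comm_ring_1)" "prime p"
  shows "(of_nat ((p + s) choose i) :: 'k)
    = of_nat (s choose i) + (if i < p then 0 else of_nat (s choose (i - p)))"
proof -
  have "(1 + fps_X :: 'k fps) ^ p = 1 ^ p + fps_X ^ p"
    by (rule freshmans_dream) (use assms in simp_all)
  then have "(1 + fps_X :: 'k fps) ^ (p + s) = (1 + fps_X) ^ s + fps_X ^ p * (1 + fps_X) ^ s"
    by (simp add: power_add algebra_simps)
  then have "((1 + fps_X :: 'k fps) ^ (p + s)) $ i = ((1 + fps_X) ^ s + fps_X ^ p * (1 + fps_X) ^ s) $ i"
    by simp
  then show ?thesis by (simp add: one_plus_X_power_nth fps_X_power_mult_nth)
qed

text \<open>Used with n = p: reducing an exponent modulo p alters a binomial series only from degree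
  p on, and only this first discrepancy is of interest.\<close>

lemma fps_mult_nth_perturb:
  fixes A A' B :: "'k::comm_ring_1 fps"
  assumes "\<And>i. i < n \<Longrightarrow> A $ i = A' $ i"
  shows "(A * B) $ n = (A' * B) $ n + (A $ n - A' $ n) * B $ 0"
proof -
  have split: "(C * B) $ n = (\<Sum>i<n. C $ i * B $ (n - i)) + C $ n * B $ 0" for C :: "'k fps"
  proof -
    have "{0..n} = insert n {..<n}" by auto
    then show ?thesis by (simp add: fps_mult_nth)
  qed
  have "(\<Sum>i<n. A $ i * B $ (n - i)) = (\<Sum>i<n. A' $ i * B $ (n - i))"
    using assms by (intro sum.cong) auto
  then show ?thesis by (simp add: split algebra_simps)
qed

section \<open>The cohomology of the cyclic group under weighted endomorphisms\<close>

text \<open>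
  The carry cocycle: modulo \<open>p\<close>, the binomial coefficient is \<open>1\<close> if the addition of the residues
  produces a carry, and \<open>0\<close> otherwise. It is the coefficient of \<open>X ^ p\<close> in
  \<open>(1 + X) ^ (residue a + residue b)\<close>.
\<close>

fun carry :: "'p::prime_card mod_ring list \<Rightarrow> 'p mod_ring" where
  "carry [a, b] = of_nat ((residue a + residue b) choose CARD('p))"
| "carry _ = 0"

lemma carry_length: "carry as \<noteq> 0 \<Longrightarrow> length as = 2"
  by (induction as rule: carry.induct) auto

definition carry_cocycle :: "('p::prime_card mod_ring, 'p mod_ring) cochain" where
  "carry_cocycle = of_bar carry"

lemma carry_cocycle_length: "carry_cocycle xs \<noteq> 0 \<Longrightarrow> length xs = 3"
  using carry_length by (cases xs) (fastforce simp: carry_cocycle_def)+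

definition binom_series :: "'p::prime_card mod_ring \<Rightarrow> 'k::comm_ring_1 fps" where
  "binom_series e = (1 + fps_X) ^ residue e"

lemma binom_series_mult_nth:
  "(binom_series a * binom_series b) $ n = of_nat ((residue a + residue b) choose n)"
  unfolding binom_series_def power_add[symmetric] by (rule one_plus_X_power_nth)

lemma binom_series_nth: "binom_series a $ n = of_nat (residue a choose n)"
  by (simp add: binom_series_def one_plus_X_power_nth)

lemma binom_series_mult_low:
  fixes a b :: "'p::prime_card mod_ring"
  assumes "CHAR('k) = CARD('p)" "n < CARD('p)"
  shows "(binom_series a * binom_series b :: 'k::comm_ring_1 fps) $ n = binom_series (a + b) $ n"
  using of_nat_choose_add_prime[where ?'k = 'k, of "CARD('p)" "residue (a + b)" n] assms
    prime_card[where ?'a = 'p]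
  by (cases a b rule: residue_add_cases) (simp_all add: binom_series_mult_nth binom_series_nth)

text \<open>Replacing the product of the series of a and b by the series of a + b changes nothing
  below degree p, and in degree p it changes the coefficient by the carry. So each side of the
  cocycle identity is the coefficient of X^p in the product of three series, and commutativity
  identifies the two bracketings.\<close>

lemma carry_cocycle_cocycle:
  "carry_cocycle \<in> carrier (cocycle_ring (add_group :: 'p::prime_card mod_ring monoid))"
proof -
  have eq: "(binom_series a * binom_series b * binom_series c :: 'p mod_ring fps) $ CARD('p)
      = carry [a + b, c] + carry [a, b]" for a b c :: "'p mod_ring"
    using fps_mult_nth_perturb[of "CARD('p)" "binom_series a * binom_series b"
        "binom_series (a + b) :: 'p mod_ring fps" "binom_series c"] residue_less[of "a + b"]
    by (simp add: binom_series_mult_low) (simp add: binom_series_mult_nth binom_series_nth binomial_eq_0)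
  have "carry [a + b, c] + carry [a, b] = carry [a, b + c] + carry [b, c]" for a b c :: "'p mod_ring"
    using eq[of a b c] eq[of b c a]
    by (simp add: ac_simps)
  then have "cobd (of_bar carry) xs = 0" if "length xs = 4" for xs :: "'p mod_ring list"
  proof -
    obtain w x y z where xs: "xs = [w, x, y, z]"
      using \<open>length xs = 4\<close> by (auto simp: length_Suc_conv numeral_eq_Suc)
    show ?thesis
      using \<open>\<And>a b c. carry [a + b, c] + carry [a, b] = carry [a, b + c] + carry [b, c]\<close>[of "x - w" "y - x" "z - y"]
      by (simp add: xs del: carry.simps(1)) (simp add: algebra_simps del: carry.simps(1))
  qed
  moreover have "cobd (of_bar carry) xs = 0" if "length xs \<noteq> 4" for xs :: "'p mod_ring list"
  proof -
    have "cobd carry_cocycle xs = cobd (\<lambda>_. 0 :: 'p mod_ring) xs"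
      by (rule cobd_cong) (use carry_cocycle_length \<open>length xs \<noteq> 4\<close> in force)
    then show ?thesis by (simp add: carry_cocycle_def)
  qed
  ultimately have "cobd (of_bar carry) xs = 0" for xs :: "'p mod_ring list" by blast
  moreover have "of_bar carry \<in> cochains (add_group :: 'p mod_ring monoid) UNIV"
    by (rule of_bar_in_cochains[where n = 2]) (simp add: carry_length)
  ultimately show ?thesis
    by (simp add: carrier_cocycle_ring carry_cocycle_def coboundary_add_group fun_eq_iff)
qed

text \<open>Adding 1 to m produces no carry before m = p - 1, so a primitive g satisfies g(m) = m
  g(1) up to that point. The single carry in the last step would then give 1 = p g(1) - g(0) =
  0.\<close>

lemma carry_cocycle_not_coboundary:
  "carry_cocycle \<notin> coboundaries (add_group :: 'p::prime_card mod_ring monoid)"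
proof
  assume "carry_cocycle \<in> coboundaries (add_group :: 'p mod_ring monoid)"
  then obtain h where h: "h \<in> cochains (add_group :: 'p mod_ring monoid) UNIV" "carry_cocycle = cobd h"
    by (auto elim: coboundariesE simp: coboundary_add_group)
  define g where "g a = h [0, a]" for a
  have "h [a, a + b] = g b" for a b
    using cochains_invariant[OF h(1), of a "[0, b]"] by (simp add: g_def)
  then have g: "carry [a, b] = g b - g (a + b) + g a" for a b
    using fun_cong[OF h(2), of "[0, a, a + b]"] by (simp add: carry_cocycle_def g_def del: carry.simps(1))
  have g0: "g 0 = 0" using g[of 0 0] by (simp add: zero_less_card_finite binomial_eq_0)
  have step: "g (of_nat m) = of_nat m * g 1" if "m < CARD('p)" for m
    using that
  proof (induction m)
    case (Suc m)
    have "carry [of_nat m, 1 :: 'p mod_ring] = 0"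
      using Suc.prems by (simp add: residue_of_nat_less binomial_eq_0)
    then show ?case
      using g[of "of_nat m" 1] Suc by (simp del: carry.simps(1) add: algebra_simps)
  qed (simp add: g0)
  define q where "q = CARD('p) - 1"
  have q: "CARD('p) = Suc q" using card_gt_1[where ?'p = 'p] by (simp add: q_def)
  have "carry [of_nat q, 1 :: 'p mod_ring] = 1"
    using q by (simp add: residue_of_nat_less)
  moreover have "carry [of_nat q, 1 :: 'p mod_ring] = g 1 - g (of_nat (Suc q)) + of_nat q * g 1"
    using g[of "of_nat q" 1] step[of q] q by (simp del: carry.simps(1) add: algebra_simps)
  moreover have "of_nat (Suc q) = (0 :: 'p mod_ring)"
    unfolding q[symmetric] by (rule of_nat_card_eq_0)
  moreover have "g 1 + of_nat q * g 1 = of_nat (Suc q) * g 1" by (simp add: algebra_simps)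
  ultimately show False using g0 by simp
qed

locale weighted_endo = weighted_hom L
  for L :: "'p::prime_card mod_ring \<Rightarrow> ('p mod_ring \<Rightarrow> 'p mod_ring poly) \<Rightarrow> 'p mod_ring poly"
begin

text \<open>The scalar by which \<open>L\<close> acts on additive functions, that is, on first
  cohomology.\<close>

definition slope :: "'p mod_ring poly" where "slope = L 1 (\<lambda>e. [:e:])"

lemma const_poly_of_nat: "[:of_nat n:] = (of_nat n :: 'a::comm_ring_1 poly)"
  by (simp add: of_nat_poly)

lemma L_id: "L j (\<lambda>e. [:e:]) = [:j:] * slope"
proof -
  have "L (j + k) (\<lambda>e. [:e:]) = L j (\<lambda>e. [:e:]) + L k (\<lambda>e. [:e:])" for j k
  proof -
    have "[:e + e':] = [:e:] + [:e':]" for e e' :: "'p mod_ring" by simp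
    then have "L (j + k) (\<lambda>e. [:e:]) = L j (\<lambda>e. L k (\<lambda>e'. [:e:] + [:e':]))" by (simp only: L_conv)
    then show ?thesis by (simp only: L_add L_const)
  qed
  from additive_mod_ring[where g = "\<lambda>j. L j (\<lambda>e. [:e:])" and a = j, OF this]
  have "L j (\<lambda>e. [:e:]) = of_nat (residue j) * slope" by (simp add: slope_def)
  also have "of_nat (residue j) = [:j:]"
    using const_poly_of_nat[of "residue j", where ?'a = "'p mod_ring"] by simp
  finally show ?thesis .
qed

definition scales :: "('p mod_ring, 'p mod_ring) cochain \<Rightarrow> 'p mod_ring poly \<Rightarrow> bool" where
  "scales f c \<longleftrightarrow> (\<lambda>xs. shift L (extend_scalars f) xs - c * extend_scalars f xs) \<in> coboundaries add_group"

text \<open>Length 2 means degree one. Such a cocycle is an additive function of the difference of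
  its vertices, hence a multiple of the identity function, so the relation holds exactly and not
  only up to a coboundary.\<close>

lemma scales_degree_one:
  assumes f: "f \<in> carrier (cocycle_ring add_group)" and len: "\<And>xs. f xs \<noteq> 0 \<Longrightarrow> length xs = 2"
  shows "scales f slope"
proof -
  have f': "f \<in> cochains add_group UNIV" "cobd f = (\<lambda>_. 0)"
    using f by (auto simp: carrier_cocycle_ring coboundary_add_group)
  define g where "g a = f [0, a]" for a
  have fg: "f [x, y] = g (y - x)" for x y
    using cochains_invariant[OF f'(1), of x "[0, y - x]"] by (simp add: g_def)
  have "g (a + b) = g a + g b" for a b
    using fun_cong[OF f'(2), of "[0, a, a + b]"] by (simp add: fg)
  then have g: "g a = a * g 1" for a using additive_mod_ring[of g a] by simp
  have "shift L (extend_scalars f) xs = slope * extend_scalars f xs" for xs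
  proof (cases "length xs = 2")
    case True
    then obtain x y where xs: "xs = [x, y]" by (auto simp: length_Suc_conv numeral_2_eq_2)
    have "(\<lambda>e. [:f [0, e]:]) = (\<lambda>e. [:g 1:] * [:e:])"
    proof
      fix e show "[:f [0, e]:] = [:g 1:] * [:e:]" using g[of e] by (simp add: fg mult.commute)
    qed
    then have "shift L (extend_scalars f) xs = L (y - x) (\<lambda>e. [:g 1:] * [:e:])"
      by (simp add: xs shift_def to_bar_def extend_scalars_def)
    also have "\<dots> = slope * [:(y - x) * g 1:]"
      by (simp only: L_scale L_id) simp
    also have "(y - x) * g 1 = f xs" using g[of "y - x"] by (simp add: xs fg)
    finally show ?thesis by (simp only: extend_scalars_def[of f xs])
  next
    case False
    have "weigh L (to_bar (extend_scalars f)) js = 0" if "length js \<noteq> 1" for js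
      by (rule weigh_eq_zero) (use len that in \<open>force simp: to_bar_def extend_scalars_def\<close>)
    then have "shift L (extend_scalars f) xs = 0"
      using False by (cases xs) (simp_all add: shift_def)
    moreover have "f xs = 0" using False len by blast
    ultimately show ?thesis by (simp add: extend_scalars_def)
  qed
  then show ?thesis by (simp add: scales_def)
qed

text \<open>Writing a generator of the cyclic group as 1 + X turns its group algebra into
  polynomials truncated at X^p. This is the image of the unit attached to j under that
  identification, lifted to power series; below degree p it is therefore multiplicative in
  j.\<close>

definition series :: "'p mod_ring \<Rightarrow> 'p mod_ring poly fps" where
  "series j = Abs_fps (\<lambda>n. L j (\<lambda>e. binom_series e $ n))"

lemma series_mult_nth:
  "(series j * series k) $ n = L j (\<lambda>e. L k (\<lambda>e'. (binom_series e * binom_series e') $ n))"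
  by (simp add: series_def fps_mult_nth L_sum L_scale L_scale_right)

lemma series_mult_low:
  "n < CARD('p) \<Longrightarrow> (series j * series k) $ n = series (j + k) $ n"
  unfolding series_mult_nth by (simp add: binom_series_mult_low series_def L_conv)

lemma series_nth_card: "series j $ CARD('p) = 0"
  by (simp add: series_def binom_series_nth binomial_eq_0 residue_less L_const)

lemma series_nth_0: "series j $ 0 = 1"
  by (simp add: series_def binom_series_nth L_one)

lemma series_nth_1: "series 1 $ 1 = slope"
  by (simp add: series_def binom_series_nth slope_def flip: const_poly_of_nat)

lemma series_power_low: "n < CARD('p) \<Longrightarrow> (series 1 ^ m) $ n = series (of_nat m) $ n"
proof (induction m arbitrary: n)
  case 0
  then show ?case by (cases n) (simp_all add: series_def binom_series_nth L_zero)
next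
  case (Suc m)
  have "(series 1 ^ Suc m) $ n = (series (of_nat m) * series 1) $ n"
    using Suc by (simp add: power_Suc2 fps_mult_nth del: power_Suc)
  then show ?case using series_mult_low[OF Suc.prems, of "of_nat m" 1] by (simp add: add.commute)
qed

lemma series_power_card_mult: "(series 1 ^ CARD('p) * A) $ CARD('p) = A $ CARD('p) + slope ^ CARD('p) * A $ 0"
proof -
  \<comment> \<open>The constant term of \<open>series 1\<close> is 1 by augmentation, so R is
    (\<open>series 1\<close> - 1)/X and its constant term is the slope. Frobenius on 1 + X R is the
    origin of the exponent p.\<close>
  define R where "R = fps_shift 1 (series 1)"
  have "series 1 = 1 + fps_X * R"
  proof (rule fps_ext)
    show "series 1 $ n = (1 + fps_X * R) $ n" for n
      by (cases n) (simp_all add: R_def series_nth_0)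
  qed
  then have "series 1 ^ CARD('p) = (1 + fps_X * R) ^ CARD('p)" by (rule arg_cong)
  also have "\<dots> = 1 ^ CARD('p) + (fps_X * R) ^ CARD('p)"
    by (rule freshmans_dream) (simp_all add: prime_card)
  finally have "series 1 ^ CARD('p) = 1 + fps_X ^ CARD('p) * R ^ CARD('p)"
    by (simp only: power_one power_mult_distrib)
  then have "series 1 ^ CARD('p) * A = A + fps_X ^ CARD('p) * (R ^ CARD('p) * A)"
    by (simp add: distrib_right mult.assoc)
  moreover have "(R ^ CARD('p)) $ 0 = slope ^ CARD('p)"
    using series_nth_1 by (simp add: R_def fps_power_zeroth)
  ultimately show ?thesis by (simp add: fps_X_power_mult_nth)
qed

text \<open>
  Write \<open>q\<close> for \<open>series 1\<close>. Below degree \<open>p\<close> the series \<open>q ^ j\<close> and \<open>series j\<close> agree; their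
  difference \<open>u j\<close> in degree \<open>p\<close> is the cochain whose coboundary compares the pulled back carry
  cocycle with a multiple of the carry cocycle, since \<open>q ^ p = 1 + slope ^ p * X ^ p + \<dots>\<close>.
\<close>

lemma scales_carry: "scales carry_cocycle (slope ^ CARD('p))"
proof -
  define u where "u j = (series 1 ^ residue j) $ CARD('p)" for j :: "'p mod_ring"
  define U where "U = (\<lambda>as. case as of [a] \<Rightarrow> u a | _ \<Rightarrow> 0)"
  have low: "(series 1 ^ residue j) $ i = series j $ i" if "i < CARD('p)" for i j
    using series_power_low[OF that, of "residue j"] by simp
  have key: "(series j * series k) $ CARD('p) + u j + u k = u (j + k) + slope ^ CARD('p) * [:carry [j, k]:]" for j k
  proof -
    have "(series 1 ^ residue j * series 1 ^ residue k) $ CARD('p)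
        = (series j * series 1 ^ residue k) $ CARD('p) + u j"
      using fps_mult_nth_perturb[of "CARD('p)" "series 1 ^ residue j" "series j" "series 1 ^ residue k"] low
      by (simp add: u_def series_nth_card series_nth_0)
    also have "(series j * series 1 ^ residue k) $ CARD('p) = (series k * series j) $ CARD('p) + u k"
      using fps_mult_nth_perturb[of "CARD('p)" "series 1 ^ residue k" "series k" "series j"] low
      by (simp add: u_def series_nth_card series_nth_0 mult.commute)
    finally have powers: "(series j * series k) $ CARD('p) + u j + u k = (series 1 ^ (residue j + residue k)) $ CARD('p)"
      by (simp add: power_add mult.commute add_ac)
    show ?thesis
    proof (cases j k rule: residue_add_cases)
      case 1
      then show ?thesis using powers by (simp add: u_def binomial_eq_0)
    next
      case 2
      have "of_nat ((CARD('p) + residue (j + k)) choose CARD('p)) = (1 :: 'p mod_ring)"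
        using of_nat_choose_add_prime[where ?'k = "'p mod_ring", of "CARD('p)" "residue (j + k)" "CARD('p)"]
          prime_card[where ?'a = 'p] residue_less[of "j + k"]
        by (simp add: binomial_eq_0)
      then have "[:carry [j, k]:] = 1" using 2 by simp
      moreover have "(series 1 ^ (residue j + residue k)) $ CARD('p) = u (j + k) + slope ^ CARD('p)"
        unfolding 2 power_add series_power_card_mult
        using low[of 0 "j + k"] by (simp add: u_def series_nth_0)
      ultimately show ?thesis using powers by simp
    qed
  qed
  have "shift L (extend_scalars carry_cocycle) xs - slope ^ CARD('p) * extend_scalars carry_cocycle xs
      = cobd (\<lambda>ys. - of_bar U ys) xs" for xs
  proof (cases "length xs = 3")
    case True
    then obtain x y z where xs: "xs = [x, y, z]" by (auto simp: length_Suc_conv numeral_3_eq_3)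
    have "to_bar (extend_scalars carry_cocycle) as = [:carry as:]" for as :: "'p mod_ring list"
      using fun_cong[OF to_bar_of_bar[of carry], of as]
      by (simp add: carry_cocycle_def extend_scalars_def to_bar_def)
    then have "shift L (extend_scalars carry_cocycle) xs
        = L (y - x) (\<lambda>e. L (z - y) (\<lambda>e'. [:carry [e, e']:]))"
      by (simp add: xs shift_def del: carry.simps(1))
    also have "\<dots> = (series (y - x) * series (z - y)) $ CARD('p)"
      by (simp add: series_mult_nth binom_series_mult_nth const_poly_of_nat)
    finally show ?thesis
      using key[of "y - x" "z - y"]
      by (simp add: xs carry_cocycle_def extend_scalars_def U_def del: carry.simps(1))
         (simp add: algebra_simps del: carry.simps(1))
  next
    case False
    have "weigh L (to_bar (extend_scalars carry_cocycle)) js = 0" if "length js \<noteq> 2" for js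
      by (rule weigh_eq_zero) (use carry_cocycle_length that in \<open>force simp: to_bar_def extend_scalars_def\<close>)
    then have "shift L (extend_scalars carry_cocycle) xs = 0"
      using False by (cases xs) (simp_all add: shift_def)
    moreover have "carry_cocycle xs = 0" using False carry_cocycle_length by blast
    moreover have "cobd (\<lambda>ys. - of_bar U ys) xs = cobd (\<lambda>_. 0) xs"
    proof (rule cobd_cong)
      fix ys :: "'p mod_ring list" assume "Suc (length ys) = length xs"
      then have "length ys \<noteq> 2" using False by simp
      then show "- of_bar U ys = 0"
        by (cases ys) (auto simp: U_def split: list.split, metis length_0_conv length_Cons length_steps numeral_2_eq_2)
    qed
    ultimately show ?thesis by (simp add: extend_scalars_def)
  qed
  moreover have "of_bar U \<in> cochains add_group UNIV"
    by (rule of_bar_in_cochains[where n = 1]) (auto simp: U_def split: list.splits)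
  ultimately show ?thesis
    unfolding scales_def
    by (intro coboundariesI[OF cochains_minus]) (auto simp: coboundary_add_group fun_eq_iff)
qed

lemma scales_cohomologous:
  assumes "scales f c" and g: "(\<lambda>xs. g xs - a * f xs) \<in> coboundaries add_group"
  shows "scales g c"
proof -
  define h where "h = (\<lambda>xs. g xs - a * f xs)"
  have ext: "extend_scalars g = (\<lambda>xs. [:a:] * extend_scalars f xs + extend_scalars h xs)"
    by (simp add: h_def extend_scalars_def fun_eq_iff)
  have h: "extend_scalars h \<in> coboundaries add_group"
    using g by (simp add: h_def extend_scalars_coboundaries)
  have "(\<lambda>xs. [:a:] * (shift L (extend_scalars f) xs - c * extend_scalars f xs)
      + (shift L (extend_scalars h) xs - c * extend_scalars h xs)) \<in> coboundaries add_group"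
    by (rule coboundaries_add[OF coboundaries_scale[OF assms(1)[unfolded scales_def]]
        coboundaries_diff[OF shift_coboundaries[OF h] coboundaries_scale[OF h]]])
  then show ?thesis
    unfolding scales_def ext shift_add shift_scale by (simp add: algebra_simps)
qed

lemma scales_cup:
  assumes f: "f \<in> carrier (cocycle_ring add_group)" and g: "g \<in> carrier (cocycle_ring add_group)"
    and sf: "scales f c" and sg: "scales g d"
  shows "scales (cup f g) (c * d)"
proof -
  interpret h: ring_hom_ring "cocycle_ring add_group" "cohom_ring add_group"
    "cohom_class add_group :: ('p mod_ring, 'p mod_ring poly) cochain \<Rightarrow> _"
    by (rule cohom_class_ring_hom[OF group_add_group])
  have mult: "cohom_class add_group (cup a b) = cohom_class add_group a \<otimes>\<^bsub>cohom_ring add_group\<^esub> cohom_class add_group b"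
    if "a \<in> carrier (cocycle_ring add_group)" "b \<in> carrier (cocycle_ring add_group)"
    for a b :: "('p mod_ring, 'p mod_ring poly) cochain"
    using h.hom_mult[OF that] by simp
  have scale: "(\<lambda>xs. c * a xs) \<in> carrier (cocycle_ring add_group)" if "a \<in> carrier (cocycle_ring add_group)"
    for c and a :: "('p mod_ring, 'p mod_ring poly) cochain"
    using that by (auto simp: carrier_cocycle_ring cochains_scale coboundary_scale)
  have ef: "extend_scalars f \<in> carrier (cocycle_ring add_group)" and eg: "extend_scalars g \<in> carrier (cocycle_ring add_group)"
    using f g by (simp_all add: extend_scalars_cocycle)
  have cup_ext: "extend_scalars (cup f g) = cup (extend_scalars f) (extend_scalars g)"
    using Ring.ring_hom_mult[OF extend_scalars_ring_hom f g] by simp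
  have "cohom_class add_group (shift L (extend_scalars (cup f g)))
    = cohom_class add_group (shift L (extend_scalars f)) \<otimes>\<^bsub>cohom_ring add_group\<^esub> cohom_class add_group (shift L (extend_scalars g))"
    unfolding cup_ext
    using mult[OF shift_cocycle[OF ef] shift_cocycle[OF eg]] Ring.ring_hom_mult[OF shift_ring_hom ef eg] by simp
  also have "cohom_class add_group (shift L (extend_scalars f)) = cohom_class add_group (\<lambda>xs. c * extend_scalars f xs)"
    using sf by (simp add: scales_def cohom_class_eq_iff)
  also have "cohom_class add_group (shift L (extend_scalars g)) = cohom_class add_group (\<lambda>xs. d * extend_scalars g xs)"
    using sg by (simp add: scales_def cohom_class_eq_iff)
  also have "cohom_class add_group (\<lambda>xs. c * extend_scalars f xs) \<otimes>\<^bsub>cohom_ring add_group\<^esub> cohom_class add_group (\<lambda>xs. d * extend_scalars g xs)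
      = cohom_class add_group (cup (\<lambda>xs. c * extend_scalars f xs) (\<lambda>xs. d * extend_scalars g xs))"
    by (rule mult[OF scale[OF ef] scale[OF eg], symmetric])
  also have "cup (\<lambda>xs. c * extend_scalars f xs) (\<lambda>xs. d * extend_scalars g xs) = (\<lambda>xs. c * d * extend_scalars (cup f g) xs)"
    unfolding cup_ext by (simp add: fun_eq_iff cup_scale_left cup_scale_right)
  finally show ?thesis by (simp add: scales_def cohom_class_eq_iff)
qed

lemma scales_pow:
  assumes f: "f \<in> carrier (cocycle_ring add_group)" and "scales f c"
  shows "scales (f [^]\<^bsub>cocycle_ring add_group\<^esub> (n::nat)) (c ^ n)"
proof (induction n)
  case 0
  have "extend_scalars (cochain_const add_group 1) = (cochain_const add_group 1 :: ('p mod_ring, 'p mod_ring poly) cochain)"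
    by (auto simp: extend_scalars_def cochain_const_def fun_eq_iff)
  then show ?case by (simp add: scales_def shift_const)
next
  case (Suc n)
  interpret ring "cocycle_ring add_group :: ('p mod_ring, 'p mod_ring) cochain ring"
    by (rule ring_cocycle_ring[OF group_add_group])
  have "scales (cup (f [^]\<^bsub>cocycle_ring add_group\<^esub> n) f) (c ^ n * c)"
    by (rule scales_cup[OF nat_pow_closed[OF f] f Suc assms(2)])
  then show ?case by (simp add: mult.commute)
qed

end

unbundle no fps_syntax
notation vec_index (infixl \<open>$\<close> 100)

section \<open>Power sums of linear forms\<close>

text \<open>One digit of Lucas' theorem.\<close>

lemma lucas_step:
  assumes "p = CHAR('k::comm_ring_1)" "prime p" "r < p" "t < p"
  shows "(of_nat ((p * a + r) choose (p * b + t)) :: 'k) = of_nat (a choose b) * of_nat (r choose t)"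
proof (induction a arbitrary: b)
  case 0
  then show ?case using assms(3) by (cases b) (simp_all add: binomial_eq_0)
next
  case (Suc a)
  have eq: "p * Suc a + r = p + (p * a + r)" by simp
  show ?case
  proof (cases b)
    case 0
    then show ?thesis
      using assms Suc.IH[of 0] unfolding eq of_nat_choose_add_prime[OF assms(1,2)] by simp
  next
    case (Suc b')
    then show ?thesis
      using Suc.IH[of b] Suc.IH[of b'] unfolding eq of_nat_choose_add_prime[OF assms(1,2)]
      by (simp add: algebra_simps)
  qed
qed

lemma digit_sum_extend:
  assumes "1 < p" "d \<le> M"
  shows "(\<Sum>i\<le>M. d div p ^ i mod p) = digit_sum p d"
  unfolding digit_sum_def
proof (rule sum.mono_neutral_right)
  have "d div p ^ i = 0" if "d < i" for i
    using that power_gt_expt[of p i] assms(1) by simp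
  then show "\<forall>i\<in>{..M} - {..d}. d div p ^ i mod p = 0" by auto
qed (use assms in auto)

lemma digit_sum_step:
  assumes "1 < p" "r < p"
  shows "digit_sum p (p * a + r) = r + digit_sum p a"
proof -
  have "a \<le> p * a" using assms by simp
  have "digit_sum p (p * a + r) = (\<Sum>i\<le>Suc (p * a + r). (p * a + r) div p ^ i mod p)"
    using assms by (simp only: digit_sum_extend)
  also have "\<dots> = r + (\<Sum>i\<le>p * a + r. (p * a + r) div p ^ Suc i mod p)"
    using assms by (simp only: sum.atMost_Suc_shift) simp
  also have "(\<Sum>i\<le>p * a + r. (p * a + r) div p ^ Suc i mod p) = (\<Sum>i\<le>p * a + r. a div p ^ i mod p)"
    using assms by (simp add: div_mult2_eq)
  also have "\<dots> = digit_sum p a"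
    using assms trans_le_add1[OF \<open>a \<le> p * a\<close>] by (intro digit_sum_extend) auto
  finally show ?thesis .
qed

lemma digit_sum_0 [simp]: "digit_sum p 0 = 0"
  by (simp add: digit_sum_def)

lemma digit_sum_cong:
  assumes "1 < p"
  shows "[d = digit_sum p d] (mod (p - 1))"
proof (induction d rule: less_induct)
  case (less d)
  show ?case
  proof (cases "d = 0")
    case False
    then have "[d div p = digit_sum p (d div p)] (mod (p - 1))"
      using less assms by simp
    then have "[d div p + d mod p + (p - 1) * (d div p) = digit_sum p (d div p) + d mod p + 0] (mod (p - 1))"
      by (intro cong_add cong_refl) (simp_all add: cong_0_iff)
    moreover have "d div p + d mod p + (p - 1) * (d div p) = d"
      using assms mult_div_mod_eq[of p d] by (simp add: algebra_simps diff_mult_distrib)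
    moreover have "digit_sum p (d div p) + d mod p + 0 = digit_sum p d"
      using digit_sum_step[of p "d mod p" "d div p"] assms by simp
    ultimately show ?thesis by simp
  qed simp
qed

text \<open>The digits of j are bounded by those of d and filled greedily from the top. No borrow
  occurs in d - j, so the digit sums add up. By Lucas the binomial coefficient is a product of
  binomials of single digits, each prime to p.\<close>

lemma digit_sum_split:
  assumes p: "p = CARD('p::prime_card)" and s: "s \<le> digit_sum p d"
  shows "\<exists>j\<le>d. digit_sum p j = s \<and> digit_sum p (d - j) = digit_sum p d - s
    \<and> of_nat (d choose j) \<noteq> (0 :: 'p mod_ring)"
  using s
proof (induction d arbitrary: s rule: less_induct)
  case (less d)
  have p1: "1 < p" and prime: "prime p"
    using card_gt_1[where ?'p = 'p] prime_card[where ?'a = 'p] p by simp_all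
  have char: "p = CHAR('p mod_ring)" using p by simp
  define a r where "a = d div p" and "r = d mod p"
  have d: "d = p * a + r" and r: "r < p" using p1 by (simp_all add: a_def r_def)
  have ds: "digit_sum p d = r + digit_sum p a" using digit_sum_step[OF p1 r] d by simp
  show ?case
  proof (cases "d = 0")
    case True
    then show ?thesis using less.prems by (intro exI[of _ 0]) simp
  next
    case False
    then have "a < d" using p1 by (simp add: a_def)
    show ?thesis
    proof (cases "s \<le> digit_sum p a")
      case True
      then obtain j where j: "j \<le> a" "digit_sum p j = s" "digit_sum p (a - j) = digit_sum p a - s"
        "of_nat (a choose j) \<noteq> (0 :: 'p mod_ring)"
        using less.IH[OF \<open>a < d\<close>] by blast
      have "d - (p * j + 0) = p * (a - j) + r"
        using j(1) by (simp add: d diff_mult_distrib2)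
      moreover have "of_nat (d choose (p * j + 0)) \<noteq> (0 :: 'p mod_ring)"
        unfolding d lucas_step[OF char prime r prime_gt_0_nat[OF prime]] using j(4) by simp
      ultimately show ?thesis
        using j ds True digit_sum_step[OF p1, of 0 j] digit_sum_step[OF p1 r, of "a - j"] p1
          trans_le_add1[OF mult_le_mono2[OF j(1)], of p r]
        by (intro exI[of _ "p * j + 0"]) (auto simp: d)
    next
      case False
      define t where "t = s - digit_sum p a"
      have t: "t \<le> r" "s = t + digit_sum p a" using False less.prems ds by (auto simp: t_def)
      have "\<not> p dvd fact r" using prime r by (simp add: prime_dvd_fact_iff)
      moreover have "(r choose t) dvd fact r"
        using binomial_fact_lemma[OF t(1)] by (metis dvd_triv_right)
      ultimately have "\<not> p dvd (r choose t)" using dvd_trans by blast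
      then have "of_nat (r choose t) \<noteq> (0 :: 'p mod_ring)"
        using of_nat_0_mod_ring_dvd p by blast
      then have "of_nat (d choose (p * a + t)) \<noteq> (0 :: 'p mod_ring)"
        unfolding d lucas_step[OF char prime r le_less_trans[OF t(1) r]] by simp
      moreover have "digit_sum p (r - t) = r - t"
        using digit_sum_step[OF p1, of "r - t" 0] r by simp
      ultimately show ?thesis
        using t r ds digit_sum_step[OF p1, of t a]
        by (intro exI[of _ "p * a + t"]) (auto simp: d)
    qed
  qed
qed

section \<open>Power sums over the prime field and over its linear forms\<close>

lemma mod_ring_power_card_minus_one:
  assumes "b \<noteq> (0 :: 'p::prime_card mod_ring)"
  shows "b ^ (CARD('p) - 1) = 1"
proof -
  have "b * b ^ (CARD('p) - 1) = b * 1"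
    using finite_field_power_card_eq_same[of b] card_gt_1[where ?'p = 'p] by (simp flip: power_Suc)
  then show ?thesis using assms mult_left_cancel[of b "b ^ (CARD('p) - 1)" 1] by blast
qed

lemma mod_ring_power_eq_one:
  assumes "b \<noteq> (0 :: 'p::prime_card mod_ring)" "CARD('p) - 1 dvd j"
  shows "b ^ j = 1"
  using assms mod_ring_power_card_minus_one[OF assms(1)] by (auto elim!: dvdE simp: power_mult)

lemma sum_powers_mod_ring:
  assumes "0 < j" "CARD('p::prime_card) - 1 dvd j"
  shows "(\<Sum>b\<in>UNIV. (b :: 'p mod_ring) ^ j) = - 1"
proof -
  have "(\<Sum>b\<in>UNIV. (b :: 'p mod_ring) ^ j) = (\<Sum>b\<in>UNIV - {0}. b ^ j)"
    using assms by (intro sum.mono_neutral_right) auto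
  also have "\<dots> = (\<Sum>b\<in>UNIV - {0 :: 'p mod_ring}. 1)"
    using assms mod_ring_power_eq_one by (intro sum.cong) auto
  also have "\<dots> = of_nat (CARD('p) - 1)" by (simp add: card_Diff_singleton)
  also have "\<dots> = - 1"
    using card_gt_1[where ?'p = 'p] by (simp add: of_nat_diff)
  finally show ?thesis .
qed

definition linear_form :: "nat \<Rightarrow> (nat \<Rightarrow> 'p::prime_card mod_ring poly) \<Rightarrow> (nat \<Rightarrow> 'p mod_ring) \<Rightarrow> 'p mod_ring poly" where
  "linear_form m a c = (\<Sum>k<m. [:c k:] * a k)"

abbreviation coefficient_vectors :: "nat \<Rightarrow> (nat \<Rightarrow> 'p::prime_card mod_ring) set" where
  "coefficient_vectors m \<equiv> {..<m} \<rightarrow>\<^sub>E UNIV"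

text \<open>The offset \<open>X\<close> is there for induction on m: summing over one more
  coefficient b amounts to moving \<open>X\<close> by b times the new slope.\<close>

definition power_sum :: "nat \<Rightarrow> (nat \<Rightarrow> 'p::prime_card mod_ring poly) \<Rightarrow> 'p mod_ring poly \<Rightarrow> nat \<Rightarrow> 'p mod_ring poly" where
  "power_sum m a X d = (\<Sum>c\<in>coefficient_vectors m. (X + linear_form m a c) ^ d)"

lemma power_sum_Suc:
  "power_sum (Suc m) a X d = (\<Sum>b\<in>UNIV. power_sum m a (X + [:b:] * a m) d)"
proof -
  let ?V = "coefficient_vectors m :: (nat \<Rightarrow> 'a mod_ring) set"
  have V: "coefficient_vectors (Suc m) = (\<lambda>(b, c). c(m := b)) ` (UNIV \<times> ?V)"
    unfolding lessThan_Suc by (rule PiE_insert_eq)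
  have inj: "inj_on (\<lambda>(b, c). c(m := b)) (UNIV \<times> ?V)"
    using inj_combinator[of m "{..<m}" "\<lambda>_. UNIV :: 'a mod_ring set"] by simp
  have "linear_form (Suc m) a (c(m := b)) = linear_form m a c + [:b:] * a m" for b c
    by (simp add: linear_form_def)
  then have "power_sum (Suc m) a X d = (\<Sum>(b, c)\<in>UNIV \<times> ?V. (X + (linear_form m a c + [:b:] * a m)) ^ d)"
    unfolding power_sum_def V sum.reindex[OF inj] by (simp add: case_prod_unfold)
  also have "\<dots> = (\<Sum>b\<in>UNIV. \<Sum>c\<in>?V. (X + [:b:] * a m + linear_form m a c) ^ d)"
    by (simp add: sum.cartesian_product add_ac)
  finally show ?thesis by (simp add: power_sum_def)
qed

lemma power_sum_cong:
  "(\<And>k. k < m \<Longrightarrow> a k = a' k) \<Longrightarrow> power_sum m a X d = power_sum m a' X d"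
  by (simp add: power_sum_def linear_form_def)

lemma power_sum_expand:
  "power_sum m a X d = (\<Sum>j\<le>d. of_nat (d choose j) * X ^ j * power_sum m a 0 (d - j))"
  unfolding power_sum_def binomial_ring sum_distrib_left add_0_left
  by (rule sum.swap)

lemma infinite_poly_UNIV: "infinite (UNIV :: 'a::comm_ring_1 poly set)"
proof
  assume "finite (UNIV :: 'a poly set)"
  then have "finite (range (\<lambda>n. monom (1 :: 'a) n))" by (rule finite_subset[rotated]) simp
  moreover have "inj (\<lambda>n. monom (1 :: 'a) n)" by (rule injI) (metis degree_monom_eq one_neq_zero)
  ultimately show False using finite_imageD by blast
qed

lemma const_poly_sum: "(\<Sum>i\<in>I. [:f i:]) = [:\<Sum>i\<in>I. f i:]"
  by (induction I rule: infinite_finite_induct) simp_all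

text \<open>Each variable costs p - 1 units of the digit sum. Choose j with digit sum p - 1 by
  \<open>digit_sum_split\<close>; then p - 1 divides j and the sum of b^j over the field is -1. As a
  polynomial in the new slope x, the power sum has at x^j the coefficient - binom(d, j) times the
  power sum of exponent d - j in the old slopes. This is nonzero by induction, and a nonzero
  polynomial over an infinite domain has a non-root.\<close>

lemma power_sum_nonzero:
  assumes "1 \<le> m" "m \<le> k" "digit_sum CARD('p::prime_card) d = k * (CARD('p) - 1)"
  shows "\<exists>a. power_sum m a 0 d \<noteq> (0 :: 'p mod_ring poly)"
  using assms
proof (induction m arbitrary: k d rule: nat_induct_at_least)
  case base
  let ?p = "CARD('p)"
  have p1: "1 < ?p" by (rule card_gt_1)
  have "?p - 1 dvd d"
    using digit_sum_cong[OF p1, of d] base by (simp add: cong_dvd_iff)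
  moreover have "d \<noteq> 0"
  proof
    assume "d = 0" then show False using base p1 by simp
  qed
  ultimately have s: "(\<Sum>b\<in>UNIV. (b :: 'p mod_ring) ^ d) = - 1" using sum_powers_mod_ring by blast
  have "power_sum (Suc 0) (\<lambda>_. 1) 0 d = (\<Sum>b\<in>UNIV. [:b:] ^ d :: 'p mod_ring poly)"
    by (simp add: power_sum_Suc) (simp add: power_sum_def linear_form_def)
  also have "\<dots> = [:(\<Sum>b\<in>UNIV. b ^ d):]"
    by (simp add: poly_const_pow const_poly_sum)
  also have "\<dots> \<noteq> 0" using s by simp
  finally show ?case by (intro exI[of _ "\<lambda>_. 1"]) simp
next
  case (Suc m)
  let ?p = "CARD('p)"
  have p1: "1 < ?p" by (rule card_gt_1)
  obtain k' where k: "k = Suc k'" "m \<le> k'" using Suc.prems by (cases k) auto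
  have ds: "digit_sum ?p d = (?p - 1) + k' * (?p - 1)" using Suc.prems k by simp
  then have "?p - 1 \<le> digit_sum ?p d" by (simp only: le_add1)
  from digit_sum_split[where ?'p = 'p, OF refl this]
  obtain j where j: "j \<le> d" "digit_sum ?p j = ?p - 1" "digit_sum ?p (d - j) = digit_sum ?p d - (?p - 1)"
    "of_nat (d choose j) \<noteq> (0 :: 'p mod_ring)"
    by blast
  have "digit_sum ?p (d - j) = k' * (?p - 1)" using j(3) ds by simp
  then obtain a where a: "power_sum m a 0 (d - j) \<noteq> (0 :: 'p mod_ring poly)"
    using Suc.IH[OF k(2)] by blast
  have jd: "0 < j" "?p - 1 dvd j"
    using digit_sum_cong[OF p1, of j] j(2) p1 by (auto simp: cong_dvd_iff intro!: gr0I)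
  have sj: "(\<Sum>b\<in>UNIV. [:b:] ^ j) = (- 1 :: 'p mod_ring poly)"
    using sum_powers_mod_ring[OF jd] by (simp add: poly_const_pow const_poly_sum one_pCons)
  define Q :: "'p mod_ring poly poly" where
    "Q = (\<Sum>i\<le>d. monom (of_nat (d choose i) * (\<Sum>b\<in>UNIV. [:b:] ^ i) * power_sum m a 0 (d - i)) i)"
  have "coeff Q j = of_nat (d choose j) * (- 1) * power_sum m a 0 (d - j)"
    using j(1) sj by (simp add: Q_def coeff_sum)
  moreover have "of_nat (d choose j) \<noteq> (0 :: 'p mod_ring poly)"
    using j(4) by (simp add: of_nat_poly)
  ultimately have "Q \<noteq> 0" using a by auto
  then have "finite {x. poly Q x = 0}" by (rule poly_roots_finite)
  then have "{x. poly Q x = 0} \<noteq> UNIV"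
    using infinite_poly_UNIV[where ?'a = "'p mod_ring"] by auto
  then obtain x where x: "poly Q x \<noteq> 0" by blast
  have "power_sum (Suc m) (a(m := x)) 0 d = (\<Sum>b\<in>UNIV. power_sum m a ([:b:] * x) d)"
    unfolding power_sum_Suc by (intro sum.cong power_sum_cong refl) (simp_all add: power_sum_cong[of m "a(m := x)" a])
  also have "\<dots> = (\<Sum>i\<le>d. \<Sum>b\<in>UNIV. of_nat (d choose i) * ([:b:] * x) ^ i * power_sum m a 0 (d - i))"
    unfolding power_sum_expand[of m a "_ * x"] by (rule sum.swap)
  also have "\<dots> = poly Q x"
    by (simp add: Q_def poly_sum poly_monom power_mult_distrib sum_distrib_left sum_distrib_right mult_ac
        del: mult_pCons_left mult_pCons_right)
  finally have "power_sum (Suc m) (a(m := x)) 0 d \<noteq> 0" using x by (simp only: not_False_eq_True)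
  then show ?case by blast
qed

section \<open>Existence of weighted homomorphisms\<close>

definition weighted_sum :: "('e \<Rightarrow>\<^sub>0 'k::comm_ring_1) \<Rightarrow> ('e \<Rightarrow> 'k) \<Rightarrow> 'k" where
  "weighted_sum w F = (\<Sum>e\<in>Poly_Mapping.keys w. Poly_Mapping.lookup w e * F e)"

lemma weighted_sum_superset:
  "finite A \<Longrightarrow> Poly_Mapping.keys w \<subseteq> A \<Longrightarrow> weighted_sum w F = (\<Sum>e\<in>A. Poly_Mapping.lookup w e * F e)"
  unfolding weighted_sum_def by (rule sum.mono_neutral_left) (auto simp: in_keys_iff)

lemma weighted_sum_add: "weighted_sum (w + w') F = weighted_sum w F + weighted_sum w' F"
proof -
  have "weighted_sum (w + w') F = (\<Sum>e\<in>Poly_Mapping.keys w \<union> Poly_Mapping.keys w'. Poly_Mapping.lookup (w + w') e * F e)"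
    by (rule weighted_sum_superset) (simp_all add: keys_add)
  then show ?thesis
    using weighted_sum_superset[of "Poly_Mapping.keys w \<union> Poly_Mapping.keys w'" w F] weighted_sum_superset[of "Poly_Mapping.keys w \<union> Poly_Mapping.keys w'" w' F]
    by (simp add: lookup_add distrib_right sum.distrib)
qed

lemma weighted_sum_single [simp]: "weighted_sum (Poly_Mapping.single e c) F = c * F e"
  using weighted_sum_superset[of "{e}" "Poly_Mapping.single e c" F] by simp

lemma weighted_sum_zero [simp]: "weighted_sum 0 F = 0"
  by (simp add: weighted_sum_def)

lemma weighted_sum_sum: "weighted_sum (\<Sum>i\<in>I. w i) F = (\<Sum>i\<in>I. weighted_sum (w i) F)"
  by (induction I rule: infinite_finite_induct) (simp_all add: weighted_sum_add)

lemma sum_single_lookup: "(\<Sum>e\<in>Poly_Mapping.keys w. Poly_Mapping.single e (Poly_Mapping.lookup w e)) = w"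
  by (rule poly_mapping_eqI) (simp add: lookup_sum lookup_single when_def in_keys_iff)

lemma weighted_sum_mult:
  fixes w w' :: "'e::ab_group_add \<Rightarrow>\<^sub>0 'k::comm_ring_1"
  shows "weighted_sum (w * w') F = weighted_sum w (\<lambda>e. weighted_sum w' (\<lambda>e'. F (e + e')))"
proof -
  have "w * w' = (\<Sum>e\<in>Poly_Mapping.keys w. Poly_Mapping.single e (Poly_Mapping.lookup w e)) * (\<Sum>e'\<in>Poly_Mapping.keys w'. Poly_Mapping.single e' (Poly_Mapping.lookup w' e'))"
    by (simp add: sum_single_lookup)
  also have "\<dots> = (\<Sum>e\<in>Poly_Mapping.keys w. \<Sum>e'\<in>Poly_Mapping.keys w'. Poly_Mapping.single (e + e') (Poly_Mapping.lookup w e * Poly_Mapping.lookup w' e'))"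
    by (simp add: sum_product mult_single)
  finally show ?thesis
    by (simp add: weighted_sum_sum) (simp add: weighted_sum_def sum_distrib_left mult_ac)
qed

text \<open>Exponents may be taken in the prime field since w^p = 1: a carry in the sum of two
  residues changes the power of w by a factor 1.\<close>

lemma weighted_hom_power:
  fixes w :: "'e::ab_group_add \<Rightarrow>\<^sub>0 'k::comm_ring_1"
  assumes "w ^ CARD('p::prime_card) = 1" and aug: "weighted_sum w (\<lambda>_. 1) = 1"
  shows "weighted_hom (\<lambda>(j :: 'p mod_ring) F. weighted_sum (w ^ residue j) F)"
proof
  fix j k :: "'p mod_ring" and F F' :: "'e \<Rightarrow> 'k" and c :: 'k
  show "weighted_sum (w ^ residue j) (\<lambda>e. F e + F' e) = weighted_sum (w ^ residue j) F + weighted_sum (w ^ residue j) F'"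
    by (simp add: weighted_sum_def distrib_left sum.distrib)
  show "weighted_sum (w ^ residue j) (\<lambda>e. c * F e) = c * weighted_sum (w ^ residue j) F"
    by (simp add: weighted_sum_def sum_distrib_left mult_ac)
  have "weighted_sum (w ^ n) (\<lambda>_. 1) = 1" for n
    using aug by (induction n) (simp_all add: weighted_sum_mult flip: single_one)
  then show "weighted_sum (w ^ residue j) (\<lambda>_. 1) = 1" .
  show "weighted_sum (w ^ residue (0 :: 'p mod_ring)) F = F 0"
    by (simp flip: single_one)
  have "w ^ residue (j + k) = w ^ (residue j + residue k)"
    using assms(1) by (cases j k rule: residue_add_cases) (simp_all add: power_add)
  then show "weighted_sum (w ^ residue (j + k)) F
    = weighted_sum (w ^ residue j) (\<lambda>e. weighted_sum (w ^ residue k) (\<lambda>e'. F (e + e')))"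
    by (simp add: power_add weighted_sum_mult)
qed

text \<open>The vector space \<open>'p mod_ring poly\<close> serves as an elementary abelian group of unbounded rank,
  with the coefficients as coordinates.\<close>

definition coordinate_form :: "nat \<Rightarrow> (nat \<Rightarrow> 'p::prime_card mod_ring) \<Rightarrow> 'p mod_ring poly \<Rightarrow> 'p mod_ring" where
  "coordinate_form m c e = (\<Sum>k<m. c k * coeff e k)"

lemma coordinate_form_add: "coordinate_form m c (e + e') = coordinate_form m c e + coordinate_form m c e'"
  by (simp add: coordinate_form_def algebra_simps sum.distrib)

lemma coordinate_form_monom: "k < m \<Longrightarrow> coordinate_form m c (monom 1 k) = c k"
  by (simp add: coordinate_form_def if_distrib[of "\<lambda>x. _ * x"] cong: if_cong)

text \<open>The unit is w = 1 + \<Sum> a_k (g_k - 1), the generator of a cyclic shifted subgroup. By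
  Frobenius w^p = 1 + \<Sum> a_k^p (g_k^p - 1) = 1 without any condition on the a_k. Its functional
  sends F to F(0) + \<Sum> a_k (F(g_k) - F(0)), which on a linear form pairs the coefficients with
  the a_k.\<close>

lemma weighted_hom_with_slopes:
  fixes a :: "nat \<Rightarrow> 'p::prime_card mod_ring poly"
  obtains L :: "'p mod_ring \<Rightarrow> ('p mod_ring poly \<Rightarrow> 'p mod_ring poly) \<Rightarrow> 'p mod_ring poly"
  where "weighted_hom L" "\<And>c. L 1 (\<lambda>e. [:coordinate_form m c e:]) = linear_form m a c"
proof -
  let ?A = "\<lambda>c. Poly_Mapping.single (0 :: 'p mod_ring poly) (c :: 'p mod_ring poly)"
  let ?g = "\<lambda>e. Poly_Mapping.single (e :: 'p mod_ring poly) (1 :: 'p mod_ring poly)"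
  define w where "w = 1 + (\<Sum>k<m. ?A (a k) * (?g (monom 1 k) + ?A (- 1)))"
  have ws: "weighted_sum w F = F 0 + (\<Sum>k<m. a k * (F (monom 1 k) - F 0))" for F
    by (simp add: w_def weighted_sum_add weighted_sum_sum distrib_left mult_single right_diff_distrib flip: single_one)
  have char: "CHAR('p mod_ring poly \<Rightarrow>\<^sub>0 'p mod_ring poly) = CARD('p)"
  proof (rule CHAR_eqI)
    have *: "of_nat n = (0 :: 'p mod_ring poly \<Rightarrow>\<^sub>0 'p mod_ring poly) \<longleftrightarrow> of_nat n = (0 :: 'p mod_ring poly)" for n
    proof
      assume "of_nat n = (0 :: 'p mod_ring poly \<Rightarrow>\<^sub>0 'p mod_ring poly)"
      then have "Poly_Mapping.lookup (of_nat n :: 'p mod_ring poly \<Rightarrow>\<^sub>0 'p mod_ring poly) 0 = 0" by simp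
      then show "of_nat n = (0 :: 'p mod_ring poly)" by (simp add: lookup_of_nat)
    next
      assume "of_nat n = (0 :: 'p mod_ring poly)"
      then show "of_nat n = (0 :: 'p mod_ring poly \<Rightarrow>\<^sub>0 'p mod_ring poly)" by (metis single_of_nat single_zero)
    qed
    show "of_nat CARD('p) = (0 :: 'p mod_ring poly \<Rightarrow>\<^sub>0 'p mod_ring poly)"
      unfolding * by (simp add: of_nat_eq_0_iff_char_dvd)
    show "CARD('p) dvd n" if "of_nat n = (0 :: 'p mod_ring poly \<Rightarrow>\<^sub>0 'p mod_ring poly)" for n
      using that unfolding * by (simp add: of_nat_eq_0_iff_char_dvd)
  qed
  have prime: "prime CHAR('p mod_ring poly \<Rightarrow>\<^sub>0 'p mod_ring poly)"
    unfolding char by (rule prime_card)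
  have g_pow: "?g e ^ n = ?g (of_nat n * e)" for e n
    by (induction n) (simp_all add: mult_single algebra_simps flip: single_one)
  have "of_nat CARD('p) = (0 :: 'p mod_ring poly)" by (simp add: of_nat_eq_0_iff_char_dvd)
  then have g_card: "?g e ^ CARD('p) = 1" for e
    by (simp add: g_pow)
  have "(?g e + ?A (- 1)) ^ CARD('p) = 0" for e
  proof -
    have "?g e = (?g e + ?A (- 1)) + 1"
      by (simp add: add.assoc flip: single_one single_add)
    then have "?g e ^ CARD('p) = (?g e + ?A (- 1)) ^ CARD('p) + 1 ^ CARD('p)"
      using freshmans_dream[OF prime char[symmetric], of "?g e + ?A (- 1)" 1] by metis
    then show ?thesis by (simp add: g_card)
  qed
  then have "w ^ CARD('p) = 1"
    unfolding w_def
    by (simp add: freshmans_dream[OF prime char[symmetric]] freshmans_dream_sum[OF prime char[symmetric]]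
        power_mult_distrib)
  then have "weighted_hom (\<lambda>(j :: 'p mod_ring) F. weighted_sum (w ^ residue j) F)"
    by (rule weighted_hom_power) (simp add: ws)
  moreover have "weighted_sum (w ^ residue (1 :: 'p mod_ring)) (\<lambda>e. [:coordinate_form m c e:]) = linear_form m a c" for c
    unfolding residue_1 power_one_right ws
    by (simp add: coordinate_form_monom linear_form_def coordinate_form_def[of m c 0] mult.commute)
  ultimately show ?thesis by (rule that)
qed

section \<open>The cohomology of the general linear group of rank two\<close>

lemma GL_simps [simp]:
  "A \<otimes>\<^bsub>GL n\<^esub> B = A * B" "\<one>\<^bsub>GL n\<^esub> = 1\<^sub>m n"
  by (simp_all add: GL_def units_of_mult units_of_one ring_mat_simps)

lemma carrier_GL: "M \<in> carrier (GL n) \<longleftrightarrow> M \<in> carrier_mat n n \<and> det M \<noteq> 0"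
  using unit_imp_det_non_zero[of M n "()"] det_non_zero_imp_unit[of M n "()"]
  by (auto simp: GL_def units_of_carrier Units_def ring_mat_simps)

lemma group_GL: "group (GL n)"
proof -
  interpret R: ring "ring_mat TYPE('a mod_ring) n ()" by (rule ring_mat)
  show ?thesis unfolding GL_def by (rule R.units_group)
qed

lemma finite_carrier_GL: "finite (carrier (GL n :: 'p::prime_card mod_ring mat monoid))"
proof -
  have "carrier (GL n) \<subseteq> mat n n ` (({..<n} \<times> {..<n}) \<rightarrow>\<^sub>E (UNIV :: 'p mod_ring set))"
  proof
    fix M :: "'p mod_ring mat" assume "M \<in> carrier (GL n)"
    then have "M = mat n n (restrict (\<lambda>ij. M $$ ij) ({..<n} \<times> {..<n}))"
      by (intro eq_matI) (auto simp: carrier_GL)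
    then show "M \<in> mat n n ` (({..<n} \<times> {..<n}) \<rightarrow>\<^sub>E (UNIV :: 'p mod_ring set))"
      by (rule image_eqI[where f = "mat n n"]) simp
  qed
  then show ?thesis by (rule finite_subset) (intro finite_imageI finite_PiE finite_cartesian_product, auto)
qed

lemma finite_rcosets_GL: "subgroup H (GL n) \<Longrightarrow> finite (rcosets\<^bsub>GL n\<^esub> H)"
  using subgroup.rcosets_carrier[OF _ group_GL] finite_carrier_GL[of n]
  by (meson finite_Pow_iff finite_subset Pow_iff subsetI)

section \<open>Two-by-two matrices and the unipotent subgroup\<close>

definition mat2 :: "'a \<Rightarrow> 'a \<Rightarrow> 'a \<Rightarrow> 'a \<Rightarrow> 'a mat" where
  "mat2 a b c d = mat_of_rows_list 2 [[a, b], [c, d]]"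

lemma mat2_carrier [simp]: "mat2 a b c d \<in> carrier_mat 2 2" "dim_row (mat2 a b c d) = 2" "dim_col (mat2 a b c d) = 2"
  by (simp_all add: mat2_def mat_of_rows_list_def numeral_2_eq_2)

lemma mat2_index [simp]:
  "mat2 a b c d $$ (0, 0) = a" "mat2 a b c d $$ (0, Suc 0) = b"
  "mat2 a b c d $$ (Suc 0, 0) = c" "mat2 a b c d $$ (Suc 0, Suc 0) = d"
  by (simp_all add: mat2_def mat_of_rows_list_def)

lemma mat2_eqI:
  assumes "M \<in> carrier_mat 2 2" "M $$ (0, 0) = a" "M $$ (0, 1) = b" "M $$ (1, 0) = c" "M $$ (1, 1) = d"
  shows "M = mat2 a b c d"
proof (rule eq_matI)
  fix i j assume "i < dim_row (mat2 a b c d)" "j < dim_col (mat2 a b c d)"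
  then show "M $$ (i, j) = mat2 a b c d $$ (i, j)" using assms by (auto simp: less_2_cases_iff)
qed (use assms in auto)

lemma mat2_inject [simp]: "mat2 a b c d = mat2 a' b' c' d' \<longleftrightarrow> a = a' \<and> b = b' \<and> c = c' \<and> d = d'"
  using mat2_index by metis

lemma mat2_mult:
  "mat2 a b c d * mat2 a' b' c' d' = mat2 (a * a' + b * c') (a * b' + b * d') (c * a' + d * c') (c * b' + d * d')"
proof (rule mat2_eqI)
  show "mat2 a b c d * mat2 a' b' c' d' \<in> carrier_mat 2 2"
    by (rule mult_carrier_mat[OF mat2_carrier(1) mat2_carrier(1)])
qed (simp_all add: scalar_prod_def numeral_2_eq_2)

lemma one_mat2: "1\<^sub>m 2 = mat2 1 0 0 1"
  by (rule mat2_eqI) simp_all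

lemma det_mat2_upper: "det (mat2 a b 0 d) = a * (d :: 'a::comm_ring_1)"
proof -
  have "det (mat2 a b 0 d) = prod_list (diag_mat (mat2 a b 0 d))"
    by (rule det_upper_triangular[where n = 2]) (auto simp: upper_triangular_def less_2_cases_iff)
  then show ?thesis by (simp add: diag_mat_def numeral_2_eq_2)
qed

lemma unipotent_eq: "unipotent c = mat2 1 c 0 1"
  by (simp add: unipotent_def mat2_def)

lemma mat2_upper_GL: "mat2 a b 0 d \<in> carrier (GL 2) \<longleftrightarrow> a \<noteq> 0 \<and> d \<noteq> 0"
  by (simp add: carrier_GL det_mat2_upper)

lemma unipotent_GL: "unipotent c \<in> carrier (GL 2)"
  by (simp add: unipotent_eq mat2_upper_GL)

lemma unipotent_add: "unipotent (c + d) = unipotent c * unipotent d"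
  by (simp add: unipotent_eq mat2_mult add.commute)

lemma unipotent_hom: "unipotent \<in> hom add_group (GL 2)"
  by (simp add: hom_def unipotent_GL unipotent_add)

lemma subgroup_unipotent: "subgroup (range unipotent) (GL 2 :: 'p::prime_card mod_ring mat monoid)"
proof -
  interpret group_hom "add_group :: 'p mod_ring monoid" "GL 2" unipotent
    by (simp add: group_hom_def group_hom_axioms_def group_add_group group_GL unipotent_hom)
  show ?thesis using img_is_subgroup by simp
qed

definition upper_right :: "'a mat \<Rightarrow> 'a" where "upper_right M = M $$ (0, 1)"

lemma upper_right_unipotent [simp]: "upper_right (unipotent c) = c"
  by (simp add: upper_right_def unipotent_eq)

lemma upper_right_hom: "upper_right \<in> hom ((GL 2)\<lparr>carrier := range unipotent\<rparr>) add_group"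
  by (auto simp: hom_def simp flip: unipotent_add)

text \<open>The fixed point congruence for actions of p-groups, read off in degree 0 from the double
  coset formula for the constant cochain 1: a coboundary vanishes on lists of length one.\<close>

lemma card_rcosets_fixed:
  fixes scale :: "'p::prime_card mod_ring \<Rightarrow> 'e::ab_group_add \<Rightarrow> 'e"
    and G :: "('g, 'b) monoid_scheme" and \<rho> :: "'e \<Rightarrow> 'g"
  assumes vs: "vector_space scale" and G: "group G" and H: "subgroup H G" and fin: "finite (rcosets\<^bsub>G\<^esub> H)"
    and \<rho>: "\<rho> \<in> hom add_group G"
  shows "(of_nat (card (rcosets\<^bsub>G\<^esub> H)) :: 'p mod_ring)
    = of_nat (card {K \<in> rcosets\<^bsub>G\<^esub> H. \<forall>e. K #>\<^bsub>G\<^esub> \<rho> e = K})"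
proof -
  interpret group G by fact
  let ?F = "{K \<in> rcosets\<^bsub>G\<^esub> H. \<forall>e. K #>\<^bsub>G\<^esub> \<rho> e = K}"
  let ?u = "cochain_const G (1 :: 'p mod_ring)"
  have u: "?u \<in> cochains G H"
    using cochain_const_in_cochains[OF G] cochains_mono[OF subgroup.subset[OF H]] by blast
  have \<rho>_closed: "\<rho> e \<in> carrier G" for e using \<rho> by (auto simp: hom_def)
  have p0: "of_nat CARD('p) = (0 :: 'p mod_ring)" by simp
  obtain h where h: "h \<in> cochains add_group UNIV"
    "(\<lambda>xs. cochain_pullback add_group \<rho> (cochain_transfer G H ?u) xs
     - (\<Sum>K\<in>?F. ?u (map (\<lambda>e. (SOME t. t \<in> K) \<otimes>\<^bsub>G\<^esub> \<rho> e) xs))) = coboundary add_group h"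
    using transfer_restriction_elementary[OF p0 vs G H fin \<rho> u coboundary_const]
    by (auto elim: coboundariesE)
  have "cochain_pullback add_group \<rho> (cochain_transfer G H ?u) [0] = of_nat (card (rcosets\<^bsub>G\<^esub> H))"
    using some_in_rcoset(2)[OF G H] \<rho>_closed
    by (simp add: cochain_pullback_add_group cochain_transfer_def cochain_const_def)
  moreover have "(\<Sum>K\<in>?F. ?u (map (\<lambda>e. (SOME t. t \<in> K) \<otimes>\<^bsub>G\<^esub> \<rho> e) [0])) = of_nat (card ?F)"
    using some_in_rcoset(2)[OF G H] \<rho>_closed by (simp add: cochain_const_def)
  moreover have "coboundary add_group h [0] = 0"
    using h(1) by (simp add: coboundary_add_group)
  ultimately show ?thesis using fun_cong[OF h(2), of "[0]"] by simp
qed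

lemma vector_space_mod_ring: "vector_space ((*) :: 'p::prime_card mod_ring \<Rightarrow> _)"
  by unfold_locales (simp_all add: algebra_simps)

text \<open>The coset of t is fixed exactly if t normalizes the unipotent subgroup, that is, if t is
  upper triangular; the diagonal torus is a transversal of the unipotent subgroup in the upper
  triangular matrices.\<close>

lemma fixed_cosets_unipotent:
  "bij_betw (\<lambda>(a, d). range unipotent #>\<^bsub>GL 2\<^esub> mat2 a 0 0 d) ((UNIV - {0}) \<times> (UNIV - {0}))
     {K \<in> rcosets\<^bsub>GL 2\<^esub> (range unipotent). \<forall>e :: 'p::prime_card mod_ring. K #>\<^bsub>GL 2\<^esub> unipotent e = K}"
  (is "bij_betw ?c ?D ?F")
proof (rule bij_betw_imageI)
  let ?U = "range (unipotent :: 'p mod_ring \<Rightarrow> _)"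
  interpret group "GL 2 :: 'p mod_ring mat monoid" by (rule group_GL)
  note U = subgroup_unipotent[where ?'p = 'p]
  have U_sub: "?U \<subseteq> carrier (GL 2)" using unipotent_GL by auto
  have mem: "s \<in> ?U #>\<^bsub>GL 2\<^esub> t \<longleftrightarrow> (\<exists>x. s = unipotent x * t)" for s t :: "'p mod_ring mat"
    by (auto simp: r_coset_def)
  have diag: "mat2 a 0 0 d \<in> carrier (GL 2)" if "a \<noteq> 0" "d \<noteq> 0" for a d :: "'p mod_ring"
    using that by (simp add: mat2_upper_GL)
  show "inj_on ?c ?D"
  proof (rule inj_onI)
    fix x y assume x: "x \<in> ?D" and y: "y \<in> ?D" and "?c x = ?c y"
    moreover obtain a d a' d' where xy: "x = (a, d)" "y = (a', d')" by fastforce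
    ultimately have "?U #>\<^bsub>GL 2\<^esub> mat2 a 0 0 d = ?U #>\<^bsub>GL 2\<^esub> mat2 a' 0 0 d'" "a \<noteq> 0" "d \<noteq> 0" by auto
    then have "mat2 a 0 0 d \<in> ?U #>\<^bsub>GL 2\<^esub> mat2 a' 0 0 d'"
      using rcos_self[OF diag U] by blast
    then obtain e where "mat2 a 0 0 d = unipotent e * mat2 a' 0 0 d'" using mem by blast
    then show "x = y" by (simp add: xy unipotent_eq mat2_mult)
  qed
  show "?c ` ?D = ?F"
  proof (intro equalityI subsetI)
    fix K assume "K \<in> ?c ` ?D"
    then obtain a d where ad: "a \<noteq> 0" "d \<noteq> 0" "K = ?U #>\<^bsub>GL 2\<^esub> mat2 a 0 0 d" by auto
    have "K #>\<^bsub>GL 2\<^esub> unipotent e = K" for e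
    proof -
      have "K #>\<^bsub>GL 2\<^esub> unipotent e = ?U #>\<^bsub>GL 2\<^esub> (mat2 a 0 0 d * unipotent e)"
        using coset_mult_assoc[OF U_sub diag[OF ad(1,2)] unipotent_GL] ad(3) by simp
      moreover have "mat2 a 0 0 d * unipotent e = unipotent (a * e / d) * mat2 a 0 0 d"
        using ad by (simp add: unipotent_eq mat2_mult)
      ultimately show ?thesis
        using repr_independence[OF _ diag[OF ad(1,2)] U] mem ad(3) by metis
    qed
    then show "K \<in> ?F" using ad(3) rcosetsI[OF U_sub diag[OF ad(1,2)]] by simp
  next
    fix K assume K: "K \<in> ?F"
    then obtain t where t: "t \<in> carrier (GL 2)" "K = ?U #>\<^bsub>GL 2\<^esub> t" by (auto simp: RCOSETS_def)
    define a b c d where "a = t $$ (0, 0)" and "b = t $$ (0, 1)" and "c = t $$ (1, 0)" and "d = t $$ (1, 1)"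
    have t_eq: "t = mat2 a b c d"
      using t(1) by (intro mat2_eqI) (auto simp: carrier_GL a_def b_def c_def d_def)
    have "K #>\<^bsub>GL 2\<^esub> unipotent 1 = K" using K by blast
    moreover have "t * unipotent 1 \<in> K #>\<^bsub>GL 2\<^esub> unipotent 1"
    proof -
      have "t \<in> K" using rcos_self[OF t(1) U] t(2) by simp
      then show ?thesis unfolding r_coset_def[of "GL 2" K] by auto
    qed
    ultimately obtain x where "t * unipotent 1 = unipotent x * t" using mem t(2) by auto
    \<comment> \<open>The lower right entries of the two products are c + d and d.\<close>
    then have c: "c = 0" by (simp add: t_eq unipotent_eq mat2_mult)
    then have ad: "a \<noteq> 0" "d \<noteq> 0" using t(1) by (simp_all add: t_eq mat2_upper_GL)
    have "t = unipotent (b / d) * mat2 a 0 0 d"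
      using ad c by (simp add: t_eq unipotent_eq mat2_mult)
    then have "K = ?U #>\<^bsub>GL 2\<^esub> mat2 a 0 0 d"
      using repr_independence[OF _ diag[OF ad] U, of t] mem t(2) by auto
    then show "K \<in> ?c ` ?D" using ad by (intro image_eqI[of _ _ "(a, d)"]) auto
  qed
qed

lemma card_mod_ring_units: "of_nat (card (UNIV - {0 :: 'p::prime_card mod_ring})) = (- 1 :: 'p mod_ring)"
  using card_gt_1[where ?'p = 'p] by (simp add: card_Diff_singleton of_nat_diff)

lemma card_fixed_cosets_unipotent:
  "(of_nat (card {K \<in> rcosets\<^bsub>GL 2\<^esub> (range unipotent). \<forall>e :: 'p::prime_card mod_ring. K #>\<^bsub>GL 2\<^esub> unipotent e = K}) :: 'p mod_ring) = 1"
  unfolding bij_betw_same_card[OF fixed_cosets_unipotent, symmetric] card_cartesian_product of_nat_mult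
    card_mod_ring_units by simp

lemma card_rcosets_unipotent:
  "(of_nat (card (rcosets\<^bsub>GL 2\<^esub> (range (unipotent :: 'p::prime_card mod_ring \<Rightarrow> _)))) :: 'p mod_ring) = 1"
  unfolding card_rcosets_fixed[OF vector_space_mod_ring group_GL subgroup_unipotent
      finite_rcosets_GL[OF subgroup_unipotent] unipotent_hom]
  by (rule card_fixed_cosets_unipotent)

text \<open>The unipotent subgroup has index 1 modulo p, so the transfer fixes the cochain f itself,
  while it turns a primitive invariant under the subgroup into one invariant under the whole
  group.\<close>

lemma GL2_restriction_injective:
  fixes f :: "('p::prime_card mod_ring mat, 'p mod_ring) cochain"
  assumes f: "f \<in> carrier (cocycle_ring (GL 2))"
    and res: "cochain_pullback add_group unipotent f \<in> coboundaries add_group"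
  shows "f \<in> coboundaries (GL 2)"
proof -
  let ?U = "range (unipotent :: 'p mod_ring \<Rightarrow> _)"
  note U = subgroup_unipotent[where ?'p = 'p]
  have f': "f \<in> cochains (GL 2) (carrier (GL 2))" "coboundary (GL 2) f = (\<lambda>_. 0)"
    using f by (auto simp: carrier_cocycle_ring)
  have fU: "f \<in> cochains (GL 2) ?U"
    using f'(1) cochains_mono[OF subgroup.subset[OF U]] by blast
  have "cochain_pullback ((GL 2)\<lparr>carrier := ?U\<rparr>) (\<lambda>x. x) f
    = cochain_pullback ((GL 2)\<lparr>carrier := ?U\<rparr>) (\<lambda>x. unipotent (upper_right x)) f"
    by (rule cochain_pullback_cong) auto
  also have "\<dots> = cochain_pullback ((GL 2)\<lparr>carrier := ?U\<rparr>) upper_right (cochain_pullback add_group unipotent f)"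
    by (rule cochain_pullback_comp[symmetric]) simp
  also have "\<dots> \<in> coboundaries ((GL 2)\<lparr>carrier := ?U\<rparr>)"
    by (rule cochain_pullback_coboundaries[OF _ group_add_group upper_right_hom res])
       (rule group.subgroup_imp_group[OF group_GL U])
  finally obtain k where k: "k \<in> cochains (GL 2) ?U" "f = coboundary (GL 2) k"
    using coboundary_if_restriction_coboundary[OF group_GL U fU f'(2)] by blast
  have "cochain_transfer (GL 2) ?U f = f"
    using cochain_transfer_invariant[OF group_GL U f'(1)] by (simp add: card_rcosets_unipotent)
  then have "f = coboundary (GL 2) (cochain_transfer (GL 2) ?U k)"
    using k(2) coboundary_cochain_transfer[OF group_GL U, of k] by simp
  then show ?thesis using cochain_transfer_in_cochains[OF group_GL U k(1)] by (rule coboundariesI[rotated])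
qed

lemma res_GL2_class:
  "res_GL2 (cohom_class (GL 2) f) = cohom_class add_group (cochain_pullback add_group unipotent f)"
  unfolding res_GL2_def Fp_group_eq by (rule cohom_map_class[OF group_add_group group_GL unipotent_hom])

lemma res_GL2_inj: "inj_on res_GL2 (carrier (H_GL 2))"
proof (rule inj_onI)
  fix z w :: "('a mod_ring mat, 'a mod_ring) cohom_class"
  assume "z \<in> carrier (H_GL 2)" "w \<in> carrier (H_GL 2)" and eq: "res_GL2 z = res_GL2 w"
  then obtain f g where f: "f \<in> carrier (cocycle_ring (GL 2))" "z = cohom_class (GL 2) f"
    and g: "g \<in> carrier (cocycle_ring (GL 2))" "w = cohom_class (GL 2) g"
    by (auto simp: carrier_cohom_ring)
  have "(\<lambda>xs. f xs - g xs) \<in> carrier (cocycle_ring (GL 2))"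
    using f g by (simp add: carrier_cocycle_ring cochains_diff coboundary_diff)
  moreover have "cochain_pullback add_group unipotent (\<lambda>xs. f xs - g xs) \<in> coboundaries add_group"
    using eq by (simp add: f g res_GL2_class cohom_class_eq_iff cochain_pullback_diff)
  ultimately have "(\<lambda>xs. f xs - g xs) \<in> coboundaries (GL 2)" by (rule GL2_restriction_injective)
  then show "z = w" by (simp add: f g cohom_class_eq_iff)
qed

text \<open>The transfer from the unipotent subgroup inverts the restriction on classes invariant
  under the torus: only the cosets in its normalizer contribute, and there are
  \<open>(p - 1)^2\<close> of them, which is \<open>1\<close> modulo \<open>p\<close>.\<close>

lemma GL2_class_representative:
  fixes z :: "('p::prime_card mod_ring, 'p mod_ring) cochain"
  assumes z: "z \<in> carrier (cocycle_ring add_group)"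
    and inv: "\<And>b. b \<noteq> 0 \<Longrightarrow> (\<lambda>xs. z (map ((*) b) xs) - z xs) \<in> coboundaries add_group"
    and len: "\<And>xs. z xs \<noteq> 0 \<Longrightarrow> length xs = n"
  obtains f where "f \<in> carrier (cocycle_ring (GL 2))" "GL2_class (cohom_class add_group z) = cohom_class (GL 2) f"
    "(\<lambda>xs. cochain_pullback add_group unipotent f xs - z xs) \<in> coboundaries add_group"
    "\<And>xs. f xs \<noteq> 0 \<Longrightarrow> length xs = n"
proof -
  let ?U = "range (unipotent :: 'p mod_ring \<Rightarrow> _)"
  let ?F = "{K \<in> rcosets\<^bsub>GL 2\<^esub> ?U. \<forall>e. K #>\<^bsub>GL 2\<^esub> unipotent e = K}"
  let ?D = "(UNIV - {0 :: 'p mod_ring}) \<times> (UNIV - {0 :: 'p mod_ring})"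
  interpret group "GL 2 :: 'p mod_ring mat monoid" by (rule group_GL)
  note U = subgroup_unipotent[where ?'p = 'p]
  have gU: "group ((GL 2)\<lparr>carrier := ?U\<rparr>)" by (rule subgroup_imp_group[OF U])
  have zU: "cochain_pullback ((GL 2)\<lparr>carrier := ?U\<rparr>) upper_right z \<in> carrier (cocycle_ring ((GL 2)\<lparr>carrier := ?U\<rparr>))"
    by (rule cochain_pullback_cocycle[OF gU group_add_group upper_right_hom z])
  have len': "length xs = n" if "cochain_pullback ((GL 2)\<lparr>carrier := ?U\<rparr>) upper_right z xs \<noteq> 0" for xs
    using len that by (rule cochain_pullback_length)
  obtain u where u: "u \<in> cochains (GL 2) ?U" "coboundary (GL 2) u = (\<lambda>_. 0)"
    "cochain_pullback ((GL 2)\<lparr>carrier := ?U\<rparr>) (\<lambda>x. x) u = cochain_pullback ((GL 2)\<lparr>carrier := ?U\<rparr>) upper_right z"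
    and u_len: "\<And>xs. u xs \<noteq> 0 \<Longrightarrow> length xs = n"
    by (rule cocycle_extension[OF group_GL U zU], erule len') (rule that; simp)
  have u_unip: "u (map unipotent xs) = z xs" for xs
  proof -
    have "set (map unipotent xs) \<subseteq> ?U" by auto
    then show ?thesis using fun_cong[OF u(3), of "map unipotent xs"]
      by (simp add: cochain_pullback_def comp_def)
  qed
  define f where "f = cochain_transfer (GL 2) ?U u"
  have f: "f \<in> carrier (cocycle_ring (GL 2))"
    unfolding f_def by (rule cochain_transfer_cocycle[OF group_GL U u(1,2)])
  have term_D: "(\<lambda>xs. u (map (\<lambda>e. (SOME t. t \<in> ?U #>\<^bsub>GL 2\<^esub> mat2 a 0 0 d) \<otimes>\<^bsub>GL 2\<^esub> unipotent e) xs) - z xs)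
      \<in> coboundaries add_group" if ad: "a \<noteq> 0" "d \<noteq> 0" for a d
  proof -
    let ?t = "mat2 a 0 0 d"
    have t: "?t \<in> carrier (GL 2)" using ad by (simp add: mat2_upper_GL)
    have "mat2 (inverse a) 0 0 (inverse d) \<in> carrier (GL 2)" using ad by (simp add: mat2_upper_GL)
    then have inv_t: "inv\<^bsub>GL 2\<^esub> ?t = mat2 (inverse a) 0 0 (inverse d)"
      using t ad by (intro inv_equality) (simp_all add: mat2_mult one_mat2)
    \<comment> \<open>The torus acts on the unipotent subgroup through the quotient a/d, so the
      invariance of z under scaling removes the dependence on the coset.\<close>
    have conj: "?t \<otimes>\<^bsub>GL 2\<^esub> unipotent e \<otimes>\<^bsub>GL 2\<^esub> inv\<^bsub>GL 2\<^esub> ?t = unipotent (a / d * e)" for e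
      using ad by (simp add: inv_t unipotent_eq mat2_mult field_simps)
    have "(\<lambda>xs. u (map (\<lambda>e. ?t \<otimes>\<^bsub>GL 2\<^esub> unipotent e) xs)
        - u (map (\<lambda>e. ?t \<otimes>\<^bsub>GL 2\<^esub> unipotent e \<otimes>\<^bsub>GL 2\<^esub> inv\<^bsub>GL 2\<^esub> ?t) xs)) \<in> coboundaries add_group"
      by (rule fixed_coset_conjugate[OF group_GL U unipotent_hom u(1,2) t]) (simp only: conj rangeI)
    moreover have "u (map (\<lambda>e. ?t \<otimes>\<^bsub>GL 2\<^esub> unipotent e \<otimes>\<^bsub>GL 2\<^esub> inv\<^bsub>GL 2\<^esub> ?t) xs) = z (map ((*) (a / d)) xs)" for xs
      using u_unip[of "map ((*) (a / d)) xs"] unfolding conj by (simp add: comp_def)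
    moreover have "u (map (\<lambda>e. (SOME t. t \<in> ?U #>\<^bsub>GL 2\<^esub> ?t) \<otimes>\<^bsub>GL 2\<^esub> unipotent e) xs)
        = u (map (\<lambda>e. ?t \<otimes>\<^bsub>GL 2\<^esub> unipotent e) xs)" for xs
    proof -
      have "(SOME t. t \<in> ?U #>\<^bsub>GL 2\<^esub> ?t) \<in> ?U #>\<^bsub>GL 2\<^esub> ?t"
        by (rule some_in_rcoset(1)[OF group_GL U rcosetsI[OF subgroup.subset[OF U] t]])
      from cochain_coset_rep[OF group_GL U u(1) t this, of "map unipotent xs"]
      show ?thesis using unipotent_GL by (auto simp: comp_def)
    qed
    ultimately show ?thesis
      using coboundaries_add[OF _ inv[of "a / d"]] ad by fastforce
  qed
  have "(\<lambda>xs. \<Sum>K\<in>?F. u (map (\<lambda>e. (SOME t. t \<in> K) \<otimes>\<^bsub>GL 2\<^esub> unipotent e) xs) - z xs) \<in> coboundaries add_group"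
  proof (rule coboundaries_sum)
    fix K assume "K \<in> ?F"
    then have "K \<in> (\<lambda>(a, d). ?U #>\<^bsub>GL 2\<^esub> mat2 a 0 0 d) ` ?D"
      using bij_betw_imp_surj_on[OF fixed_cosets_unipotent[where ?'p = 'p]] by blast
    then obtain a d where "a \<noteq> 0" "d \<noteq> 0" "K = ?U #>\<^bsub>GL 2\<^esub> mat2 a 0 0 d" by auto
    then show "(\<lambda>xs. u (map (\<lambda>e. (SOME t. t \<in> K) \<otimes>\<^bsub>GL 2\<^esub> unipotent e) xs) - z xs) \<in> coboundaries add_group"
      using term_D by simp
  qed
  moreover have "of_nat (card ?F) = (1 :: 'p mod_ring)"
    by (rule card_fixed_cosets_unipotent)
  ultimately have "(\<lambda>xs. (\<Sum>K\<in>?F. u (map (\<lambda>e. (SOME t. t \<in> K) \<otimes>\<^bsub>GL 2\<^esub> unipotent e) xs)) - z xs) \<in> coboundaries add_group"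
    by (simp add: sum_subtractf)
  from coboundaries_add[OF this transfer_restriction_elementary[OF of_nat_card_eq_0 vector_space_mod_ring group_GL U
        finite_rcosets_GL[OF U] unipotent_hom u(1,2)]]
  have res: "(\<lambda>xs. cochain_pullback add_group unipotent f xs - z xs) \<in> coboundaries add_group"
    by (simp add: f_def)
  then have "res_GL2 (cohom_class (GL 2) f) = cohom_class add_group z"
    by (simp add: res_GL2_class cohom_class_eq_iff)
  moreover have "cohom_class (GL 2) f \<in> carrier (H_GL 2)" using f by (simp add: carrier_cohom_ring)
  ultimately have cls: "GL2_class (cohom_class add_group z) = cohom_class (GL 2) f"
    unfolding GL2_class_def by (metis the_inv_into_f_f[OF res_GL2_inj])
  have f_len: "length xs = n" if "f xs \<noteq> 0" for xs
    using cochain_transfer_length[OF u_len] that by (simp add: f_def)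
  show ?thesis by (rule that[OF f cls res f_len])
qed

section \<open>Digits\<close>

definition digit :: "nat \<Rightarrow> nat \<Rightarrow> nat \<Rightarrow> nat" where
  "digit p k i = i div p ^ k mod p"

lemma digit_less: "0 < p \<Longrightarrow> digit p k i < p"
  by (simp add: digit_def)

lemma digit_add_high:
  assumes "k < m"
  shows "digit p k (q * p ^ m + i) = digit p k i"
proof (cases "p = 0")
  case False
  have "p ^ m = p * p ^ (m - k - 1) * p ^ k"
    using assms by (simp flip: power_add power_Suc)
  then have "(q * p ^ m + i) div p ^ k = (q * (p * p ^ (m - k - 1)) * p ^ k + i) div p ^ k"
    by (simp add: mult.assoc)
  also have "\<dots> = q * (p * p ^ (m - k - 1)) + i div p ^ k"
    using False by simp
  also have "\<dots> = i div p ^ k + p * (q * p ^ (m - k - 1))" by simp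
  finally show ?thesis unfolding digit_def by (simp only: mod_mult_self2)
qed (use assms in \<open>simp add: digit_def power_0_left\<close>)

lemma digit_add_top:
  assumes "q < p" "i < p ^ m"
  shows "digit p m (q * p ^ m + i) = q"
  using assms by (simp add: digit_def)

lemma sum_digits: "(\<Sum>k<m. digit p k i * p ^ k) = i mod p ^ m"
proof (induction m)
  case (Suc m)
  then show ?case using mod_mult2_eq[of i "p ^ m" p] by (simp add: digit_def mult.commute add.commute)
qed simp

lemma sum_digits_less:
  fixes c :: "nat \<Rightarrow> nat"
  assumes "\<And>k. k < m \<Longrightarrow> c k < p"
  shows "(\<Sum>k<m. c k * p ^ k) < p ^ m"
  using assms
proof (induction m)
  case (Suc m)
  have "(\<Sum>k<m. c k * p ^ k) < p ^ m" using Suc by simp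
  then have "(\<Sum>k<Suc m. c k * p ^ k) < p ^ m + c m * p ^ m" by simp
  also have "\<dots> = Suc (c m) * p ^ m" by simp
  also have "\<dots> \<le> p * p ^ m" using Suc.prems[of m] by (intro mult_le_mono1) simp
  finally show ?case by simp
qed simp

lemma digit_sum_digits:
  assumes "\<And>k. k < m \<Longrightarrow> c k < p" "l < m"
  shows "digit p l (\<Sum>k<m. c k * p ^ k) = c l"
  using assms
proof (induction m)
  case (Suc m)
  have *: "(\<Sum>k<Suc m. c k * p ^ k) = c m * p ^ m + (\<Sum>k<m. c k * p ^ k)" by simp
  show ?case
  proof (cases "l < m")
    case True
    then show ?thesis using Suc by (simp add: * digit_add_high del: sum.lessThan_Suc)
  next
    case False
    then have "l = m" using Suc.prems by simp
    then show ?thesis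
      using digit_add_top[OF Suc.prems(1)[of m] sum_digits_less[of m c p]] Suc.prems by (simp only: *)
  qed
qed simp

lemma digits_le_imp_le:
  assumes "i < p ^ m" "j < p ^ m" "\<And>k. k < m \<Longrightarrow> digit p k i \<le> digit p k j"
  shows "i \<le> j"
proof -
  have "i = (\<Sum>k<m. digit p k i * p ^ k)" "j = (\<Sum>k<m. digit p k j * p ^ k)"
    using assms by (simp_all add: sum_digits)
  then show ?thesis using assms(3) by (metis (no_types, lifting) lessThan_iff mult_le_mono1 sum_mono)
qed

lemma digits_eq_imp_eq:
  assumes "i < p ^ m" "j < p ^ m" "\<And>k. k < m \<Longrightarrow> digit p k i = digit p k j"
  shows "i = j"
  using digits_le_imp_le[of i p m j] digits_le_imp_le[of j p m i] assms by simp

lemma digit_power: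
  assumes "1 < p" "l < m" "k < m"
  shows "digit p k (p ^ l) = (if k = l then 1 else 0)"
proof -
  have "(\<Sum>k<m. (if k = l then 1 else 0) * p ^ k) = p ^ l"
    using assms(2) by (simp add: if_distrib[of "\<lambda>x. x * _"] cong: if_cong)
  then show ?thesis
    using digit_sum_digits[of m "\<lambda>k. if k = l then 1 else 0" p k] assms by (simp del: power.simps)
qed

lemma digit_minus_power:
  assumes "1 < p" "t < p ^ m" "l < m" "0 < digit p l t" "k < m"
  shows "p ^ l \<le> t" "digit p k (t - p ^ l) = (if k = l then digit p l t - 1 else digit p k t)"
proof -
  define c where "c k = (if k = l then digit p l t - 1 else digit p k t)" for k
  have less: "c k < p" for k
  proof -
    have "digit p k t < p" "digit p l t < p" using assms(1) by (simp_all add: digit_less)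
    then show ?thesis by (auto simp: c_def)
  qed
  have "digit p k t * p ^ k = c k * p ^ k + (if k = l then p ^ k else 0)" for k
  proof (cases "k = l")
    case True
    then have "digit p k t = Suc (c k)" using assms(4) by (simp add: c_def)
    then show ?thesis using True by simp
  qed (simp add: c_def)
  then have "t = (\<Sum>k<m. c k * p ^ k + (if k = l then p ^ k else 0))"
    using sum_digits[of p t m] assms(2) by simp
  also have "\<dots> = (\<Sum>k<m. c k * p ^ k) + p ^ l"
    using assms(3) by (simp add: sum.distrib)
  finally have t: "t = (\<Sum>k<m. c k * p ^ k) + p ^ l" .
  then show "p ^ l \<le> t" by simp
  have "t - p ^ l = (\<Sum>k<m. c k * p ^ k)" using t by simp
  then show "digit p k (t - p ^ l) = (if k = l then digit p l t - 1 else digit p k t)"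
    using digit_sum_digits[of m c p k] less assms(5) by (simp add: c_def)
qed

text \<open>The distributive law indexed by digit expansions. It reduces composition of translations
  in all coordinates to a single coordinate in \<open>entry_add\<close>.\<close>

lemma sum_prod_digits:
  fixes F :: "nat \<Rightarrow> nat \<Rightarrow> 'k::comm_ring_1"
  shows "(\<Sum>l<p ^ m. \<Prod>k<m. F k (digit p k l)) = (\<Prod>k<m. \<Sum>r<p. F k r)"
proof (induction m)
  case (Suc m)
  have "(\<Sum>l<p ^ Suc m. \<Prod>k<Suc m. F k (digit p k l))
      = (\<Sum>q<p. \<Sum>l = q * p ^ m..<q * p ^ m + p ^ m. \<Prod>k<Suc m. F k (digit p k l))"
    by (simp only: power_Suc sum.nat_group)
  also have "\<dots> = (\<Sum>q<p. \<Sum>i<p ^ m. F m q * (\<Prod>k<m. F k (digit p k i)))"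
  proof (rule sum.cong[OF refl])
    fix q assume q: "q \<in> {..<p}"
    have "(\<Sum>l = q * p ^ m..<q * p ^ m + p ^ m. \<Prod>k<Suc m. F k (digit p k l))
      = (\<Sum>i = 0..<p ^ m. \<Prod>k<Suc m. F k (digit p k (q * p ^ m + i)))"
      by (subst sum.atLeastLessThan_shift_0) simp
    also have "\<dots> = (\<Sum>i<p ^ m. F m q * (\<Prod>k<m. F k (digit p k i)))"
      using q by (intro sum.cong) (auto simp: digit_add_high digit_add_top mult.commute)
    finally show "(\<Sum>l = q * p ^ m..<q * p ^ m + p ^ m. \<Prod>k<Suc m. F k (digit p k l))
      = (\<Sum>i<p ^ m. F m q * (\<Prod>k<m. F k (digit p k i)))" .
  qed
  also have "\<dots> = (\<Sum>q<p. F m q) * (\<Sum>i<p ^ m. \<Prod>k<m. F k (digit p k i))"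
    by (simp add: sum_product)
  finally show ?case by (simp add: Suc.IH mult.commute)
qed simp

section \<open>A representation of an elementary abelian group\<close>

text \<open>
  The functions \<open>x \<mapsto> \<Prod>k. binom (x k) (digit k i)\<close> for \<open>i < p ^ m\<close> form a basis of the functions
  on the group \<open>(\<int>/p)^m\<close>. Their translates are given by Vandermonde's identity, and for every
  \<open>N \<le> p ^ m\<close> the span of the first \<open>N\<close> of them is invariant.
\<close>

definition shift_entry :: "'p::prime_card mod_ring \<Rightarrow> nat \<Rightarrow> nat \<Rightarrow> 'p mod_ring" where
  "shift_entry a r s = (if r \<le> s then of_nat (residue a choose (s - r)) else 0)"

lemma shift_entry_add:
  assumes "s < CARD('p::prime_card)"
  shows "(\<Sum>l<CARD('p). shift_entry a r l * shift_entry b l s) = shift_entry (a + b :: 'p mod_ring) r s"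
proof (cases "r \<le> s")
  case True
  have "(\<Sum>l<CARD('p). shift_entry a r l * shift_entry b l s) = (\<Sum>l\<in>{r..s}. shift_entry a r l * shift_entry b l s)"
    using assms by (intro sum.mono_neutral_right) (auto simp: shift_entry_def)
  also have "\<dots> = (\<Sum>i\<in>{0..s - r}. of_nat (residue a choose i) * of_nat (residue b choose (s - r - i)))"
    using True by (subst sum.atLeastAtMost_shift_0) (auto simp: shift_entry_def intro!: sum.cong)
  also have "\<dots> = fps_nth (binom_series a * binom_series b) (s - r)"
    by (simp add: fps_mult_nth binom_series_nth)
  also have "\<dots> = fps_nth (binom_series (a + b)) (s - r)"
    using assms by (intro binom_series_mult_low) simp_all
  also have "\<dots> = shift_entry (a + b) r s"
    using True by (simp add: binom_series_nth shift_entry_def)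
  finally show ?thesis .
next
  case False
  then have "(\<Sum>l<CARD('p). shift_entry a r l * shift_entry b l s) = 0"
    by (intro sum.neutral) (auto simp: shift_entry_def)
  then show ?thesis using False by (simp add: shift_entry_def)
qed

lemma shift_entry_0: "shift_entry 0 r s = (if r = s then 1 else 0)"
  by (auto simp: shift_entry_def binomial_eq_0)

lemma shift_entry_1: "shift_entry 1 r s = (if r = s \<or> s = Suc r then 1 else 0)"
proof (cases "r \<le> s")
  case True
  then obtain d where d: "s = r + d" using le_Suc_ex by blast
  have "1 choose d = (if d = 0 \<or> d = Suc 0 then 1 else 0)"
    by (cases "d \<le> 1") (auto simp: le_Suc_eq binomial_eq_0)
  then show ?thesis by (simp add: d shift_entry_def)
qed (simp add: shift_entry_def)

lemma shift_entry_target_0: "shift_entry a r 0 = (if r = 0 then 1 else 0)"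
  by (simp add: shift_entry_def)

lemma shift_entry_target_1: "shift_entry a r (Suc 0) = (if r = 0 then a else if r = Suc 0 then 1 else 0)"
  by (auto simp: shift_entry_def le_Suc_eq)

text \<open>The upper bound on N keeps all indices within m digits. The lower bound puts the indices
  p^k for k < m below N; they belong to the coordinate functions, so every linear form lies in the
  space.\<close>

locale translation_representation =
  fixes p_type :: "'p::prime_card itself" and m N :: nat
  assumes m: "0 < m" and N: "2 \<le> N" "N \<le> CARD('p) ^ m" "CARD('p) ^ (m - 1) < N"
begin

lemma p1: "1 < CARD('p)" by (rule card_gt_1)

lemma power_less_N:
  assumes "k < m"
  shows "CARD('p) ^ k < N"
proof -
  have "CARD('p) ^ k \<le> CARD('p) ^ (m - 1)" using assms p1 by (intro power_increasing) auto
  then show ?thesis using N(3) by (rule le_less_trans)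
qed

text \<open>The coefficient of basis function i in the translate by e of basis function j.\<close>

definition entry :: "'p mod_ring poly \<Rightarrow> nat \<Rightarrow> nat \<Rightarrow> 'p mod_ring" where
  "entry e i j = (\<Prod>k<m. shift_entry (coeff e k) (digit CARD('p) k i) (digit CARD('p) k j))"

definition rep :: "'p mod_ring poly \<Rightarrow> 'p mod_ring mat" where
  "rep e = mat N N (\<lambda>(i, j). entry e i j)"

lemma rep_carrier [simp]: "rep e \<in> carrier_mat N N" "dim_row (rep e) = N" "dim_col (rep e) = N"
  by (simp_all add: rep_def)

lemma rep_index: "i < N \<Longrightarrow> j < N \<Longrightarrow> rep e $$ (i, j) = entry e i j"
  by (simp add: rep_def)

text \<open>A nonzero entry forces every digit of i to be at most the corresponding digit of j. The
  resulting triangularity makes the span of the first N functions invariant for every N in the given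
  range, not only for powers of p.\<close>

lemma entry_nonzero_le:
  assumes "entry e i j \<noteq> 0" "i < CARD('p) ^ m" "j < CARD('p) ^ m"
  shows "i \<le> j"
proof (rule digits_le_imp_le[OF assms(2,3)])
  fix k assume "k < m"
  then have "shift_entry (coeff e k) (digit CARD('p) k i) (digit CARD('p) k j) \<noteq> 0"
    using assms(1) by (auto simp: entry_def)
  then show "digit CARD('p) k i \<le> digit CARD('p) k j" by (auto simp: shift_entry_def split: if_splits)
qed

lemma entry_diag: "entry e i i = 1"
  by (simp add: entry_def shift_entry_def)

lemma entry_add: "(\<Sum>l<CARD('p) ^ m. entry e i l * entry e' l j) = entry (e + e') i j"
proof -
  have "(\<Sum>l<CARD('p) ^ m. entry e i l * entry e' l j)
    = (\<Sum>l<CARD('p) ^ m. \<Prod>k<m. (\<lambda>k r. shift_entry (coeff e k) (digit CARD('p) k i) r * shift_entry (coeff e' k) r (digit CARD('p) k j)) k (digit CARD('p) k l))"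
    by (simp add: entry_def prod.distrib)
  also have "\<dots> = (\<Prod>k<m. \<Sum>r<CARD('p). shift_entry (coeff e k) (digit CARD('p) k i) r * shift_entry (coeff e' k) r (digit CARD('p) k j))"
    by (rule sum_prod_digits)
  also have "\<dots> = entry (e + e') i j"
    using p1 by (simp add: shift_entry_add digit_less entry_def)
  finally show ?thesis .
qed

lemma rep_add: "rep (e + e') = rep e * rep e'"
proof (rule eq_matI)
  fix i j assume "i < dim_row (rep e * rep e')" "j < dim_col (rep e * rep e')"
  then have ij: "i < N" "j < N" by simp_all
  have "(rep e * rep e') $$ (i, j) = (\<Sum>l<N. entry e i l * entry e' l j)"
    using ij by (simp add: scalar_prod_def rep_index lessThan_atLeast0)
  also have "\<dots> = (\<Sum>l<CARD('p) ^ m. entry e i l * entry e' l j)"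
  proof (rule sum.mono_neutral_left)
    show "\<forall>l\<in>{..<CARD('p) ^ m} - {..<N}. entry e i l * entry e' l j = 0"
    proof
      fix l assume l: "l \<in> {..<CARD('p) ^ m} - {..<N}"
      then have "entry e' l j = 0" using entry_nonzero_le[of e' l j] ij N by force
      then show "entry e i l * entry e' l j = 0" by simp
    qed
  qed (use N in auto)
  also have "\<dots> = rep (e + e') $$ (i, j)"
    using ij by (simp add: entry_add rep_index)
  finally show "rep (e + e') $$ (i, j) = (rep e * rep e') $$ (i, j)" by simp
qed simp_all

lemma rep_zero: "rep 0 = 1\<^sub>m N"
proof (rule eq_matI)
  fix i j assume "i < dim_row (1\<^sub>m N)" "j < dim_col (1\<^sub>m N)"
  then have ij: "i < N" "j < N" by simp_all
  have "entry 0 i j = (if i = j then 1 else 0)"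
  proof (cases "i = j")
    case False
    then obtain k where "k < m" "digit CARD('p) k i \<noteq> digit CARD('p) k j"
      using digits_eq_imp_eq[of i "CARD('p)" m j] ij N by force
    then show ?thesis using False unfolding entry_def
      by (simp add: shift_entry_0) (metis lessThan_iff prod_zero finite_lessThan)
  qed (simp add: entry_diag)
  then show "rep 0 $$ (i, j) = 1\<^sub>m N $$ (i, j)" using ij by (simp add: rep_index)
qed simp_all

lemma rep_GL: "rep e \<in> carrier (GL N)"
proof -
  have "rep e * rep (- e) = 1\<^sub>m N" using rep_add[of e "- e"] rep_zero by simp
  then have "det (rep e) * det (rep (- e)) = 1"
    using det_mult[of "rep e" N "rep (- e)"] by simp
  then show ?thesis by (auto simp: carrier_GL)
qed

lemma rep_hom: "rep \<in> hom add_group (GL N)"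
  by (simp add: hom_def rep_GL rep_add)

lemma rep_mult_vec:
  "v \<in> carrier_vec N \<Longrightarrow> i < N \<Longrightarrow> (rep e *\<^sub>v v) $ i = (\<Sum>j<N. entry e i j * v $ j)"
  by (simp add: scalar_prod_def rep_index lessThan_atLeast0)

lemma entry_target_0:
  assumes "i < CARD('p) ^ m"
  shows "entry e i 0 = (if i = 0 then 1 else 0)"
proof (cases "i = 0")
  case False
  then have "entry e i 0 = 0" using entry_nonzero_le[of e i 0] assms p1 by auto
  then show ?thesis using False by simp
qed (simp add: entry_diag)

text \<open>Index p^l stands for the coordinate function x_l and index 0 for the constant 1; the
  translate of x_l by e is x_l + e_l.\<close>

lemma entry_target_power:
  assumes "l < m" "i < CARD('p) ^ m"
  shows "entry e i (CARD('p) ^ l) = (if i = 0 then coeff e l else if i = CARD('p) ^ l then 1 else 0)"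
proof -
  have zero: "0 < CARD('p)" using p1 by simp
  show ?thesis
  proof (cases "\<forall>k<m. k \<noteq> l \<longrightarrow> digit CARD('p) k i = 0")
    case True
    have "entry e i (CARD('p) ^ l) = shift_entry (coeff e l) (digit CARD('p) l i) 1"
    proof -
      have "entry e i (CARD('p) ^ l) = shift_entry (coeff e l) (digit CARD('p) l i) (digit CARD('p) l (CARD('p) ^ l))
          * (\<Prod>k\<in>{..<m} - {l}. shift_entry (coeff e k) (digit CARD('p) k i) (digit CARD('p) k (CARD('p) ^ l)))"
        unfolding entry_def using assms(1) by (intro prod.remove) auto
      moreover have "(\<Prod>k\<in>{..<m} - {l}. shift_entry (coeff e k) (digit CARD('p) k i) (digit CARD('p) k (CARD('p) ^ l))) = 1"
        using True assms(1) p1 by (intro prod.neutral) (auto simp: digit_power[of "CARD('p)" l m] shift_entry_target_0)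
      ultimately show ?thesis using digit_power[OF p1 assms(1) assms(1)] by simp
    qed
    moreover have "i = digit CARD('p) l i * CARD('p) ^ l"
    proof -
      have "i = (\<Sum>k<m. digit CARD('p) k i * CARD('p) ^ k)" using assms(2) by (simp add: sum_digits)
      also have "\<dots> = digit CARD('p) l i * CARD('p) ^ l + (\<Sum>k\<in>{..<m} - {l}. digit CARD('p) k i * CARD('p) ^ k)"
        using assms(1) by (intro sum.remove) auto
      finally show ?thesis using True by simp
    qed
    then have "i = 0 \<longleftrightarrow> digit CARD('p) l i = 0" "i = CARD('p) ^ l \<longleftrightarrow> digit CARD('p) l i = 1"
      using p1 by (metis mult_is_0 power_not_zero less_numeral_extra(3) zero, metis mult_cancel2 nat_mult_1 power_not_zero less_numeral_extra(3) zero)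
    ultimately show ?thesis by (auto simp: shift_entry_target_1)
  next
    case False
    then obtain k where k: "k < m" "k \<noteq> l" "digit CARD('p) k i \<noteq> 0" by blast
    then have "shift_entry (coeff e k) (digit CARD('p) k i) (digit CARD('p) k (CARD('p) ^ l)) = 0"
      using digit_power[OF p1 assms(1) k(1)] by (simp add: shift_entry_target_0)
    then have "entry e i (CARD('p) ^ l) = 0" unfolding entry_def using k(1) by (intro prod_zero) auto
    moreover have "i \<noteq> 0" using k(3) by (metis digit_def div_0 mod_0)
    moreover have "i \<noteq> CARD('p) ^ l" using digit_power[OF p1 assms(1) k(1)] k by auto
    ultimately show ?thesis by simp
  qed
qed

text \<open>Pascal's rule in coordinate l. It means that the difference operator in direction l
  carries basis function t to basis function t - p^l.\<close>

lemma entry_monom: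
  assumes "l < m" "t < CARD('p) ^ m" "0 < digit CARD('p) l t" "j < CARD('p) ^ m"
  shows "entry (monom 1 l) (t - CARD('p) ^ l) j = (if j = t \<or> j = t - CARD('p) ^ l then 1 else 0)"
proof -
  let ?i = "t - CARD('p) ^ l"
  have i: "digit CARD('p) k ?i = (if k = l then digit CARD('p) l t - 1 else digit CARD('p) k t)" if "k < m" for k
    using digit_minus_power(2)[OF p1 assms(2,1,3) that] .
  have "?i < CARD('p) ^ m" using assms(2) by simp
  have eq: "shift_entry (coeff (monom 1 l) k) (digit CARD('p) k ?i) (digit CARD('p) k j)
      = (if digit CARD('p) k j = digit CARD('p) k ?i \<or> k = l \<and> digit CARD('p) k j = digit CARD('p) k t then 1 else 0)" if "k < m" for k
    using assms(3) i[OF that] by (auto simp: shift_entry_0 shift_entry_1)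
  show ?thesis
  proof (cases "\<forall>k<m. digit CARD('p) k j = digit CARD('p) k ?i \<or> k = l \<and> digit CARD('p) k j = digit CARD('p) k t")
    case True
    have "shift_entry (coeff (monom 1 l) k) (digit CARD('p) k ?i) (digit CARD('p) k j) = 1" if "k < m" for k
      by (subst eq[OF that], rule if_P) (use True that in blast)
    then have "entry (monom 1 l) ?i j = 1"
      unfolding entry_def by (intro prod.neutral ballI) blast
    moreover have "j = t \<or> j = ?i"
    proof (cases "digit CARD('p) l j = digit CARD('p) l t")
      case True
      have "digit CARD('p) k j = digit CARD('p) k t" if "k < m" for k
        using \<open>\<forall>k<m. _\<close> i[OF that] True that by (cases "k = l") auto
      then show ?thesis using digits_eq_imp_eq[OF assms(4,2)] by blast
    next
      case False
      then have "digit CARD('p) k j = digit CARD('p) k ?i" if "k < m" for k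
        using \<open>\<forall>k<m. _\<close> that by auto
      then show ?thesis using digits_eq_imp_eq[OF assms(4) \<open>?i < CARD('p) ^ m\<close>] by blast
    qed
    ultimately show ?thesis by simp
  next
    case False
    then obtain k where k: "k < m" "digit CARD('p) k j \<noteq> digit CARD('p) k ?i" "\<not> (k = l \<and> digit CARD('p) k j = digit CARD('p) k t)" by blast
    have "shift_entry (coeff (monom 1 l) k) (digit CARD('p) k ?i) (digit CARD('p) k j) = 0"
      by (subst eq[OF k(1)], rule if_not_P) (use k in blast)
    then have "entry (monom 1 l) ?i j = 0"
      unfolding entry_def by (intro prod_zero bexI[of _ k]) (use k(1) in simp_all)
    moreover have "j \<noteq> ?i" using k by auto
    moreover have "j \<noteq> t" using k i[OF k(1)] by (cases "k = l") auto
    ultimately show ?thesis by simp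
  qed
qed

section \<open>Difference operators and invariant subspaces\<close>

lemma digit_positive:
  assumes "t < N" "0 < t"
  obtains l where "l < m" "0 < digit CARD('p) l t"
proof -
  have "t < CARD('p) ^ m" using assms N by simp
  then have "t = (\<Sum>k<m. digit CARD('p) k t * CARD('p) ^ k)" by (simp add: sum_digits)
  then have "\<exists>l<m. digit CARD('p) l t \<noteq> 0" using assms(2) by (metis (no_types, lifting) lessThan_iff less_numeral_extra(3) mult_zero_left sum.neutral)
  then show ?thesis using that by auto
qed

text \<open>In the binomial basis, \<open>fixed_vec\<close> is the constant function 1 and
  \<open>linear_vec c\<close> the linear form with coefficients c, since index p^k is the k-th
  coordinate function.\<close>

definition fixed_vec :: "'p mod_ring vec" where
  "fixed_vec = vec N (\<lambda>i. if i = 0 then 1 else 0)"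

definition linear_vec :: "(nat \<Rightarrow> 'p mod_ring) \<Rightarrow> 'p mod_ring vec" where
  "linear_vec c = vec N (\<lambda>i. \<Sum>k<m. if i = CARD('p) ^ k then c k else 0)"

lemma fixed_vec_carrier [simp]: "fixed_vec \<in> carrier_vec N" "dim_vec fixed_vec = N"
  by (simp_all add: fixed_vec_def)

lemma linear_vec_carrier [simp]: "linear_vec c \<in> carrier_vec N" "dim_vec (linear_vec c) = N"
  by (simp_all add: linear_vec_def)

lemma fixed_vec_index: "i < N \<Longrightarrow> fixed_vec $ i = (if i = 0 then 1 else 0)"
  by (simp add: fixed_vec_def)

lemma power_p_inject: "CARD('p) ^ k = CARD('p) ^ l \<longleftrightarrow> k = l"
  using p1 by (simp add: power_inject_exp)

lemma linear_vec_power: "l < m \<Longrightarrow> linear_vec c $ (CARD('p) ^ l) = c l"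
  using power_less_N[of l] by (simp add: linear_vec_def power_p_inject)

lemma linear_vec_0: "linear_vec c $ 0 = 0"
proof -
  have "0 < CARD('p) ^ k" for k using p1 by simp
  then show ?thesis using N by (auto simp: linear_vec_def intro!: sum.neutral dest: less_imp_neq)
qed

lemma linear_vec_other: "i < N \<Longrightarrow> (\<And>k. k < m \<Longrightarrow> i \<noteq> CARD('p) ^ k) \<Longrightarrow> linear_vec c $ i = 0"
  by (auto simp: linear_vec_def intro!: sum.neutral)

lemma rep_fixed_vec: "rep e *\<^sub>v fixed_vec = fixed_vec"
proof (rule eq_vecI)
  fix i assume "i < dim_vec fixed_vec"
  then have i: "i < N" "i < CARD('p) ^ m" using N by simp_all
  have "(rep e *\<^sub>v fixed_vec) $ i = (\<Sum>j<N. entry e i j * fixed_vec $ j)"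
    by (rule rep_mult_vec[OF fixed_vec_carrier(1) i(1)])
  also have "\<dots> = (\<Sum>j<N. if j = 0 then entry e i 0 else 0)"
    by (intro sum.cong) (auto simp: fixed_vec_index)
  also have "\<dots> = entry e i 0" using N by simp
  finally show "(rep e *\<^sub>v fixed_vec) $ i = fixed_vec $ i"
    using i by (simp add: entry_target_0 fixed_vec_index)
qed simp

lemma rep_linear_vec:
  "rep e *\<^sub>v linear_vec c = linear_vec c + coordinate_form m c e \<cdot>\<^sub>v fixed_vec"
proof (rule eq_vecI)
  fix i assume "i < dim_vec (linear_vec c + coordinate_form m c e \<cdot>\<^sub>v fixed_vec)"
  then have i: "i < N" "i < CARD('p) ^ m" using N by simp_all
  have "(rep e *\<^sub>v linear_vec c) $ i = (\<Sum>j<N. entry e i j * linear_vec c $ j)"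
    by (rule rep_mult_vec[OF linear_vec_carrier(1) i(1)])
  also have "\<dots> = (\<Sum>j<N. \<Sum>k<m. if j = CARD('p) ^ k then entry e i (CARD('p) ^ k) * c k else 0)"
    by (auto simp: linear_vec_def sum_distrib_left intro!: sum.cong)
  also have "\<dots> = (\<Sum>k<m. entry e i (CARD('p) ^ k) * c k)"
    by (subst sum.swap) (auto simp: power_less_N intro!: sum.cong)
  also have "\<dots> = (\<Sum>k<m. (if i = 0 then c k * coeff e k else 0) + (if i = CARD('p) ^ k then c k else 0))"
    using i p1 by (intro sum.cong) (auto simp: entry_target_power)
  also have "\<dots> = (linear_vec c + coordinate_form m c e \<cdot>\<^sub>v fixed_vec) $ i"
    using i by (auto simp: sum.distrib linear_vec_def fixed_vec_index coordinate_form_def)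
  finally show "(rep e *\<^sub>v linear_vec c) $ i = (linear_vec c + coordinate_form m c e \<cdot>\<^sub>v fixed_vec) $ i" .
qed simp

definition diff_op :: "nat \<Rightarrow> 'p mod_ring vec \<Rightarrow> 'p mod_ring vec" where
  "diff_op l v = rep (monom 1 l) *\<^sub>v v - v"

text \<open>Lets coefficients of v be recovered from its differences: if all differences vanish, or
  vanish outside index 0, then v is determined to be constant, or constant plus linear.\<close>

lemma diff_op_index:
  assumes v: "v \<in> carrier_vec N" and l: "l < m" and t: "t < N" "0 < digit CARD('p) l t"
  shows "diff_op l v $ (t - CARD('p) ^ l) = v $ t"
proof -
  let ?i = "t - CARD('p) ^ l"
  have i: "?i < N" using t(1) by simp
  have "CARD('p) ^ l \<le> t" "0 < CARD('p) ^ l"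
    using digit_minus_power(1)[OF p1 _ l t(2) l] t(1) N p1 by simp_all
  then have ne: "t \<noteq> ?i" by linarith
  have "(rep (monom 1 l) *\<^sub>v v) $ ?i = (\<Sum>j<N. entry (monom 1 l) ?i j * v $ j)"
    by (rule rep_mult_vec[OF v i])
  also have "\<dots> = (\<Sum>j<N. (if j = t then v $ t else 0) + (if j = ?i then v $ ?i else 0))"
    using entry_monom[OF l _ t(2)] t(1) N ne by (intro sum.cong) auto
  also have "\<dots> = v $ t + v $ ?i" using t(1) i by (simp add: sum.distrib)
  finally show ?thesis using i v by (simp add: diff_op_def)
qed

text \<open>By triangularity with unit diagonal, subtracting v removes the top coefficient. The
  shrinking support is the induction measure for \<open>invariant_plane\<close>.\<close>

lemma diff_op_support:
  assumes v: "v \<in> carrier_vec N" and supp: "\<And>i. Suc n \<le> i \<Longrightarrow> i < N \<Longrightarrow> v $ i = 0"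
    and i: "n \<le> i" "i < N"
  shows "diff_op l v $ i = 0"
proof -
  have "(rep (monom 1 l) *\<^sub>v v) $ i = (\<Sum>j<N. entry (monom 1 l) i j * v $ j)"
    by (rule rep_mult_vec[OF v i(2)])
  also have "\<dots> = (\<Sum>j<N. if j = i then v $ i else 0)"
  proof (rule sum.cong[OF refl])
    fix j assume "j \<in> {..<N}"
    then have j: "j < N" "j < CARD('p) ^ m" using N by auto
    consider "j = i" | "j < i" | "Suc n \<le> j" using i(1) by linarith
    then show "entry (monom 1 l) i j * v $ j = (if j = i then v $ i else 0)"
    proof cases
      case 2
      then have "entry (monom 1 l) i j = 0"
        using entry_nonzero_le[of "monom 1 l" i j] j i(2) N by force
      then show ?thesis using 2 by simp
    next
      case 3
      then show ?thesis using supp[OF 3 j(1)] by auto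
    qed (simp add: entry_diag)
  qed
  also have "\<dots> = v $ i" using i by simp
  finally show ?thesis using i v by (simp add: diff_op_def)
qed

text \<open>Apply difference operators as long as the result stays nonzero, respectively
  nonconstant. A nonzero vector whose differences all vanish is a multiple of 1; a nonconstant
  vector whose differences are all constant is a nonzero linear form plus a constant, and the
  constant can be subtracted inside W.\<close>

lemma invariant_plane:
  assumes W: "W \<subseteq> carrier_vec N"
    and W_add: "\<And>v w. v \<in> W \<Longrightarrow> w \<in> W \<Longrightarrow> v + w \<in> W" and W_smult: "\<And>a v. v \<in> W \<Longrightarrow> a \<cdot>\<^sub>v v \<in> W"
    and W_rep: "\<And>e v. v \<in> W \<Longrightarrow> rep e *\<^sub>v v \<in> W"
    and w: "w \<in> W" "0 < t" "t < N" "w $ t \<noteq> 0"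
  shows "fixed_vec \<in> W" "\<exists>c. (\<exists>k<m. c k \<noteq> 0) \<and> linear_vec c \<in> W"
proof -
  have W_diff: "diff_op l v \<in> W" if "v \<in> W" for l v
  proof -
    have v: "v \<in> carrier_vec N" using that W by blast
    then have "diff_op l v = rep (monom 1 l) *\<^sub>v v + (- 1) \<cdot>\<^sub>v v"
      by (intro eq_vecI) (simp_all add: diff_op_def)
    then show ?thesis using W_add[OF W_rep[OF that] W_smult[OF that]] by simp
  qed
  have fixed: "fixed_vec \<in> W" if "v \<in> W" "\<exists>i<N. v $ i \<noteq> 0" "\<And>i. n \<le> i \<Longrightarrow> i < N \<Longrightarrow> v $ i = 0" for n v
    using that
  proof (induction n arbitrary: v)
    case 0
    then show ?case by blast
  next
    case (Suc n)
    have v: "v \<in> carrier_vec N" using Suc.prems W by blast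
    show ?case
    proof (cases "\<exists>l. \<exists>i<N. diff_op l v $ i \<noteq> 0")
      case True
      then obtain l where "\<exists>i<N. diff_op l v $ i \<noteq> 0" by blast
      then show ?thesis
        using Suc.IH[OF W_diff[OF Suc.prems(1)]] diff_op_support[OF v Suc.prems(3)] by blast
    next
      case False
      have zero: "v $ i = 0" if i: "0 < i" "i < N" for i
      proof -
        obtain l where "l < m" "0 < digit CARD('p) l i" using digit_positive[OF i(2,1)] by blast
        then show ?thesis using diff_op_index[OF v] False i by (metis less_imp_diff_less)
      qed
      then have v0: "v $ 0 \<noteq> 0" using Suc.prems(2) by (metis gr0I)
      have "inverse (v $ 0) \<cdot>\<^sub>v v = fixed_vec"
        using v v0 zero by (intro eq_vecI) (auto simp: fixed_vec_index)
      then show ?thesis using W_smult[OF Suc.prems(1)] by metis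
    qed
  qed
  show fv: "fixed_vec \<in> W" using fixed[of w N] w by auto
  have "\<exists>c. (\<exists>k<m. c k \<noteq> 0) \<and> linear_vec c \<in> W"
    if "v \<in> W" "\<exists>i<N. 0 < i \<and> v $ i \<noteq> 0" "\<And>i. n \<le> i \<Longrightarrow> i < N \<Longrightarrow> v $ i = 0" for n v
    using that
  proof (induction n arbitrary: v)
    case 0
    then show ?case by blast
  next
    case (Suc n)
    have v: "v \<in> carrier_vec N" using Suc.prems W by blast
    show ?case
    proof (cases "\<exists>l. \<exists>i<N. 0 < i \<and> diff_op l v $ i \<noteq> 0")
      case True
      then obtain l where "\<exists>i<N. 0 < i \<and> diff_op l v $ i \<noteq> 0" by blast
      then show ?thesis
        using Suc.IH[OF W_diff[OF Suc.prems(1)]] diff_op_support[OF v Suc.prems(3)] by blast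
    next
      case False
      define c where "c k = v $ (CARD('p) ^ k)" for k
      \<comment> \<open>All differences of v are constant here. If i is not a power of p, then i -
        p^l is positive, so coefficient i of v equals a coefficient of a difference at a positive
        index.\<close>
      have zero: "v $ i = 0" if i: "0 < i" "i < N" and not_power: "\<And>k. k < m \<Longrightarrow> i \<noteq> CARD('p) ^ k" for i
      proof -
        obtain l where l: "l < m" "0 < digit CARD('p) l i" using digit_positive[OF i(2,1)] by blast
        have "CARD('p) ^ l \<le> i" using digit_minus_power(1)[OF p1 _ l(1) l(2) l(1)] i N by simp
        then have "0 < i - CARD('p) ^ l" "i - CARD('p) ^ l < N" using not_power[OF l(1)] i by auto
        then show ?thesis using diff_op_index[OF v l(1) i(2) l(2)] False by metis
      qed
      have eq: "v + (- (v $ 0)) \<cdot>\<^sub>v fixed_vec = linear_vec c"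
      proof (rule eq_vecI)
        fix i assume "i < dim_vec (linear_vec c)"
        then have i: "i < N" by simp
        consider "i = 0" | k where "k < m" "i = CARD('p) ^ k" | "0 < i" "\<And>k. k < m \<Longrightarrow> i \<noteq> CARD('p) ^ k" by blast
        then show "(v + (- (v $ 0)) \<cdot>\<^sub>v fixed_vec) $ i = linear_vec c $ i"
        proof cases
          case 1
          then show ?thesis using i v by (simp add: fixed_vec_index linear_vec_0)
        next
          case 2
          then have "i \<noteq> 0" using p1 by simp
          then show ?thesis using i v 2 by (simp add: fixed_vec_index linear_vec_power c_def)
        next
          case 3
          then show ?thesis using i v zero[OF 3(1) i 3(2)] linear_vec_other[OF i 3(2)] by (simp add: fixed_vec_index)
        qed
      qed (use v in simp)
      have "linear_vec c \<in> W"
        unfolding eq[symmetric] by (rule W_add[OF Suc.prems(1) W_smult[OF fv]])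
      moreover have "\<exists>k<m. c k \<noteq> 0"
        using Suc.prems(2) zero unfolding c_def by blast
      ultimately show ?thesis by blast
    qed
  qed
  then show "\<exists>c. (\<exists>k<m. c k \<noteq> 0) \<and> linear_vec c \<in> W"
    using w by (metis leD)
qed

end

section \<open>Invariant planes\<close>

lemma (in group) finite_subgroupI:
  assumes "finite (carrier G)" "S \<subseteq> carrier G" "\<one> \<in> S" "\<And>x y. x \<in> S \<Longrightarrow> y \<in> S \<Longrightarrow> x \<otimes> y \<in> S"
  shows "subgroup S G"
proof (rule subgroupI)
  fix x assume x: "x \<in> S"
  have "inj_on (\<lambda>y. x \<otimes> y) S" using x assms(2) by (intro inj_onI) (metis Units_eq Units_l_cancel subsetD)
  moreover have "(\<lambda>y. x \<otimes> y) ` S \<subseteq> S" using x assms(4) by blast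
  moreover have "finite S" using assms(1,2) finite_subset by blast
  ultimately have "(\<lambda>y. x \<otimes> y) ` S = S" by (simp add: endo_inj_surj)
  then have "\<one> \<in> (\<lambda>y. x \<otimes> y) ` S" using assms(3) by simp
  then obtain y where y: "y \<in> S" "x \<otimes> y = \<one>" by auto
  then have "inv x = y" using x assms(2) by (intro inv_equality[symmetric, THEN sym] ) (auto intro: inv_comm)
  then show "inv x \<in> S" using y by simp
qed (use assms in auto)

lemma parabolic_eq:
  assumes N: "2 \<le> N"
  shows "parabolic N = {M \<in> carrier (GL N). \<forall>i j. 2 \<le> i \<longrightarrow> i < N \<longrightarrow> j < 2 \<longrightarrow> M $$ (i, j) = 0}"
proof (intro equalityI subsetI)
  fix M :: "'a mod_ring mat" assume "M \<in> parabolic N"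
  then obtain A B C where M: "M = four_block_mat A C (0\<^sub>m (N - 2) 2) B"
    and ABC: "A \<in> carrier (GL 2)" "B \<in> carrier (GL (N - 2))" "C \<in> carrier_mat 2 (N - 2)"
    by (auto simp: parabolic_def)
  have A: "A \<in> carrier_mat 2 2" "det A \<noteq> 0" and B: "B \<in> carrier_mat (N - 2) (N - 2)" "det B \<noteq> 0"
    using ABC by (auto simp: carrier_GL)
  have "det M = det A * det B"
    unfolding M by (rule det_four_block_mat_lower_left_zero[OF A(1) ABC(3) refl B(1)])
  moreover have "M \<in> carrier_mat N N"
    using four_block_carrier_mat[OF A(1) B(1), of C "0\<^sub>m (N - 2) 2"] N by (simp only: M le_add_diff_inverse)
  ultimately show "M \<in> {M \<in> carrier (GL N). \<forall>i j. 2 \<le> i \<longrightarrow> i < N \<longrightarrow> j < 2 \<longrightarrow> M $$ (i, j) = 0}"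
    using A B by (auto simp: carrier_GL M)
next
  fix M :: "'a mod_ring mat"
  assume "M \<in> {M \<in> carrier (GL N). \<forall>i j. 2 \<le> i \<longrightarrow> i < N \<longrightarrow> j < 2 \<longrightarrow> M $$ (i, j) = 0}"
  then have M: "M \<in> carrier_mat N N" "det M \<noteq> 0" and zero: "\<And>i j. 2 \<le> i \<Longrightarrow> i < N \<Longrightarrow> j < 2 \<Longrightarrow> M $$ (i, j) = 0"
    by (auto simp: carrier_GL)
  obtain A C D B where split: "split_block M 2 2 = (A, C, D, B)" by (metis prod_cases4)
  have dims: "dim_row M = 2 + (N - 2)" "dim_col M = 2 + (N - 2)" using M N by auto
  note sb = split_block[OF split dims]
  have "D = 0\<^sub>m (N - 2) 2"
  proof (rule eq_matI)
    fix i j assume ij: "i < dim_row (0\<^sub>m (N - 2) 2 :: 'a mod_ring mat)" "j < dim_col (0\<^sub>m (N - 2) 2 :: 'a mod_ring mat)"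
    have "D $$ (i, j) = M $$ (i + 2, j)" using split ij M by (auto simp: split_block_def Let_def)
    then show "D $$ (i, j) = 0\<^sub>m (N - 2) 2 $$ (i, j)" using zero[of "i + 2" j] ij by simp
  qed (use sb in auto)
  then have M_eq: "M = four_block_mat A C (0\<^sub>m (N - 2) 2) B" using sb(5) by simp
  have "det M = det A * det B"
    unfolding M_eq by (rule det_four_block_mat_lower_left_zero[OF sb(1,2) refl sb(4)])
  then have "A \<in> carrier (GL 2)" "B \<in> carrier (GL (N - 2))"
    using M(2) sb by (auto simp: carrier_GL)
  then show "M \<in> parabolic N" using M_eq sb(2) by (auto simp: parabolic_def)
qed

lemma mat_mult_index:
  "A \<in> carrier_mat n n \<Longrightarrow> B \<in> carrier_mat n n \<Longrightarrow> i < n \<Longrightarrow> j < n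
    \<Longrightarrow> (A * B) $$ (i, j) = (\<Sum>l<n. A $$ (i, l) * B $$ (l, j))"
  by (simp add: scalar_prod_def lessThan_atLeast0)

lemma subgroup_parabolic:
  assumes N: "2 \<le> N"
  shows "subgroup (parabolic N) (GL N :: 'p::prime_card mod_ring mat monoid)"
proof -
  interpret group "GL N :: 'p mod_ring mat monoid" by (rule group_GL)
  show ?thesis
  proof (rule finite_subgroupI[OF finite_carrier_GL])
    show "parabolic N \<subseteq> carrier (GL N :: 'p mod_ring mat monoid)" by (auto simp: parabolic_eq[OF N])
    show "\<one>\<^bsub>GL N\<^esub> \<in> (parabolic N :: 'p mod_ring mat set)"
      using N one_closed by (auto simp: parabolic_eq[OF N])
    fix M M' :: "'p mod_ring mat" assume "M \<in> parabolic N" "M' \<in> parabolic N"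
    then have M: "M \<in> carrier (GL N)" "\<And>i j. 2 \<le> i \<Longrightarrow> i < N \<Longrightarrow> j < 2 \<Longrightarrow> M $$ (i, j) = 0"
      and M': "M' \<in> carrier (GL N)" "\<And>i j. 2 \<le> i \<Longrightarrow> i < N \<Longrightarrow> j < 2 \<Longrightarrow> M' $$ (i, j) = 0"
      by (auto simp: parabolic_eq[OF N])
    have "(M * M') $$ (i, j) = 0" if "2 \<le> i" "i < N" "j < 2" for i j
    proof -
      have "(M * M') $$ (i, j) = (\<Sum>l<N. M $$ (i, l) * M' $$ (l, j))"
        using M(1) M'(1) that N by (intro mat_mult_index) (auto simp: carrier_GL)
      also have "\<dots> = 0"
      proof (rule sum.neutral, rule ballI)
        fix l assume "l \<in> {..<N}"
        then show "M $$ (i, l) * M' $$ (l, j) = 0"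
          using M(2)[of i l] M'(2)[of l j] that by (cases "l < 2") auto
      qed
      finally show ?thesis .
    qed
    moreover have "M * M' \<in> carrier (GL N)" using m_closed[OF M(1) M'(1)] by simp
    ultimately show "M \<otimes>\<^bsub>GL N\<^esub> M' \<in> parabolic N" by (auto simp: parabolic_eq[OF N])
  qed
qed

lemma upper_left_hom:
  assumes N: "2 \<le> N"
  shows "upper_left \<in> hom ((GL N)\<lparr>carrier := parabolic N\<rparr>) (GL 2 :: 'p::prime_card mod_ring mat monoid)"
proof -
  have closed: "upper_left M \<in> carrier (GL 2)" if MP: "M \<in> parabolic N" for M :: "'p mod_ring mat"
  proof -
    obtain A B C where M: "M = four_block_mat A C (0\<^sub>m (N - 2) 2) B"
      and A: "A \<in> carrier (GL 2)" and B: "B \<in> carrier (GL (N - 2))"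
      using MP unfolding parabolic_def by blast
    have "upper_left M = A"
      unfolding upper_left_def M using A by (intro eq_matI) (auto simp: carrier_GL)
    then show ?thesis using A by simp
  qed
  moreover have "upper_left (M * M') = upper_left M * upper_left M'"
    if "M \<in> parabolic N" "M' \<in> parabolic N" for M M' :: "'p mod_ring mat"
  proof (rule eq_matI)
    have M: "M \<in> carrier_mat N N" and M': "M' \<in> carrier_mat N N"
      and zero: "\<And>i j. 2 \<le> i \<Longrightarrow> i < N \<Longrightarrow> j < 2 \<Longrightarrow> M' $$ (i, j) = 0"
      using that by (auto simp: parabolic_eq[OF N] carrier_GL)
    fix i j assume "i < dim_row (upper_left M * upper_left M')" "j < dim_col (upper_left M * upper_left M')"
    then have ij: "i < 2" "j < 2" by (simp_all add: upper_left_def)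
    have "upper_left (M * M') $$ (i, j) = (\<Sum>l<N. M $$ (i, l) * M' $$ (l, j))"
      using ij N mat_mult_index[OF M M', of i j] by (simp add: upper_left_def)
    also have "\<dots> = (\<Sum>l<2. M $$ (i, l) * M' $$ (l, j))"
      using zero N ij by (intro sum.mono_neutral_right) auto
    also have "\<dots> = (upper_left M * upper_left M') $$ (i, j)"
      using ij mat_mult_index[of "upper_left M" 2 "upper_left M'" i j] by (simp add: upper_left_def)
    finally show "upper_left (M * M') $$ (i, j) = (upper_left M * upper_left M') $$ (i, j)" .
  qed (simp_all add: upper_left_def)
  ultimately show ?thesis by (simp add: hom_def)
qed

text \<open>Provides the invariant cocycle to which the double coset formula is applied. Its values
  are explicit only on the parabolic subgroup, which suffices once the fixed cosets have been
  conjugated into it.\<close>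

lemma chi_representative:
  fixes f :: "('p::prime_card mod_ring mat, 'p mod_ring) cochain"
  assumes N: "2 \<le> N" and f: "f \<in> carrier (cocycle_ring (GL 2))" and len: "\<And>xs. f xs \<noteq> 0 \<Longrightarrow> length xs = n"
  obtains u where "u \<in> cochains (GL N) (parabolic N)" "coboundary (GL N) u = (\<lambda>_. 0)"
    "\<And>Ms. set Ms \<subseteq> parabolic N \<Longrightarrow> u Ms = f (map upper_left Ms)"
    "chi N (cohom_class (GL 2) f) = cohom_class (GL N) (cochain_transfer (GL N) (parabolic N) u)"
    "\<And>xs. u xs \<noteq> 0 \<Longrightarrow> length xs = n"
proof -
  let ?P = "parabolic N :: 'p mod_ring mat set"
  let ?GP = "(GL N)\<lparr>carrier := ?P\<rparr> :: 'p mod_ring mat monoid"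
  note P = subgroup_parabolic[OF N, where ?'p = 'p]
  have gP: "group ?GP" by (rule group.subgroup_imp_group[OF group_GL P])
  have fP: "cochain_pullback ?GP upper_left f \<in> carrier (cocycle_ring ?GP)"
    by (rule cochain_pullback_cocycle[OF gP group_GL upper_left_hom[OF N] f])
  have len': "length xs = n" if "cochain_pullback ?GP upper_left f xs \<noteq> 0" for xs
    using len that by (rule cochain_pullback_length)
  obtain u where u: "u \<in> cochains (GL N) ?P" "coboundary (GL N) u = (\<lambda>_. 0)"
    "cochain_pullback ?GP (\<lambda>x. x) u = cochain_pullback ?GP upper_left f"
    and u_len: "\<And>xs. u xs \<noteq> 0 \<Longrightarrow> length xs = n"
    by (rule cocycle_extension[OF group_GL P fP], erule len') (rule that; (assumption | simp))
  have val: "u Ms = f (map upper_left Ms)" if "set Ms \<subseteq> ?P" for Ms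
    using fun_cong[OF u(3), of Ms] that by (simp add: cochain_pullback_def)
  have "cohom_map ?GP upper_left (cohom_class (GL 2) f) = cohom_class ?GP (cochain_pullback ?GP (\<lambda>x. x) u)"
    unfolding u(3) by (rule cohom_map_class[OF gP group_GL upper_left_hom[OF N]])
  then have cls: "chi N (cohom_class (GL 2) f) = cohom_class (GL N) (cochain_transfer (GL N) ?P u)"
    using transfer_class[OF group_GL P u(1,2)] by (simp add: chi_def)
  show ?thesis by (rule that[OF u(1,2) val cls u_len])
qed

lemma sum_eq_single:
  assumes "finite A" "a \<in> A" "\<And>x. x \<in> A \<Longrightarrow> x \<noteq> a \<Longrightarrow> g x = 0"
  shows "(\<Sum>x\<in>A. g x) = (g a :: 'b::comm_monoid_add)"
  using assms sum.remove[of A a g] by simp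

context translation_representation
begin

section \<open>Fixed cosets of the parabolic subgroup as invariant planes\<close>

abbreviation "P \<equiv> (parabolic N :: 'p mod_ring mat set)"

lemma P: "subgroup P (GL N)"
  by (rule subgroup_parabolic[OF N(1)])

definition nonzero_vectors :: "(nat \<Rightarrow> 'p mod_ring) set" where
  "nonzero_vectors = {c \<in> coefficient_vectors m. \<exists>k<m. c k \<noteq> 0}"

lemma finite_nonzero_vectors: "finite nonzero_vectors"
proof -
  have "finite (coefficient_vectors m :: (nat \<Rightarrow> 'p mod_ring) set)" by (intro finite_PiE) auto
  then show ?thesis by (simp add: nonzero_vectors_def)
qed

text \<open>The two vectors are completed by all standard basis vectors except those with indices 0
  and p^k0, where \<open>c k0\<close> is nonzero. Invertibility follows by solving s v = 0 row by
  row: row p^k0 gives v_1, row 0 gives v_0, row \<tau> j gives v_j.\<close>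

lemma frame_exists:
  assumes "\<exists>k<m. c k \<noteq> 0"
  shows "\<exists>s. s \<in> carrier (GL N) \<and> col s 0 = fixed_vec \<and> col s 1 = linear_vec c"
proof -
  obtain k0 where k0: "k0 < m" "c k0 \<noteq> 0" using assms by blast
  \<comment> \<open>Column 1 is taken by the linear form, so column p^k0 receives the standard basis
    vector with index 1.\<close>
  define \<tau> where "\<tau> j = (if j = CARD('p) ^ k0 then 1 else j)" for j
  define s where "s = mat N N (\<lambda>(i, j). if j = 0 then fixed_vec $ i else if j = 1 then linear_vec c $ i
      else if i = \<tau> j then 1 else 0)"
  have s: "s \<in> carrier_mat N N" by (simp add: s_def)
  have pk: "CARD('p) ^ k0 < N" "0 < CARD('p) ^ k0" using power_less_N[OF k0(1)] p1 by simp_all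
  have "v = 0\<^sub>v N" if v: "v \<in> carrier_vec N" and sv: "s *\<^sub>v v = 0\<^sub>v N" for v
  proof -
    have row: "(\<Sum>j<N. s $$ (i, j) * v $ j) = 0" if "i < N" for i
    proof -
      have "(s *\<^sub>v v) $ i = (\<Sum>j<N. s $$ (i, j) * v $ j)"
        using that s v by (simp add: scalar_prod_def lessThan_atLeast0)
      then show ?thesis using sv that by simp
    qed
    have "(\<Sum>j<N. s $$ (CARD('p) ^ k0, j) * v $ j) = s $$ (CARD('p) ^ k0, 1) * v $ 1"
    proof (rule sum_eq_single)
      show "s $$ (CARD('p) ^ k0, j) * v $ j = 0" if "j \<in> {..<N}" "j \<noteq> 1" for j
        using that pk by (auto simp: s_def fixed_vec_index \<tau>_def)
    qed (use N in auto)
    moreover have "s $$ (CARD('p) ^ k0, 1) = c k0"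
      using pk N k0(1) by (simp add: s_def linear_vec_power)
    ultimately have v1: "v $ 1 = 0" using row[OF pk(1)] k0(2) by simp
    have "(\<Sum>j<N. s $$ (0, j) * v $ j) = s $$ (0, 0) * v $ 0"
    proof (rule sum_eq_single)
      show "s $$ (0, j) * v $ j = 0" if "j \<in> {..<N}" "j \<noteq> 0" for j
        using that N v1 by (cases "j = 1") (auto simp: s_def \<tau>_def)
    qed (use N in auto)
    then have v0: "v $ 0 = 0" using row[of 0] N by (simp add: s_def fixed_vec_index)
    have "v $ j = 0" if j: "j < N" "2 \<le> j" for j
    proof -
      have \<tau>: "\<tau> j < N" "0 < \<tau> j" using j by (auto simp: \<tau>_def)
      have "(\<Sum>l<N. s $$ (\<tau> j, l) * v $ l) = s $$ (\<tau> j, j) * v $ j"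
      proof (rule sum_eq_single)
        show "s $$ (\<tau> j, l) * v $ l = 0" if "l \<in> {..<N}" "l \<noteq> j" for l
        proof -
          consider "l = 0" | "l = 1" | "2 \<le> l" by linarith
          then show ?thesis
          proof cases
            case 3
            then have "\<tau> j \<noteq> \<tau> l" using that j by (auto simp: \<tau>_def)
            then show ?thesis using 3 that \<tau> by (simp add: s_def)
          qed (use v0 v1 in auto)
        qed
      qed (use j in auto)
      moreover have "s $$ (\<tau> j, j) = 1" using j \<tau> by (simp add: s_def)
      ultimately show ?thesis using row[OF \<tau>(1)] by simp
    qed
    then have "v $ j = 0" if "j < N" for j
    proof -
      consider "j = 0" | "j = 1" | "2 \<le> j" by linarith
      then show ?thesis using v0 v1 \<open>\<And>j. j < N \<Longrightarrow> 2 \<le> j \<Longrightarrow> v $ j = 0\<close> that by cases auto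
    qed
    then show ?thesis using v by (intro eq_vecI) auto
  qed
  then have "det s \<noteq> 0" using det_0_iff_vec_prod_zero_field[OF s] by blast
  moreover have "col s 0 = fixed_vec" using N by (intro eq_vecI) (auto simp: s_def)
  moreover have "col s 1 = linear_vec c" using N by (intro eq_vecI) (auto simp: s_def)
  ultimately show ?thesis using s by (auto simp: carrier_GL)
qed

definition frame :: "(nat \<Rightarrow> 'p mod_ring) \<Rightarrow> 'p mod_ring mat" where
  "frame c = (SOME s. s \<in> carrier (GL N) \<and> col s 0 = fixed_vec \<and> col s 1 = linear_vec c)"

lemma frame:
  assumes "c \<in> nonzero_vectors"
  shows "frame c \<in> carrier (GL N)" "col (frame c) 0 = fixed_vec" "col (frame c) 1 = linear_vec c"
proof -
  have "\<exists>s. s \<in> carrier (GL N) \<and> col s 0 = fixed_vec \<and> col s 1 = linear_vec c"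
    using frame_exists assms by (simp add: nonzero_vectors_def)
  from someI_ex[OF this] show "frame c \<in> carrier (GL N)" "col (frame c) 0 = fixed_vec" "col (frame c) 1 = linear_vec c"
    by (simp_all add: frame_def)
qed

definition frame_inv :: "(nat \<Rightarrow> 'p mod_ring) \<Rightarrow> 'p mod_ring mat" where
  "frame_inv c = inv\<^bsub>GL N\<^esub> (frame c)"

lemma frame_inv:
  assumes "c \<in> nonzero_vectors"
  shows "frame_inv c \<in> carrier (GL N)" "frame_inv c * frame c = 1\<^sub>m N" "frame c * frame_inv c = 1\<^sub>m N"
    "inv\<^bsub>GL N\<^esub> (frame_inv c) = frame c"
proof -
  interpret group "GL N :: 'p mod_ring mat monoid" by (rule group_GL)
  note c = frame(1)[OF assms]
  show "frame_inv c \<in> carrier (GL N)" "inv\<^bsub>GL N\<^esub> (frame_inv c) = frame c"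
    using c by (simp_all add: frame_inv_def)
  show "frame_inv c * frame c = 1\<^sub>m N" "frame c * frame_inv c = 1\<^sub>m N"
    using l_inv[OF c] r_inv[OF c] by (simp_all add: frame_inv_def)
qed

lemma GL_carrier_mat: "M \<in> carrier (GL N) \<Longrightarrow> M \<in> carrier_mat N N"
  by (simp add: carrier_GL)

lemma frame_inv_mult_fixed:
  assumes "c \<in> nonzero_vectors"
  shows "frame_inv c *\<^sub>v fixed_vec = unit_vec N 0" "frame_inv c *\<^sub>v linear_vec c = unit_vec N 1"
proof -
  have "frame_inv c *\<^sub>v col (frame c) j = col (frame_inv c * frame c) j" if "j < N" for j
    using col_mult2[OF GL_carrier_mat[OF frame_inv(1)[OF assms]] GL_carrier_mat[OF frame(1)[OF assms]] that] by simp
  then show "frame_inv c *\<^sub>v fixed_vec = unit_vec N 0" "frame_inv c *\<^sub>v linear_vec c = unit_vec N 1"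
    using frame[OF assms] frame_inv(2)[OF assms] N(1) by (metis col_one less_le_trans pos2 , metis col_one less_le_trans one_less_numeral_iff semiring_norm(76))
qed

lemma conjugate_rep_index:
  assumes c: "c \<in> nonzero_vectors" and i: "i < N"
  shows "(frame_inv c * rep e * frame c) $$ (i, 0) = (if i = 0 then 1 else 0)"
    "(frame_inv c * rep e * frame c) $$ (i, 1) = (if i = 1 then 1 else if i = 0 then coordinate_form m c e else 0)"
proof -
  note A = GL_carrier_mat[OF frame_inv(1)[OF c]] and S = GL_carrier_mat[OF frame(1)[OF c]]
  have AR: "frame_inv c * rep e \<in> carrier_mat N N" using A by simp
  have "(frame_inv c * rep e * frame c) $$ (i, j) = (frame_inv c *\<^sub>v (rep e *\<^sub>v col (frame c) j)) $ i" if "j < N" for j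
  proof -
    have "(frame_inv c * rep e * frame c) $$ (i, j) = col (frame_inv c * rep e * frame c) j $ i"
      using i that AR S by (intro index_col[symmetric]) auto
    also have "col (frame_inv c * rep e * frame c) j = (frame_inv c * rep e) *\<^sub>v col (frame c) j"
      by (rule col_mult2[OF AR S that])
    also have "\<dots> = frame_inv c *\<^sub>v (rep e *\<^sub>v col (frame c) j)"
      using S by (intro assoc_mult_mat_vec[OF A rep_carrier(1)]) (simp add: carrier_vecI)
    finally show ?thesis .
  qed
  note col = this
  show "(frame_inv c * rep e * frame c) $$ (i, 0) = (if i = 0 then 1 else 0)"
    using col[of 0] N(1) i by (simp add: frame[OF c] rep_fixed_vec frame_inv_mult_fixed[OF c] unit_vec_def)
  have "frame_inv c *\<^sub>v (linear_vec c + coordinate_form m c e \<cdot>\<^sub>v fixed_vec)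
    = frame_inv c *\<^sub>v linear_vec c + frame_inv c *\<^sub>v (coordinate_form m c e \<cdot>\<^sub>v fixed_vec)"
    using A by (intro mult_add_distrib_mat_vec) auto
  also have "\<dots> = unit_vec N 1 + coordinate_form m c e \<cdot>\<^sub>v unit_vec N 0"
    using mult_mat_vec[OF A fixed_vec_carrier(1)] by (simp add: frame_inv_mult_fixed[OF c])
  finally show "(frame_inv c * rep e * frame c) $$ (i, 1) = (if i = 1 then 1 else if i = 0 then coordinate_form m c e else 0)"
    using col[of 1] N(1) i by (simp add: frame[OF c] rep_linear_vec unit_vec_def del: One_nat_def)
qed

lemma conjugate_rep:
  assumes c: "c \<in> nonzero_vectors"
  shows "frame_inv c * rep e * frame c \<in> P"
    "upper_left (frame_inv c * rep e * frame c) = unipotent (coordinate_form m c e)"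
proof -
  interpret group "GL N :: 'p mod_ring mat monoid" by (rule group_GL)
  have "frame_inv c * rep e * frame c \<in> carrier (GL N)"
    using m_closed[OF m_closed[OF frame_inv(1)[OF c] rep_GL] frame(1)[OF c]] by simp
  then show "frame_inv c * rep e * frame c \<in> P"
    using conjugate_rep_index[OF c, of _ e] by (auto simp: parabolic_eq[OF N(1)] less_2_cases_iff)
  show "upper_left (frame_inv c * rep e * frame c) = unipotent (coordinate_form m c e)"
    unfolding unipotent_eq
    using conjugate_rep_index[OF c, of _ e] N(1) by (intro mat2_eqI) (simp_all add: upper_left_def)
qed

text \<open>The parabolic subgroup stabilizes the span of the first two standard basis vectors, so
  the right coset of g corresponds to the image of that span under the inverse of g. For g the
  inverse frame this is the plane spanned by 1 and the linear form c.\<close>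

definition plane_coset :: "(nat \<Rightarrow> 'p mod_ring) \<Rightarrow> 'p mod_ring mat set" where
  "plane_coset c = P #>\<^bsub>GL N\<^esub> frame_inv c"

abbreviation fixed_cosets :: "'p mod_ring mat set set" where
  "fixed_cosets \<equiv> {K \<in> rcosets\<^bsub>GL N\<^esub> P. \<forall>e. K #>\<^bsub>GL N\<^esub> rep e = K}"

lemma mem_P_rcoset: "x \<in> P #>\<^bsub>GL N\<^esub> t \<longleftrightarrow> (\<exists>M\<in>P. x = M * t)"
  by (auto simp: r_coset_def)

lemma plane_coset_fixed:
  assumes c: "c \<in> nonzero_vectors"
  shows "plane_coset c \<in> fixed_cosets"
proof -
  interpret group "GL N :: 'p mod_ring mat monoid" by (rule group_GL)
  note t = frame_inv(1)[OF c] and s = frame(1)[OF c]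
  have PG: "P \<subseteq> carrier (GL N)" by (rule subgroup.subset[OF P])
  have "P #>\<^bsub>GL N\<^esub> frame_inv c #>\<^bsub>GL N\<^esub> rep e = P #>\<^bsub>GL N\<^esub> frame_inv c" for e
  proof -
    have "frame_inv c * rep e = (frame_inv c * rep e * frame c) * frame_inv c"
    proof -
      have "(frame_inv c * rep e * frame c) * frame_inv c = (frame_inv c * rep e) * (frame c * frame_inv c)"
        using GL_carrier_mat[OF t] GL_carrier_mat[OF s] by (intro assoc_mult_mat[of _ N N _ N _ N]) auto
      then show ?thesis using frame_inv(3)[OF c] GL_carrier_mat[OF t] by simp
    qed
    then have "frame_inv c * rep e \<in> P #>\<^bsub>GL N\<^esub> frame_inv c"
      using conjugate_rep(1)[OF c] mem_P_rcoset by blast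
    then have "P #>\<^bsub>GL N\<^esub> frame_inv c = P #>\<^bsub>GL N\<^esub> (frame_inv c * rep e)"
      by (rule repr_independence[OF _ t P])
    then show ?thesis using coset_mult_assoc[OF PG t rep_GL] by simp
  qed
  then show ?thesis using rcosetsI[OF PG t] by (simp add: plane_coset_def)
qed

lemma linear_vec_restrict: "linear_vec (restrict c {..<m}) = linear_vec c"
  by (intro eq_vecI) (auto simp: linear_vec_def intro!: sum.cong)

text \<open>W is the plane belonging to the coset of g, and it is invariant because the coset is
  fixed. By \<open>invariant_plane\<close> it contains 1 and a nonzero linear form; g carries both
  into the span of the first two basis vectors, so g times the frame is parabolic.\<close>

lemma fixed_coset_is_plane_coset:
  assumes K: "K \<in> fixed_cosets"
  shows "\<exists>c\<in>nonzero_vectors. K = plane_coset c"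
proof -
  interpret group "GL N :: 'p mod_ring mat monoid" by (rule group_GL)
  have PG: "P \<subseteq> carrier (GL N)" by (rule subgroup.subset[OF P])
  obtain g where g: "g \<in> carrier (GL N)" "K = P #>\<^bsub>GL N\<^esub> g" using K by (auto simp: RCOSETS_def)
  note gm = GL_carrier_mat[OF g(1)]
  define W where "W = {v \<in> carrier_vec N. \<forall>i. 2 \<le> i \<longrightarrow> i < N \<longrightarrow> (g *\<^sub>v v) $ i = 0}"
  have W_rep: "rep e *\<^sub>v v \<in> W" if v: "v \<in> W" for e v
  proof -
    have vN: "v \<in> carrier_vec N" using v by (simp add: W_def)
    have "K #>\<^bsub>GL N\<^esub> rep e = P #>\<^bsub>GL N\<^esub> (g * rep e)"
      using coset_mult_assoc[OF PG g(1) rep_GL] g(2) by simp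
    moreover have "g * rep e \<in> carrier (GL N)" using m_closed[OF g(1) rep_GL] by simp
    ultimately have "g * rep e \<in> P #>\<^bsub>GL N\<^esub> g"
      using rcos_self[OF _ P] K g(2) by (metis (mono_tags, lifting) mem_Collect_eq)
    then obtain M where M: "M \<in> P" "g * rep e = M * g" using mem_P_rcoset by blast
    have MN: "M \<in> carrier_mat N N" using M(1) PG GL_carrier_mat by blast
    have "g *\<^sub>v (rep e *\<^sub>v v) = (g * rep e) *\<^sub>v v"
      by (rule assoc_mult_mat_vec[OF gm rep_carrier(1) vN, symmetric])
    also have "\<dots> = M *\<^sub>v (g *\<^sub>v v)"
      unfolding M(2) by (rule assoc_mult_mat_vec[OF MN gm vN])
    finally have eq: "g *\<^sub>v (rep e *\<^sub>v v) = M *\<^sub>v (g *\<^sub>v v)" .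
    have "(M *\<^sub>v (g *\<^sub>v v)) $ i = 0" if i: "2 \<le> i" "i < N" for i
    proof -
      have "(M *\<^sub>v (g *\<^sub>v v)) $ i = (\<Sum>l<N. M $$ (i, l) * (g *\<^sub>v v) $ l)"
        using i MN gm vN by (simp add: scalar_prod_def lessThan_atLeast0)
      also have "\<dots> = 0"
      proof (rule sum.neutral, rule ballI)
        fix l assume "l \<in> {..<N}"
        then show "M $$ (i, l) * (g *\<^sub>v v) $ l = 0"
          using M(1) i v by (cases "l < 2") (auto simp: parabolic_eq[OF N(1)] W_def)
      qed
      finally show ?thesis .
    qed
    then show ?thesis using vN by (auto simp: W_def eq intro!: mult_mat_vec_carrier[OF rep_carrier(1)])
  qed
  have W_add: "v + w \<in> W" if "v \<in> W" "w \<in> W" for v w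
  proof -
    have vw: "v \<in> carrier_vec N" "w \<in> carrier_vec N" using that by (auto simp: W_def)
    have "(g *\<^sub>v (v + w)) $ i = 0" if i: "2 \<le> i" "i < N" for i
      unfolding mult_add_distrib_mat_vec[OF gm vw] using i \<open>v \<in> W\<close> \<open>w \<in> W\<close> gm
      by (subst index_add_vec) (auto simp: W_def simp del: index_mult_mat_vec)
    then show ?thesis using vw by (simp add: W_def del: index_mult_mat_vec)
  qed
  have W_smult: "a \<cdot>\<^sub>v v \<in> W" if "v \<in> W" for a v
    using that mult_mat_vec[OF gm, of v a] gm by (auto simp: W_def)
  \<comment> \<open>Otherwise the first two columns of the inverse of g, which lie in W, would both
    be multiples of the constant vector.\<close>
  have "\<exists>w\<in>W. \<exists>t. 0 < t \<and> t < N \<and> w $ t \<noteq> 0"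
  proof (rule ccontr)
    assume "\<not> ?thesis"
    then have zero: "w $ t = 0" if "w \<in> W" "0 < t" "t < N" for w t using that by blast
    define h where "h = inv\<^bsub>GL N\<^esub> g"
    have h: "h \<in> carrier (GL N)" "g * h = 1\<^sub>m N" using g(1) r_inv[OF g(1)] by (simp_all add: h_def)
    note hm = GL_carrier_mat[OF h(1)]
    have gh: "g *\<^sub>v col h j = unit_vec N j" if "j < N" for j
      using col_mult2[OF gm hm that] h(2) that by simp
    have colW: "col h j \<in> W" if j: "j < 2" for j
    proof -
      have "(g *\<^sub>v col h j) $ i = 0" if "2 \<le> i" "i < N" for i
        using that j N(1) by (subst gh) auto
      moreover have "col h j \<in> carrier_vec N" using hm by (intro carrier_vecI) simp
      ultimately show ?thesis by (simp add: W_def del: index_mult_mat_vec)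
    qed
    define a where "a j = col h j $ 0" for j
    have "col h j = a j \<cdot>\<^sub>v fixed_vec" if j: "j < 2" for j
    proof (rule eq_vecI)
      fix i assume "i < dim_vec (a j \<cdot>\<^sub>v fixed_vec)"
      then have "i < N" by simp
      then show "col h j $ i = (a j \<cdot>\<^sub>v fixed_vec) $ i"
        using zero[OF colW[OF j], of i] by (cases "i = 0") (simp_all add: a_def fixed_vec_index)
    qed (use hm in simp)
    then have "a j \<cdot>\<^sub>v (g *\<^sub>v fixed_vec) = unit_vec N j" if "j < 2" for j
      using gh[of j] mult_mat_vec[OF gm fixed_vec_carrier(1), of "a j"] that N(1) by simp
    then have "a j * (g *\<^sub>v fixed_vec) $ i = unit_vec N j $ i" if "j < 2" "i < N" for i j
      using gm that by (metis carrier_matD(1) dim_mult_mat_vec index_smult_vec(1))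
    from this[of 0 0] this[of 0 1] this[of 1 1] show False
      using N(1) by auto
  qed
  then obtain w t where w: "w \<in> W" "0 < t" "t < N" "w $ t \<noteq> 0" by blast
  have WN: "W \<subseteq> carrier_vec N" by (auto simp: W_def)
  note inv = invariant_plane[OF WN W_add W_smult W_rep w]
  obtain c where c: "\<exists>k<m. c k \<noteq> 0" "linear_vec c \<in> W" using inv(2) by blast
  define c' where "c' = restrict c {..<m}"
  have c': "c' \<in> nonzero_vectors" "linear_vec c' \<in> W"
    using c by (auto simp: c'_def nonzero_vectors_def linear_vec_restrict)
  note s = frame[OF c'(1)] and t = frame_inv[OF c'(1)]
  have "(g * frame c') $$ (i, j) = (g *\<^sub>v col (frame c') j) $ i" if "i < N" "j < N" for i j
    using that gm GL_carrier_mat[OF s(1)] by simp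
  then have "(g * frame c') $$ (i, j) = 0" if "2 \<le> i" "i < N" "j < 2" for i j
    using that s(2,3) inv(1) c'(2) by (auto simp: W_def less_2_cases_iff)
  moreover have "g * frame c' \<in> carrier (GL N)" using m_closed[OF g(1) s(1)] by simp
  ultimately have "g * frame c' \<in> P" by (auto simp: parabolic_eq[OF N(1)])
  moreover have "g = g * frame c' * frame_inv c'"
    using assoc_mult_mat[OF gm GL_carrier_mat[OF s(1)] GL_carrier_mat[OF t(1)]] t(3) gm by simp
  ultimately have "g \<in> P #>\<^bsub>GL N\<^esub> frame_inv c'" using mem_P_rcoset by blast
  then have "K = plane_coset c'"
    using repr_independence[OF _ t(1) P] g(2) by (simp add: plane_coset_def)
  then show ?thesis using c'(1) by blast
qed

text \<open>Equality of the planes makes the linear form d a combination of 1 and the linear form c.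
  Comparing coefficients at the indices p^k, where the constant function has none, leaves only a
  scaling.\<close>

lemma plane_coset_eq_iff:
  assumes c: "c \<in> nonzero_vectors" and d: "d \<in> nonzero_vectors"
  shows "plane_coset c = plane_coset d \<longleftrightarrow> (\<exists>b. b \<noteq> 0 \<and> d = restrict (\<lambda>k. b * c k) {..<m})"
proof
  interpret group "GL N :: 'p mod_ring mat monoid" by (rule group_GL)
  note s = frame[OF c] and t = frame_inv[OF c] and s' = frame[OF d] and t' = frame_inv[OF d]
  note sm = GL_carrier_mat[OF s(1)] and tm = GL_carrier_mat[OF t(1)]
    and sm' = GL_carrier_mat[OF s'(1)] and tm' = GL_carrier_mat[OF t'(1)]
  {
    assume "plane_coset c = plane_coset d"
    then have "frame_inv c \<in> P #>\<^bsub>GL N\<^esub> frame_inv d"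
      using rcos_self[OF t(1) P] by (simp add: plane_coset_def)
    then obtain M where M: "M \<in> P" "frame_inv c = M * frame_inv d" using mem_P_rcoset by blast
    have MN: "M \<in> carrier_mat N N" using M(1) subgroup.subset[OF P] GL_carrier_mat by blast
    have "frame_inv c * frame d = M"
      unfolding M(2) using assoc_mult_mat[OF MN tm' sm'] t'(2) MN by simp
    then have "frame d = frame c * M"
      using assoc_mult_mat[OF sm tm sm'] t(3) sm' by simp
    then have "linear_vec d = frame c *\<^sub>v col M 1"
      using col_mult2[OF sm MN, of 1] s'(3) N(1) by simp
    then have row: "linear_vec d $ i = (\<Sum>l<N. frame c $$ (i, l) * M $$ (l, 1))" if "i < N" for i
      using that sm MN N(1) by (simp add: scalar_prod_def lessThan_atLeast0)
    have lin: "linear_vec d $ i = M $$ (1, 1) * linear_vec c $ i" if i: "0 < i" "i < N" for i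
    proof -
      have "(\<Sum>l<N. frame c $$ (i, l) * M $$ (l, 1)) = frame c $$ (i, 1) * M $$ (1, 1)"
      proof (rule sum_eq_single)
        show "frame c $$ (i, l) * M $$ (l, 1) = 0" if "l \<in> {..<N}" "l \<noteq> 1" for l
        proof (cases "l = 0")
          case True
          have "frame c $$ (i, 0) = col (frame c) 0 $ i" using i sm N(1) by simp
          then show ?thesis using True i by (simp add: s(2) fixed_vec_index)
        next
          case False
          then show ?thesis using that M(1) by (auto simp: parabolic_eq[OF N(1)])
        qed
      qed (use N(1) in auto)
      moreover have "frame c $$ (i, 1) = linear_vec c $ i"
        using i sm N(1) by (simp flip: s(3))
      ultimately show ?thesis using row[OF i(2)] by (simp add: mult.commute)
    qed
    have dk: "d k = M $$ (1, 1) * c k" if k: "k < m" for k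
    proof -
      have "0 < CARD('p) ^ k" using p1 by simp
      from lin[OF this power_less_N[OF k]] show ?thesis by (simp only: linear_vec_power[OF k])
    qed
    then have "d = restrict (\<lambda>k. M $$ (1, 1) * c k) {..<m}"
      using d by (auto simp: nonzero_vectors_def PiE_def extensional_def fun_eq_iff)
    moreover have "M $$ (1, 1) \<noteq> 0"
      using d dk by (auto simp: nonzero_vectors_def)
    ultimately show "\<exists>b. b \<noteq> 0 \<and> d = restrict (\<lambda>k. b * c k) {..<m}" by blast
  }
  assume "\<exists>b. b \<noteq> 0 \<and> d = restrict (\<lambda>k. b * c k) {..<m}"
  then obtain b where b: "b \<noteq> 0" "d = restrict (\<lambda>k. b * c k) {..<m}" by blast
  have lin: "linear_vec d = b \<cdot>\<^sub>v linear_vec c"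
    by (intro eq_vecI) (auto simp: linear_vec_def b(2) sum_distrib_left intro!: sum.cong)
  have "(frame_inv c * frame d) $$ (i, j) = (frame_inv c *\<^sub>v col (frame d) j) $ i" if "i < N" "j < N" for i j
    using that tm sm' by simp
  moreover have "frame_inv c *\<^sub>v linear_vec d = b \<cdot>\<^sub>v unit_vec N 1"
    unfolding lin using mult_mat_vec[OF tm linear_vec_carrier(1)] frame_inv_mult_fixed(2)[OF c] by simp
  ultimately have "(frame_inv c * frame d) $$ (i, j) = 0" if "2 \<le> i" "i < N" "j < 2" for i j
    using that s'(2,3) frame_inv_mult_fixed(1)[OF c] by (auto simp: less_2_cases_iff unit_vec_def)
  moreover have "frame_inv c * frame d \<in> carrier (GL N)" using m_closed[OF t(1) s'(1)] by simp
  ultimately have "frame_inv c * frame d \<in> P" by (auto simp: parabolic_eq[OF N(1)])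
  moreover have "frame_inv c = frame_inv c * frame d * frame_inv d"
    using assoc_mult_mat[OF tm sm' tm'] t'(3) tm by simp
  ultimately have "frame_inv c \<in> P #>\<^bsub>GL N\<^esub> frame_inv d" using mem_P_rcoset by blast
  then show "plane_coset c = plane_coset d"
    using repr_independence[OF _ t'(1) P] by (simp add: plane_coset_def)
qed

lemma sum_fixed_cosets:
  fixes h :: "'p mod_ring mat set \<Rightarrow> 'p mod_ring"
  shows "(\<Sum>K\<in>fixed_cosets. h K) = - (\<Sum>c\<in>nonzero_vectors. h (plane_coset c))"
proof -
  have img: "plane_coset ` nonzero_vectors = fixed_cosets"
    using plane_coset_fixed fixed_coset_is_plane_coset by blast
  have fiber: "(\<Sum>c\<in>{c \<in> nonzero_vectors. plane_coset c = K}. h (plane_coset c)) = - h K" if K: "K \<in> fixed_cosets" for K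
  proof -
    obtain c where c: "c \<in> nonzero_vectors" "K = plane_coset c" using fixed_coset_is_plane_coset[OF K] by blast
    let ?r = "\<lambda>b. restrict (\<lambda>k. b * c k) {..<m}"
    obtain k0 where k0: "k0 < m" "c k0 \<noteq> 0" using c(1) by (auto simp: nonzero_vectors_def)
    have r: "?r b \<in> nonzero_vectors" if "b \<noteq> 0" for b
      using that k0 by (auto simp: nonzero_vectors_def)
    have "inj_on ?r (UNIV - {0})"
    proof (rule inj_onI)
      fix a b assume "?r a = ?r b"
      then have "?r a k0 = ?r b k0" by simp
      then show "a = b" using k0 by simp
    qed
    moreover have "{d \<in> nonzero_vectors. plane_coset d = K} = ?r ` (UNIV - {0})"
    proof (intro equalityI subsetI)
      fix d assume "d \<in> {d \<in> nonzero_vectors. plane_coset d = K}"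
      then have "d \<in> nonzero_vectors" "plane_coset c = plane_coset d" using c(2) by auto
      then show "d \<in> ?r ` (UNIV - {0})" using plane_coset_eq_iff[OF c(1)] by blast
    next
      fix d assume "d \<in> ?r ` (UNIV - {0})"
      then obtain b where b: "b \<noteq> 0" "d = ?r b" by blast
      have d: "d \<in> nonzero_vectors" unfolding b(2) using b(1) by (rule r)
      then have "plane_coset c = plane_coset d" using plane_coset_eq_iff[OF c(1) d] b by blast
      then show "d \<in> {d \<in> nonzero_vectors. plane_coset d = K}" using d c(2) by simp
    qed
    ultimately have "card {d \<in> nonzero_vectors. plane_coset d = K} = card (UNIV - {0 :: 'p mod_ring})"
      by (simp only: card_image)
    then have "of_nat (card {d \<in> nonzero_vectors. plane_coset d = K}) = (- 1 :: 'p mod_ring)"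
      by (simp only: card_mod_ring_units)
    moreover have "(\<Sum>c\<in>{c \<in> nonzero_vectors. plane_coset c = K}. h (plane_coset c)) = (\<Sum>c\<in>{c \<in> nonzero_vectors. plane_coset c = K}. h K)"
      by (intro sum.cong) auto
    ultimately show ?thesis by simp
  qed
  have "(\<Sum>c\<in>nonzero_vectors. h (plane_coset c))
    = (\<Sum>K\<in>plane_coset ` nonzero_vectors. \<Sum>c\<in>{c \<in> nonzero_vectors. plane_coset c = K}. h (plane_coset c))"
    by (rule sum.image_gen[OF finite_nonzero_vectors])
  also have "\<dots> = (\<Sum>K\<in>fixed_cosets. - h K)"
    unfolding img using fiber by (rule sum.cong[OF refl])
  finally show ?thesis by (simp add: sum_negf)
qed

lemma vector_space_smult: "vector_space (smult :: 'p mod_ring \<Rightarrow> 'p mod_ring poly \<Rightarrow> _)"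
  by unfold_locales (simp_all add: smult_add_right smult_add_left)

lemma rep_restriction:
  fixes z :: "('p mod_ring, 'p mod_ring) cochain"
  assumes u: "u \<in> cochains (GL N) P" "coboundary (GL N) u = (\<lambda>_. 0)"
    and val: "\<And>Ms. set Ms \<subseteq> P \<Longrightarrow> u Ms = f (map upper_left Ms)"
    and f: "(\<lambda>xs. cochain_pullback add_group unipotent f xs - z xs) \<in> coboundaries add_group"
  shows "(\<lambda>xs. cochain_pullback add_group rep (cochain_transfer (GL N) P u) xs
    + (\<Sum>c\<in>nonzero_vectors. cochain_pullback add_group (coordinate_form m c) z xs)) \<in> coboundaries add_group"
proof -
  interpret group "GL N :: 'p mod_ring mat monoid" by (rule group_GL)
  define v where "v K xs = u (map (\<lambda>e. (SOME t. t \<in> K) \<otimes>\<^bsub>GL N\<^esub> rep e) xs)" for K xs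
  have v: "(\<lambda>xs. v (plane_coset c) xs - cochain_pullback add_group (coordinate_form m c) z xs) \<in> coboundaries add_group"
    if c: "c \<in> nonzero_vectors" for c
  proof -
    note t = frame_inv(1)[OF c]
    have conj: "frame_inv c \<otimes>\<^bsub>GL N\<^esub> rep e \<otimes>\<^bsub>GL N\<^esub> inv\<^bsub>GL N\<^esub> (frame_inv c) = frame_inv c * rep e * frame c" for e
      by (simp add: frame_inv(4)[OF c])
    have 1: "(\<lambda>xs. u (map (\<lambda>e. frame_inv c \<otimes>\<^bsub>GL N\<^esub> rep e) xs)
        - u (map (\<lambda>e. frame_inv c \<otimes>\<^bsub>GL N\<^esub> rep e \<otimes>\<^bsub>GL N\<^esub> inv\<^bsub>GL N\<^esub> (frame_inv c)) xs)) \<in> coboundaries add_group"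
      by (rule fixed_coset_conjugate[OF group_GL P rep_hom u t]) (simp only: conj conjugate_rep(1)[OF c])
    have 2: "u (map (\<lambda>e. frame_inv c \<otimes>\<^bsub>GL N\<^esub> rep e \<otimes>\<^bsub>GL N\<^esub> inv\<^bsub>GL N\<^esub> (frame_inv c)) xs)
        = f (map unipotent (map (coordinate_form m c) xs))" for xs
      unfolding conj using conjugate_rep[OF c]
      by (subst val) (auto simp: comp_def)
    have 3: "v (plane_coset c) xs = u (map (\<lambda>e. frame_inv c \<otimes>\<^bsub>GL N\<^esub> rep e) xs)" for xs
    proof -
      have "(SOME t. t \<in> plane_coset c) \<in> P #>\<^bsub>GL N\<^esub> frame_inv c"
        using some_in_rcoset(1)[OF group_GL P rcosetsI[OF subgroup.subset[OF P] t]] by (simp add: plane_coset_def)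
      from cochain_coset_rep[OF group_GL P u(1) t this, of "map rep xs"]
      show ?thesis using rep_GL by (auto simp: comp_def v_def)
    qed
    have "coordinate_form m c \<in> hom add_group add_group"
      by (simp add: hom_def coordinate_form_add)
    from cochain_pullback_coboundaries[OF group_add_group group_add_group this f]
    have "(\<lambda>xs. f (map unipotent (map (coordinate_form m c) xs)) - cochain_pullback add_group (coordinate_form m c) z xs)
        \<in> coboundaries add_group"
      by (simp add: cochain_pullback_add_group[abs_def])
    from coboundaries_add[OF 1[unfolded 2] this] show ?thesis by (simp add: 3)
  qed
  have "(\<lambda>xs. cochain_pullback add_group rep (cochain_transfer (GL N) P u) xs - (\<Sum>K\<in>fixed_cosets. v K xs)) \<in> coboundaries add_group"
    unfolding v_def
    by (rule transfer_restriction_elementary[OF of_nat_card_eq_0 vector_space_smult group_GL P finite_rcosets_GL[OF P] rep_hom u])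
  moreover have "(\<lambda>xs. \<Sum>c\<in>nonzero_vectors. v (plane_coset c) xs - cochain_pullback add_group (coordinate_form m c) z xs)
      \<in> coboundaries add_group"
    by (rule coboundaries_sum[OF v])
  ultimately have "(\<lambda>xs. cochain_pullback add_group rep (cochain_transfer (GL N) P u) xs - (\<Sum>K\<in>fixed_cosets. v K xs)
      - (\<Sum>c\<in>nonzero_vectors. v (plane_coset c) xs - cochain_pullback add_group (coordinate_form m c) z xs))
      \<in> coboundaries add_group"
    by (rule coboundaries_diff)
  then show ?thesis by (simp add: sum_fixed_cosets sum_subtractf)
qed

end

section \<open>Detection\<close>

lemma cochain_pullback_ring_hom:
  assumes "group E" "group G" "\<phi> \<in> hom E G"
  shows "cochain_pullback E \<phi> \<in> Ring.ring_hom (cocycle_ring G) (cocycle_ring E)"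
proof (rule Ring.ring_hom_memI)
  have \<phi>: "\<phi> \<in> carrier E \<rightarrow> carrier G" using assms(3) by (simp add: hom_def)
  show "cochain_pullback E \<phi> f \<in> carrier (cocycle_ring E)" if "f \<in> carrier (cocycle_ring G)" for f
    using cochain_pullback_cocycle[OF assms that] .
  show "cochain_pullback E \<phi> (f \<otimes>\<^bsub>cocycle_ring G\<^esub> g)
      = cochain_pullback E \<phi> f \<otimes>\<^bsub>cocycle_ring E\<^esub> cochain_pullback E \<phi> g"
    if f: "f \<in> carrier (cocycle_ring G)" and g: "g \<in> carrier (cocycle_ring G)" for f g
  proof -
    have "cup (cochain_pullback E \<phi> f) (cochain_pullback E \<phi> g) xs = cochain_pullback E \<phi> (cup f g) xs" for xs
    proof (cases "set xs \<subseteq> carrier E")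
      case True
      then have "cup (cochain_pullback E \<phi> f) (cochain_pullback E \<phi> g) xs = cup (\<lambda>ys. f (map \<phi> ys)) (\<lambda>ys. g (map \<phi> ys)) xs"
        by (intro cup_cong) (auto simp: cochain_pullback_def)
      then show ?thesis using True by (simp add: cup_map cochain_pullback_def)
    next
      case False
      have "cochain_pullback E \<phi> f \<in> cochains E (carrier E)" "cochain_pullback E \<phi> g \<in> cochains E (carrier E)"
        using cochain_pullback_cocycle[OF assms f] cochain_pullback_cocycle[OF assms g] by (simp_all add: carrier_cocycle_ring)
      from cup_support[OF this] have "cup (cochain_pullback E \<phi> f) (cochain_pullback E \<phi> g) xs = 0"
        using False by blast
      moreover have "cochain_pullback E \<phi> (cup f g) xs = 0" using False by (simp add: cochain_pullback_def)
      ultimately show ?thesis by simp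
    qed
    then show ?thesis by (simp add: fun_eq_iff)
  qed
  show "cochain_pullback E \<phi> \<one>\<^bsub>cocycle_ring G\<^esub> = \<one>\<^bsub>cocycle_ring E\<^esub>"
    using \<phi> by (auto simp: cochain_pullback_def cochain_const_def fun_eq_iff)
qed (auto simp: cochain_pullback_def)

lemma cohom_class_pow:
  assumes "group G" "f \<in> carrier (cocycle_ring G)"
  shows "cohom_class G (f [^]\<^bsub>cocycle_ring G\<^esub> (n::nat)) = cohom_class G f [^]\<^bsub>cohom_ring G\<^esub> n"
  using ring_hom_ring.hom_nat_pow[OF cohom_class_ring_hom[OF assms(1)] assms(2)] .

lemma cocycle_scale:
  "f \<in> carrier (cocycle_ring G) \<Longrightarrow> (\<lambda>xs. c * f xs) \<in> carrier (cocycle_ring G)"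
  by (simp add: carrier_cocycle_ring cochains_scale coboundary_scale)

lemma cocycle_pow_scale:
  "(\<lambda>xs. c * f xs) [^]\<^bsub>cocycle_ring G\<^esub> (n::nat) = (\<lambda>xs. c ^ n * (f [^]\<^bsub>cocycle_ring G\<^esub> n) xs)"
proof (induction n)
  case (Suc n)
  then show ?case by (simp add: cup_scale_left cup_scale_right mult_ac)
qed simp

text \<open>One exponent has to serve all weighted endomorphisms at once: the linear forms c give
  different slopes, and a common exponent lets their contributions assemble into a power
  sum.\<close>

definition has_weight :: "('p::prime_card mod_ring, 'p mod_ring) cochain \<Rightarrow> nat \<Rightarrow> bool" where
  "has_weight z d \<longleftrightarrow> (\<forall>L. weighted_endo L \<longrightarrow> weighted_endo.scales L z (weighted_endo.slope L ^ d))"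

lemma has_weight_cup:
  assumes "f \<in> carrier (cocycle_ring add_group)" "g \<in> carrier (cocycle_ring add_group)"
    and "has_weight f a" "has_weight g b"
  shows "has_weight (cup f g) (a + b)"
  using assms weighted_endo.scales_cup unfolding has_weight_def by (metis power_add)

lemma has_weight_pow:
  fixes f :: "('p::prime_card mod_ring, 'p mod_ring) cochain"
  assumes "f \<in> carrier (cocycle_ring add_group)" "has_weight f a"
  shows "has_weight (f [^]\<^bsub>cocycle_ring add_group\<^esub> (n::nat)) (a * n)"
  unfolding has_weight_def
proof (intro allI impI)
  fix L :: "'p mod_ring \<Rightarrow> ('p mod_ring \<Rightarrow> 'p mod_ring poly) \<Rightarrow> 'p mod_ring poly"
  assume L: "weighted_endo L"
  then have "weighted_endo.scales L f (weighted_endo.slope L ^ a)" using assms(2) by (simp add: has_weight_def)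
  from weighted_endo.scales_pow[OF L assms(1) this]
  show "weighted_endo.scales L (f [^]\<^bsub>cocycle_ring add_group\<^esub> n) (weighted_endo.slope L ^ (a * n))"
    by (simp only: power_mult)
qed

text \<open>Multiplication by b is a genuine endomorphism, hence a weighted one, with slope b; and
  b^d = 1 since p - 1 divides d. So the weight already contains the torus invariance needed to lift
  the class to \<open>GL 2\<close>.\<close>

lemma has_weight_invariant:
  fixes z :: "('p::prime_card mod_ring, 'p mod_ring) cochain"
  assumes z: "z \<in> carrier (cocycle_ring add_group)" and w: "has_weight z d"
    and d: "CARD('p) - 1 dvd d" and b: "b \<noteq> 0"
  shows "(\<lambda>xs. z (map ((*) b) xs) - z xs) \<in> coboundaries add_group"
proof -
  let ?E = "\<lambda>(j :: 'p mod_ring) (F :: 'p mod_ring \<Rightarrow> 'p mod_ring poly). F j"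
  let ?L = "\<lambda>(j :: 'p mod_ring) (F :: 'p mod_ring \<Rightarrow> 'p mod_ring poly). F (b * j)"
  have add: "b * (x + y) = b * x + b * y" for x y by (rule distrib_left)
  have L: "weighted_endo ?L"
    unfolding weighted_endo_def by unfold_locales (simp_all add: distrib_left)
  have weigh: "weigh ?E \<phi> js = \<phi> js" for \<phi> js by (induction js arbitrary: \<phi>) simp_all
  have ext: "extend_scalars z \<in> cochains add_group UNIV"
    using z by (simp add: carrier_cocycle_ring extend_scalars_in_cochains)
  have mulb: "(*) b \<in> hom add_group add_group" by (simp add: hom_def distrib_left)
  have "cochain_pullback add_group ((*) b) (extend_scalars z) \<in> cochains add_group UNIV"
    using cochain_pullback_hom[OF group_add_group group_add_group mulb] ext by simp
  then have "shift ?E (cochain_pullback add_group ((*) b) (extend_scalars z)) = cochain_pullback add_group ((*) b) (extend_scalars z)"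
    by (simp add: shift_def weigh[abs_def] of_bar_to_bar)
  then have "shift ?L (extend_scalars z) = cochain_pullback add_group ((*) b) (extend_scalars z)"
    using shift_pullback[of "(*) b" ?E "extend_scalars z", OF add] by simp
  moreover have "weighted_endo.slope ?L ^ d = 1"
    using mod_ring_power_eq_one[OF b d] weighted_endo.slope_def[OF L] by (simp add: poly_const_pow one_pCons)
  moreover have "weighted_endo.scales ?L z (weighted_endo.slope ?L ^ d)"
    by (rule w[unfolded has_weight_def, rule_format, OF L])
  ultimately have "(\<lambda>xs. cochain_pullback add_group ((*) b) (extend_scalars z) xs - 1 * extend_scalars z xs) \<in> coboundaries add_group"
    by (simp only: weighted_endo.scales_def[OF L])
  then have "(\<lambda>xs. 1 * extend_scalars (\<lambda>xs. z (map ((*) b) xs) - z xs) xs) \<in> coboundaries add_group"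
    by (simp add: cochain_pullback_add_group extend_scalars_def)
  from coefficient_coboundary[OF this, of 0] show ?thesis by simp
qed

context translation_representation
begin

text \<open>Restriction, scalar extension and \<open>shift\<close> compose to a ring homomorphism
  \<Phi> sending \<chi> to the class of - \<mu> z, where \<mu> is the power sum. From \<chi>^r = 0
  follows (- \<mu>)^r z^r = 0, and a nonzero coefficient of (- \<mu>)^r, a unit of the prime field,
  can be divided out.\<close>

lemma detection:
  fixes z :: "('p mod_ring, 'p mod_ring) cochain" and a :: "nat \<Rightarrow> 'p mod_ring poly"
  assumes z: "z \<in> carrier (cocycle_ring add_group)" and w: "has_weight z d" and d: "0 < d"
    and a: "power_sum m a 0 d \<noteq> 0"
    and \<chi>: "\<chi> \<in> carrier (cocycle_ring (GL N))"
    and res: "(\<lambda>xs. cochain_pullback add_group rep \<chi> xs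
      + (\<Sum>c\<in>nonzero_vectors. cochain_pullback add_group (coordinate_form m c) z xs)) \<in> coboundaries add_group"
    and nil: "\<chi> [^]\<^bsub>cocycle_ring (GL N)\<^esub> (r::nat) \<in> coboundaries (GL N)"
  shows "z [^]\<^bsub>cocycle_ring add_group\<^esub> r \<in> coboundaries add_group"
proof -
  obtain L :: "'p mod_ring \<Rightarrow> ('p mod_ring poly \<Rightarrow> 'p mod_ring poly) \<Rightarrow> 'p mod_ring poly"
    where L: "weighted_hom L" "\<And>c. L 1 (\<lambda>e. [:coordinate_form m c e:]) = linear_form m a c"
    using weighted_hom_with_slopes by blast
  interpret weighted_hom L by (rule L(1))
  define \<Phi> where "\<Phi> g = shift L (extend_scalars (cochain_pullback add_group rep g))" for g
  have "\<Phi> = (shift L \<circ> extend_scalars) \<circ> cochain_pullback add_group rep" by (simp add: fun_eq_iff \<Phi>_def)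
  moreover have "(shift L \<circ> extend_scalars) \<circ> cochain_pullback add_group rep
      \<in> Ring.ring_hom (cocycle_ring (GL N)) (cocycle_ring add_group)"
    by (rule Ring.ring_hom_trans[OF cochain_pullback_ring_hom[OF group_add_group group_GL rep_hom]
          Ring.ring_hom_trans[OF extend_scalars_ring_hom shift_ring_hom]])
  ultimately have \<Phi>: "\<Phi> \<in> Ring.ring_hom (cocycle_ring (GL N)) (cocycle_ring add_group)" by simp
  have \<Phi>_cob: "\<Phi> g \<in> coboundaries add_group" if "g \<in> coboundaries (GL N)" for g
    unfolding \<Phi>_def
    by (rule shift_coboundaries[OF extend_scalars_coboundaries[OF cochain_pullback_coboundaries[OF group_add_group group_GL rep_hom that]]])
  have \<Phi>\<chi>: "\<Phi> \<chi> \<in> carrier (cocycle_ring add_group)" by (rule Ring.ring_hom_closed[OF \<Phi> \<chi>])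
  let ?z = "extend_scalars z"
  have ez: "?z \<in> carrier (cocycle_ring add_group)" using z by (rule extend_scalars_cocycle)
  have summand: "(\<lambda>xs. shift L (extend_scalars (cochain_pullback add_group (coordinate_form m c) z)) xs
      - linear_form m a c ^ d * ?z xs) \<in> coboundaries add_group" for c
  proof -
    let ?L = "\<lambda>j F. L j (\<lambda>e. F (coordinate_form m c e))"
    have endo: "weighted_endo ?L"
      unfolding weighted_endo_def by (rule weighted_hom_pushforward[OF L(1) coordinate_form_add])
    have "extend_scalars (cochain_pullback add_group (coordinate_form m c) z) = cochain_pullback add_group (coordinate_form m c) ?z"
      by (simp add: fun_eq_iff extend_scalars_def cochain_pullback_add_group)
    then have "shift L (extend_scalars (cochain_pullback add_group (coordinate_form m c) z)) = shift ?L ?z"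
      using shift_pullback[of "coordinate_form m c" L ?z, OF coordinate_form_add] by simp
    moreover have "weighted_endo.slope ?L = linear_form m a c"
      using weighted_endo.slope_def[OF endo] L(2) by simp
    moreover have "weighted_endo.scales ?L z (weighted_endo.slope ?L ^ d)" using w endo by (simp add: has_weight_def)
    ultimately show ?thesis using weighted_endo.scales_def[OF endo] by simp
  qed
  define \<mu> where "\<mu> = (\<Sum>c\<in>nonzero_vectors. linear_form m a c ^ d)"
  \<comment> \<open>The zero vector, absent on the left, contributes 0^d, which is 0 because d is
    positive.\<close>
  have "\<mu> = power_sum m a 0 d"
    unfolding \<mu>_def power_sum_def add_0_left
  proof (rule sum.mono_neutral_left)
    show "finite (coefficient_vectors m :: (nat \<Rightarrow> 'p mod_ring) set)" by (intro finite_PiE) auto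
    show "\<forall>c\<in>coefficient_vectors m - nonzero_vectors. linear_form m a c ^ d = 0"
      using d by (auto simp: nonzero_vectors_def linear_form_def)
  qed (auto simp: nonzero_vectors_def)
  then have \<mu>: "\<mu> \<noteq> 0" using a by simp
  have shift_sum: "shift L (extend_scalars (\<lambda>xs. g xs + (\<Sum>c\<in>I. h c xs)))
      = (\<lambda>xs. shift L (extend_scalars g) xs + (\<Sum>c\<in>I. shift L (extend_scalars (h c)) xs))"
    for g and h :: "(nat \<Rightarrow> 'p mod_ring) \<Rightarrow> ('p mod_ring poly, 'p mod_ring) cochain" and I
  proof -
    have ext_add: "extend_scalars (\<lambda>xs. g xs + h xs) = (\<lambda>xs. extend_scalars g xs + extend_scalars h xs)"
      for g h :: "('p mod_ring poly, 'p mod_ring) cochain"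
      by (simp add: extend_scalars_def fun_eq_iff)
    have ext_zero: "extend_scalars (\<lambda>_. 0) = (\<lambda>_::'p mod_ring poly list. 0 :: 'p mod_ring poly)"
      by (simp add: extend_scalars_def fun_eq_iff)
    have "shift L (extend_scalars (\<lambda>xs. \<Sum>c\<in>I. h c xs)) = (\<lambda>xs. \<Sum>c\<in>I. shift L (extend_scalars (h c)) xs)"
      by (induction I rule: infinite_finite_induct) (simp_all add: ext_add ext_zero shift_add)
    then show ?thesis by (simp add: ext_add shift_add)
  qed
  have "(\<lambda>xs. \<Phi> \<chi> xs + (\<Sum>c\<in>nonzero_vectors. shift L (extend_scalars (cochain_pullback add_group (coordinate_form m c) z)) xs))
      \<in> coboundaries add_group"
    using shift_coboundaries[OF extend_scalars_coboundaries[OF res]] unfolding shift_sum \<Phi>_def .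
  moreover have "(\<lambda>xs. \<Sum>c\<in>nonzero_vectors. shift L (extend_scalars (cochain_pullback add_group (coordinate_form m c) z)) xs
      - linear_form m a c ^ d * ?z xs) \<in> coboundaries add_group"
    by (rule coboundaries_sum[OF summand])
  ultimately have "(\<lambda>xs. \<Phi> \<chi> xs + (\<Sum>c\<in>nonzero_vectors. shift L (extend_scalars (cochain_pullback add_group (coordinate_form m c) z)) xs)
      - (\<Sum>c\<in>nonzero_vectors. shift L (extend_scalars (cochain_pullback add_group (coordinate_form m c) z)) xs
        - linear_form m a c ^ d * ?z xs)) \<in> coboundaries add_group"
    by (rule coboundaries_diff)
  then have "(\<lambda>xs. \<Phi> \<chi> xs - (- \<mu>) * ?z xs) \<in> coboundaries add_group"
    by (simp add: \<mu>_def sum_subtractf sum_distrib_right)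
  then have cls: "cohom_class add_group (\<Phi> \<chi>) = cohom_class add_group (\<lambda>xs. (- \<mu>) * ?z xs)"
    by (simp only: cohom_class_eq_iff)
  have "ring_hom_ring (cocycle_ring (GL N)) (cocycle_ring add_group) \<Phi>"
    by (rule ring_hom_ringI2[OF ring_cocycle_ring[OF group_GL] ring_cocycle_ring[OF group_add_group] \<Phi>])
  from ring_hom_ring.hom_nat_pow[OF this \<chi>, of r] \<Phi>_cob[OF nil]
  have "\<Phi> \<chi> [^]\<^bsub>cocycle_ring add_group\<^esub> r \<in> coboundaries add_group" by simp
  then have "cohom_class add_group (\<Phi> \<chi>) [^]\<^bsub>cohom_ring add_group\<^esub> r = \<zero>\<^bsub>cohom_ring add_group\<^esub>"
    by (simp add: cohom_class_eq_zero_iff flip: cohom_class_pow[OF group_add_group \<Phi>\<chi>])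
  then have "(\<lambda>xs. (- \<mu>) * ?z xs) [^]\<^bsub>cocycle_ring add_group\<^esub> r \<in> coboundaries add_group"
    unfolding cls by (simp only: cohom_class_eq_zero_iff flip: cohom_class_pow[OF group_add_group cocycle_scale[OF ez]])
  moreover have "?z [^]\<^bsub>cocycle_ring add_group\<^esub> r = extend_scalars (z [^]\<^bsub>cocycle_ring add_group\<^esub> r)"
    using ring_hom_ring.hom_nat_pow[OF ring_hom_ringI2[OF ring_cocycle_ring[OF group_add_group]
          ring_cocycle_ring[OF group_add_group] extend_scalars_ring_hom] z, of r] by simp
  ultimately have c: "(\<lambda>xs. (- \<mu>) ^ r * extend_scalars (z [^]\<^bsub>cocycle_ring add_group\<^esub> r) xs) \<in> coboundaries add_group"
    by (simp only: cocycle_pow_scale)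
  have "(- \<mu>) ^ r \<noteq> 0" using \<mu> by simp
  then obtain i where i: "coeff ((- \<mu>) ^ r) i \<noteq> 0" by (metis leading_coeff_neq_0)
  have "(\<lambda>xs. inverse (coeff ((- \<mu>) ^ r) i) * (coeff ((- \<mu>) ^ r) i * (z [^]\<^bsub>cocycle_ring add_group\<^esub> r) xs)) \<in> coboundaries add_group"
    by (rule coboundaries_scale[OF coefficient_coboundary[OF c]])
  then show ?thesis using i by (simp flip: mult.assoc)
qed

end

text \<open>Stated for every r so that r = 1 yields nonvanishing and arbitrary r non-nilpotence. The
  digit condition is used twice: it makes p - 1 divide d, so that z lifts to \<open>GL 2\<close>,
  and with m \<le> n \<le> k it makes some power sum nonzero.\<close>

lemma chi_detection:
  fixes z :: "('p::prime_card mod_ring, 'p mod_ring) cochain"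
  assumes z: "z \<in> carrier (cocycle_ring add_group)" and len: "\<forall>xs. z xs \<noteq> 0 \<longrightarrow> length xs = Suc q"
    and w: "has_weight z d" and ds: "digit_sum CARD('p) d = k * (CARD('p) - 1)"
    and n: "1 \<le> n" "n \<le> k" and N: "2 \<le> N" "N \<le> CARD('p) ^ n"
  shows "chi N (GL2_class (cohom_class add_group z)) \<in> cohom_degree (GL N) q"
    and "chi N (GL2_class (cohom_class add_group z)) [^]\<^bsub>H_GL N\<^esub> (r::nat) = \<zero>\<^bsub>H_GL N\<^esub>
      \<Longrightarrow> z [^]\<^bsub>cocycle_ring add_group\<^esub> r \<in> coboundaries add_group"
proof -
  have p1: "1 < CARD('p)" by (rule card_gt_1)
  define m where "m = (LEAST m. N \<le> CARD('p) ^ m)"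
  have mN: "N \<le> CARD('p) ^ m" "m \<le> n"
    unfolding m_def using N(2) by (rule LeastI, rule Least_le)
  have "0 < m" using mN(1) N(1) by (intro gr0I) simp
  then have "\<not> N \<le> CARD('p) ^ (m - 1)"
    using not_less_Least[of "m - 1" "\<lambda>m. N \<le> CARD('p) ^ m"] by (simp add: m_def)
  then interpret translation_representation "TYPE('p)" m N
    using \<open>0 < m\<close> N(1) mN(1) by unfold_locales simp_all
  have "[d = k * (CARD('p) - 1)] (mod (CARD('p) - 1))"
    using digit_sum_cong[OF p1, of d] by (simp only: ds)
  then have dvd: "CARD('p) - 1 dvd d" by (simp add: cong_dvd_iff)
  have "d \<noteq> 0"
  proof
    assume "d = 0" then show False using ds n p1 by simp
  qed
  then have d: "0 < d" by simp
  obtain a where a: "power_sum m a 0 d \<noteq> (0 :: 'p mod_ring poly)"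
    using power_sum_nonzero[OF _ _ ds, of m] \<open>0 < m\<close> mN(2) n(2) by auto
  have inv: "(\<lambda>xs. z (map ((*) b) xs) - z xs) \<in> coboundaries add_group" if "b \<noteq> 0" for b
    by (rule has_weight_invariant[OF z w dvd that])
  obtain f where f: "f \<in> carrier (cocycle_ring (GL 2))" "GL2_class (cohom_class add_group z) = cohom_class (GL 2) f"
    "(\<lambda>xs. cochain_pullback add_group unipotent f xs - z xs) \<in> coboundaries add_group"
    and f_len: "\<And>xs. f xs \<noteq> 0 \<Longrightarrow> length xs = Suc q"
    by (rule GL2_class_representative[OF z inv len[rule_format]]) (assumption | rule that; assumption | simp)+
  obtain u where u: "u \<in> cochains (GL N) P" "coboundary (GL N) u = (\<lambda>_. 0)"
    and val: "\<And>Ms. set Ms \<subseteq> P \<Longrightarrow> u Ms = f (map upper_left Ms)"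
    and cls: "chi N (cohom_class (GL 2) f) = cohom_class (GL N) (cochain_transfer (GL N) P u)"
    and u_len: "\<And>xs. u xs \<noteq> 0 \<Longrightarrow> length xs = Suc q"
    using chi_representative[OF N(1) f(1) f_len] by blast
  let ?\<chi> = "cochain_transfer (GL N) P u"
  have \<chi>: "?\<chi> \<in> carrier (cocycle_ring (GL N))" by (rule cochain_transfer_cocycle[OF group_GL P u])
  show "chi N (GL2_class (cohom_class add_group z)) \<in> cohom_degree (GL N) q"
    unfolding f(2) cls cohom_degree_def using \<chi> cochain_transfer_length[OF u_len] by blast
  have res: "(\<lambda>xs. cochain_pullback add_group rep ?\<chi> xs
      + (\<Sum>c\<in>nonzero_vectors. cochain_pullback add_group (coordinate_form m c) z xs)) \<in> coboundaries add_group"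
    by (rule rep_restriction[OF u _ f(3)]) (rule val)
  assume "chi N (GL2_class (cohom_class add_group z)) [^]\<^bsub>H_GL N\<^esub> r = \<zero>\<^bsub>H_GL N\<^esub>"
  then have "?\<chi> [^]\<^bsub>cocycle_ring (GL N)\<^esub> r \<in> coboundaries (GL N)"
    unfolding f(2) cls by (simp add: cohom_class_eq_zero_iff flip: cohom_class_pow[OF group_GL \<chi>])
  then show "z [^]\<^bsub>cocycle_ring add_group\<^esub> r \<in> coboundaries add_group"
    by (rule detection[OF z w d a \<chi> res])
qed

section \<open>The generators of the cohomology of the cyclic group\<close>

text \<open>If a basis member were zero, the zero class would have two expansions, with coefficient
  0 and with coefficient 1 at that member.\<close>

lemma cohom_basis_nonzero:
  fixes e :: "'i \<Rightarrow> ('g, 'a::comm_ring_1) cohom_class"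
  assumes G: "group G" and basis: "cohom_basis G I e" and i: "i \<in> I"
  shows "e i \<noteq> \<zero>\<^bsub>cohom_ring G\<^esub>"
proof
  assume zero: "e i = \<zero>\<^bsub>cohom_ring G\<^esub>"
  interpret ring "cohom_ring G :: ('g, 'a) cohom_class ring" by (rule ring_cohom_ring[OF G])
  have scalar: "cohom_scalar G (1 :: 'a) \<in> carrier (cohom_ring G)"
    unfolding cohom_scalar_def carrier_cohom_ring
    by (rule imageI) (simp add: carrier_cocycle_ring cochain_const_in_cochains[OF G])
  let ?Q = "\<lambda>c. finite {i. c i \<noteq> (0 :: 'a)} \<and> {i. c i \<noteq> 0} \<subseteq> I \<and>
        \<zero>\<^bsub>cohom_ring G\<^esub> = (\<Oplus>\<^bsub>cohom_ring G\<^esub>i\<in>{i. c i \<noteq> 0}. cohom_scalar G (c i) \<otimes>\<^bsub>cohom_ring G\<^esub> e i)"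
  have ex: "\<exists>!c. ?Q c" using basis unfolding cohom_basis_def by blast
  have Q0: "?Q (\<lambda>_. 0)" by simp
  have Q1: "?Q (\<lambda>j. if j = i then 1 else 0)"
    using i scalar zero by (simp add: finsum_insert[of "{}", simplified])
  have "(\<lambda>_. 0 :: 'a) = (\<lambda>j. if j = i then 1 else 0)"
    by (rule trans[OF the1_equality[of ?Q, OF ex Q0, symmetric] the1_equality[of ?Q, OF ex Q1]])
  then show False by (metis zero_neq_one)
qed

lemma cohom_class_cup:
  assumes "group G" "f \<in> carrier (cocycle_ring G)" "g \<in> carrier (cocycle_ring G)"
  shows "cohom_class G (cup f g) = cohom_class G f \<otimes>\<^bsub>cohom_ring G\<^esub> cohom_class G g"
  using Ring.ring_hom_mult[OF ring_hom_ring.homh[OF cohom_class_ring_hom[OF assms(1)]] assms(2,3)] by simp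

lemma cohom_class_finsum:
  fixes G :: "('g, 'b) monoid_scheme" and g :: "'i \<Rightarrow> ('g, 'a::comm_ring_1) cochain"
  assumes G: "group G" and "finite S" "\<And>i. i \<in> S \<Longrightarrow> g i \<in> carrier (cocycle_ring G)"
  shows "(\<Oplus>\<^bsub>cohom_ring G\<^esub>i\<in>S. cohom_class G (g i)) = cohom_class G (\<lambda>xs. \<Sum>i\<in>S. g i xs)"
  using assms(2,3)
proof (induction S rule: finite_induct)
  case empty
  interpret H: ring "cohom_ring G :: ('g, 'a) cohom_class ring" by (rule ring_cohom_ring[OF G])
  have "cohom_class G (\<lambda>_::'g list. 0::'a) = \<zero>\<^bsub>cohom_ring G\<^esub>" by (simp add: cohom_class_eq_zero_iff)
  then show ?case by simp
next
  case (insert i S)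
  interpret H: ring "cohom_ring G :: ('g, 'a) cohom_class ring" by (rule ring_cohom_ring[OF G])
  interpret h: ring_hom_ring "cocycle_ring G" "cohom_ring G" "cohom_class G :: ('g, 'a) cochain \<Rightarrow> _"
    by (rule cohom_class_ring_hom[OF G])
  have sum: "(\<lambda>xs. \<Sum>i\<in>S. g i xs) \<in> carrier (cocycle_ring G)"
    using insert.prems by (auto simp: carrier_cocycle_ring cochains_sum coboundary_sum)
  have "(\<Oplus>\<^bsub>cohom_ring G\<^esub>i\<in>insert i S. cohom_class G (g i))
    = cohom_class G (g i) \<oplus>\<^bsub>cohom_ring G\<^esub> (\<Oplus>\<^bsub>cohom_ring G\<^esub>i\<in>S. cohom_class G (g i))"
    using insert by (intro H.finsum_insert) auto
  also have "\<dots> = cohom_class G (g i) \<oplus>\<^bsub>cohom_ring G\<^esub> cohom_class G (\<lambda>xs. \<Sum>i\<in>S. g i xs)"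
    using insert by simp
  also have "\<dots> = cohom_class G (\<lambda>xs. g i xs + (\<Sum>i\<in>S. g i xs))"
    using h.hom_add[OF insert.prems[of i] sum] by simp
  finally show ?case using insert.hyps by simp
qed

section \<open>Homogeneous components and the weights of the generators\<close>

lemma cup_length:
  assumes "\<And>xs. f xs \<noteq> 0 \<Longrightarrow> length xs = Suc a" "\<And>xs. g xs \<noteq> 0 \<Longrightarrow> length xs = Suc b" "cup f g xs \<noteq> 0"
  shows "length xs = Suc (a + b)"
proof -
  obtain i where "i < length xs" "f (take (Suc i) xs) \<noteq> 0" "g (drop i xs) \<noteq> 0"
    using cup_nonzeroE assms(3) by metis
  then show ?thesis using assms(1)[of "take (Suc i) xs"] assms(2)[of "drop i xs"] by simp
qed

lemma pow_length:
  assumes "\<And>xs. f xs \<noteq> 0 \<Longrightarrow> length xs = Suc a"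
  shows "(f [^]\<^bsub>cocycle_ring G\<^esub> (n::nat)) xs \<noteq> 0 \<Longrightarrow> length xs = Suc (a * n)"
proof (induction n arbitrary: xs)
  case 0
  then show ?case by (simp add: cochain_const_def split: if_splits)
next
  case (Suc n)
  have "length xs = Suc (a * n + a)"
    by (rule cup_length[OF Suc.IH assms]) (use Suc.prems in simp_all)
  then show ?case by simp
qed

text \<open>Since cochains of all degrees are kept in one function, an equation modulo coboundaries
  has to be split into its homogeneous components by hand.\<close>

lemma coboundary_length_part:
  assumes h: "h \<in> cochains G H"
  shows "(\<lambda>xs. if length xs = n then h xs else 0) \<in> cochains G H"
    "coboundary G (\<lambda>xs. if length xs = n then h xs else 0)
      = (\<lambda>xs. if length xs = Suc n then coboundary G h xs else 0)"
proof -
  show "(\<lambda>xs. if length xs = n then h xs else 0) \<in> cochains G H"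
    using cochains_support[OF h] cochains_invariant[OF h]
    by (intro cochainsI[where n = n]) (auto split: if_splits)
  have "cobd (\<lambda>xs. if length xs = n then h xs else 0) xs = (if length xs = Suc n then cobd h xs else 0)" for xs
  proof (cases "length xs = Suc n")
    case True
    have "cobd (\<lambda>xs. if length xs = n then h xs else 0) xs = cobd h xs"
      by (rule cobd_cong) (use True in auto)
    then show ?thesis using True by simp
  next
    case False
    have "cobd (\<lambda>xs. if length xs = n then h xs else 0) xs = cobd (\<lambda>_. 0) xs"
      by (rule cobd_cong) (use False in auto)
    then show ?thesis using False by simp
  qed
  then show "coboundary G (\<lambda>xs. if length xs = n then h xs else 0)
      = (\<lambda>xs. if length xs = Suc n then coboundary G h xs else 0)"
    by (simp add: coboundary_eq_cobd fun_eq_iff)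
qed

lemma cohom_degreeE:
  assumes "x \<in> cohom_degree G n"
  obtains f where "f \<in> carrier (cocycle_ring G)" "x = cohom_class G f" "\<And>xs. f xs \<noteq> 0 \<Longrightarrow> length xs = Suc n"
  using assms unfolding cohom_degree_def by blast

lemma has_weight_degree_one:
  fixes f :: "('p::prime_card mod_ring, 'p mod_ring) cochain"
  assumes "f \<in> carrier (cocycle_ring add_group)" "\<And>xs. f xs \<noteq> 0 \<Longrightarrow> length xs = Suc 1"
  shows "has_weight f 1"
  unfolding has_weight_def
proof (intro allI impI)
  fix L :: "'p mod_ring \<Rightarrow> ('p mod_ring \<Rightarrow> 'p mod_ring poly) \<Rightarrow> 'p mod_ring poly"
  assume L: "weighted_endo L"
  have "length xs = 2" if "f xs \<noteq> 0" for xs using assms(2)[OF that] by simp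
  then show "weighted_endo.scales L f (weighted_endo.slope L ^ 1)"
    using weighted_endo.scales_degree_one[OF L assms(1)] by simp
qed

text \<open>The generator y is arbitrary, while the weight is known for the carry class. Expanding
  the carry class in the monomial basis and keeping degree two leaves a multiple of y; the
  coefficient is nonzero because the carry cocycle is not a coboundary, so y is a multiple of the
  carry class.\<close>

lemma has_weight_degree_two:
  fixes x y :: "('p::prime_card mod_ring, 'p mod_ring) cochain"
  assumes x: "x \<in> carrier (cocycle_ring add_group)" and x_len: "\<And>xs. x xs \<noteq> 0 \<Longrightarrow> length xs = Suc 1"
    and y: "y \<in> carrier (cocycle_ring add_group)" and y_len: "\<And>xs. y xs \<noteq> 0 \<Longrightarrow> length xs = Suc 2"
    and basis: "cohom_basis add_group ({0, 1} \<times> UNIV)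
       (\<lambda>(a::nat, b::nat). cohom_class add_group x [^]\<^bsub>cohom_ring add_group\<^esub> a
         \<otimes>\<^bsub>cohom_ring add_group\<^esub> cohom_class add_group y [^]\<^bsub>cohom_ring add_group\<^esub> b)"
  shows "has_weight y CARD('p)"
proof -
  let ?Z = "cocycle_ring (add_group :: 'p mod_ring monoid) :: ('p mod_ring, 'p mod_ring) cochain ring"
  let ?H = "cohom_ring (add_group :: 'p mod_ring monoid) :: ('p mod_ring, 'p mod_ring) cohom_class ring"
  let ?cls = "cohom_class (add_group :: 'p mod_ring monoid) :: ('p mod_ring, 'p mod_ring) cochain \<Rightarrow> _"
  interpret Z: ring ?Z by (rule ring_cocycle_ring[OF group_add_group])
  define E where "E i = cup (x [^]\<^bsub>?Z\<^esub> fst i) (y [^]\<^bsub>?Z\<^esub> snd i)" for i :: "nat \<times> nat"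
  have xp: "x [^]\<^bsub>?Z\<^esub> a \<in> carrier ?Z" and yp: "y [^]\<^bsub>?Z\<^esub> a \<in> carrier ?Z" for a :: nat
    using x y by simp_all
  have E: "E i \<in> carrier ?Z" for i
    unfolding E_def by (rule cup_cocycle[OF group_add_group xp yp])
  have const: "cochain_const add_group s \<in> carrier ?Z" for s :: "'p mod_ring"
    using cochain_const_in_cochains[OF group_add_group, of s] by (simp add: carrier_cocycle_ring)
  have carry: "?cls carry_cocycle \<in> carrier ?H"
    unfolding carrier_cohom_ring by (rule imageI[OF carry_cocycle_cocycle])
  from basis[unfolded cohom_basis_def, THEN conjunct2, rule_format, OF carry]
  obtain c :: "nat \<times> nat \<Rightarrow> 'p mod_ring" where c: "finite {i. c i \<noteq> 0}" "{i. c i \<noteq> 0} \<subseteq> {0, 1} \<times> (UNIV :: nat set)"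
    "?cls carry_cocycle = (\<Oplus>\<^bsub>?H\<^esub>i\<in>{i. c i \<noteq> 0}. cohom_scalar add_group (c i) \<otimes>\<^bsub>?H\<^esub>
      (case i of (a, b) \<Rightarrow> ?cls x [^]\<^bsub>?H\<^esub> a \<otimes>\<^bsub>?H\<^esub> ?cls y [^]\<^bsub>?H\<^esub> b))"
    by (elim ex1E conjE) (rule that; assumption)
  have "cohom_scalar add_group s \<otimes>\<^bsub>?H\<^esub> (case i of (a, b) \<Rightarrow> ?cls x [^]\<^bsub>?H\<^esub> a \<otimes>\<^bsub>?H\<^esub> ?cls y [^]\<^bsub>?H\<^esub> b)
      = ?cls (\<lambda>xs. s * E i xs)" for s i
  proof -
    have "(case i of (a, b) \<Rightarrow> ?cls x [^]\<^bsub>?H\<^esub> a \<otimes>\<^bsub>?H\<^esub> ?cls y [^]\<^bsub>?H\<^esub> b) = ?cls (E i)"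
      unfolding E_def cohom_class_cup[OF group_add_group xp yp] cohom_class_pow[OF group_add_group x]
        cohom_class_pow[OF group_add_group y] by (simp add: case_prod_unfold)
    moreover have "cohom_scalar add_group s \<otimes>\<^bsub>?H\<^esub> ?cls (E i) = ?cls (cup (cochain_const add_group s) (E i))"
      unfolding cohom_scalar_def by (rule cohom_class_cup[OF group_add_group const E, symmetric])
    moreover have "cup (cochain_const add_group s) (E i) = (\<lambda>xs. s * E i xs)"
      using E[of i] by (intro cup_const_left) (auto simp: carrier_cocycle_ring)
    ultimately show ?thesis by simp
  qed
  then have "?cls carry_cocycle = ?cls (\<lambda>xs. \<Sum>i\<in>{i. c i \<noteq> 0}. c i * E i xs)"
    unfolding c(3) using cohom_class_finsum[OF group_add_group c(1), of "\<lambda>i xs. c i * E i xs"] cocycle_scale[OF E] by simp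
  then obtain h where h: "h \<in> cochains add_group UNIV"
    "\<And>xs. carry_cocycle xs - (\<Sum>i\<in>{i. c i \<noteq> 0}. c i * E i xs) = coboundary add_group h xs"
    unfolding cohom_class_eq_iff by (auto elim!: coboundariesE simp: fun_eq_iff)
  have E_len: "E (a, b) xs \<noteq> 0 \<Longrightarrow> length xs = Suc (a + 2 * b)" for a b xs
    unfolding E_def using cup_length[OF pow_length[OF x_len] pow_length[OF y_len]] by fastforce
  have E01: "E (0, 1) = y"
    using cup_const_left[of y add_group UNIV 1] y by (simp add: E_def carrier_cocycle_ring)
  have part: "(\<Sum>i\<in>{i. c i \<noteq> 0}. c i * E i xs) = c (0, 1) * y xs" if xs: "length xs = 3" for xs
  proof -
    have "(\<Sum>i\<in>{i. c i \<noteq> 0}. c i * E i xs) = (\<Sum>i\<in>{i. c i \<noteq> 0} \<inter> {(0, 1)}. c i * E i xs)"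
    proof (rule sum.mono_neutral_right[OF c(1)])
      show "\<forall>i\<in>{i. c i \<noteq> 0} - {i. c i \<noteq> 0} \<inter> {(0, 1)}. c i * E i xs = 0"
      proof
        fix i assume i: "i \<in> {i. c i \<noteq> 0} - {i. c i \<noteq> 0} \<inter> {(0, 1)}"
        obtain a b where ab: "i = (a, b)" by fastforce
        then have "a \<in> {0, 1}" "(a, b) \<noteq> (0, 1)" using i c(2) by auto
        \<comment> \<open>Length 3 is degree two, and with a at most 1 the monomial x^a y^b has
          degree two only for a = 0, b = 1.\<close>
        then have "Suc (a + 2 * b) \<noteq> 3" by auto
        then show "c i * E i xs = 0" using E_len[of a b xs] xs ab by auto
      qed
    qed auto
    also have "\<dots> = c (0, 1) * E (0, 1) xs"
      by (cases "c (0, 1) = 0") auto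
    finally show ?thesis by (simp only: E01)
  qed
  let ?h = "\<lambda>xs. if length xs = 2 then h xs else 0"
  have eq: "(\<lambda>xs. carry_cocycle xs - c (0, 1) * y xs) = coboundary add_group ?h"
  proof
    fix xs
    have "carry_cocycle xs = 0" "y xs = 0" if "length xs \<noteq> 3"
      using that carry_cocycle_length[of xs] y_len[of xs] by auto
    then show "carry_cocycle xs - c (0, 1) * y xs = coboundary add_group ?h xs"
      using coboundary_length_part(2)[OF h(1), of 2] h(2)[of xs] part[of xs] by (cases "length xs = 3") auto
  qed
  have cob: "(\<lambda>xs. carry_cocycle xs - c (0, 1) * y xs) \<in> coboundaries add_group"
    using coboundary_length_part(1)[OF h(1), of 2] by (intro coboundariesI[OF _ eq]) simp
  have nz: "c (0, 1) \<noteq> 0" using cob carry_cocycle_not_coboundary by auto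
  have "(\<lambda>xs. - inverse (c (0, 1)) * (carry_cocycle xs - c (0, 1) * y xs)) \<in> coboundaries add_group"
    by (rule coboundaries_scale[OF cob])
  moreover have "- inverse a * (u - a * v) = v - inverse a * u" if "a \<noteq> 0" for a u v :: "'p mod_ring"
    using that by (simp add: field_simps)
  ultimately have cob_y: "(\<lambda>xs. y xs - inverse (c (0, 1)) * carry_cocycle xs) \<in> coboundaries add_group"
    using nz by (simp only: not_False_eq_True)
  show ?thesis
    unfolding has_weight_def
  proof (intro allI impI)
    fix L :: "'p mod_ring \<Rightarrow> ('p mod_ring \<Rightarrow> 'p mod_ring poly) \<Rightarrow> 'p mod_ring poly"
    assume L: "weighted_endo L"
    show "weighted_endo.scales L y (weighted_endo.slope L ^ CARD('p))"
      by (rule weighted_endo.scales_cohomologous[OF L weighted_endo.scales_carry[OF L] cob_y])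
  qed
qed

theorem theorem42:
  fixes p n N :: nat
  assumes p: "p = CARD('p::prime_card)"
    and n: "1 \<le> n"
    and N: "2 \<le> N" "N \<le> p ^ n"
  shows
    "(p = 2 \<longrightarrow>
       (\<forall>(y :: ('p mod_ring, 'p mod_ring) cohom_class) d.
          polynomial_generator y \<and> n \<le> digit_sum 2 d \<longrightarrow>
          chi N (GL2_class (y [^]\<^bsub>H_Fp\<^esub> d)) \<in> cohom_degree (GL N) d \<and>
          \<not> nilpotent_elem (H_GL N) (chi N (GL2_class (y [^]\<^bsub>H_Fp\<^esub> d))))) \<and>
     (odd p \<longrightarrow>
       (\<forall>(x :: ('p mod_ring, 'p mod_ring) cohom_class) y d.
          exterior_polynomial_generators x y \<and> (\<exists>k\<ge>n. digit_sum p d = k * (p - 1)) \<longrightarrow>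
          chi N (GL2_class (y [^]\<^bsub>H_Fp\<^esub> d)) \<in> cohom_degree (GL N) (2 * d) \<and>
          \<not> nilpotent_elem (H_GL N) (chi N (GL2_class (y [^]\<^bsub>H_Fp\<^esub> d))))) \<and>
     (odd p \<longrightarrow>
       (\<forall>(x :: ('p mod_ring, 'p mod_ring) cohom_class) y d.
          exterior_polynomial_generators x y \<and> (\<exists>k\<ge>n. digit_sum p d = k * (p - 1) - 1) \<longrightarrow>
          chi N (GL2_class (x \<otimes>\<^bsub>H_Fp\<^esub> y [^]\<^bsub>H_Fp\<^esub> d)) \<in> cohom_degree (GL N) (2 * d + 1) \<and>
          chi N (GL2_class (x \<otimes>\<^bsub>H_Fp\<^esub> y [^]\<^bsub>H_Fp\<^esub> d)) \<noteq> \<zero>\<^bsub>H_GL N\<^esub>))"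
proof -
  let ?Z = "cocycle_ring (add_group :: 'p mod_ring monoid) :: ('p mod_ring, 'p mod_ring) cochain ring"
  let ?H = "cohom_ring (add_group :: 'p mod_ring monoid) :: ('p mod_ring, 'p mod_ring) cohom_class ring"
  let ?cls = "cohom_class (add_group :: 'p mod_ring monoid) :: ('p mod_ring, 'p mod_ring) cochain \<Rightarrow> _"
  have p1: "1 < p" unfolding p by (rule card_gt_1)
  have N': "N \<le> CARD('p) ^ n" using N(2) p by simp
  interpret Z: ring ?Z by (rule ring_cocycle_ring[OF group_add_group])
  interpret H: ring ?H by (rule ring_cohom_ring[OF group_add_group])
  have not_nilpotent: "\<not> nilpotent_elem (H_GL N) (chi N (GL2_class (?cls y [^]\<^bsub>?H\<^esub> d)))"
    if y: "y \<in> carrier ?Z" and nz: "\<And>b. ?cls y [^]\<^bsub>?H\<^esub> (b::nat) \<noteq> \<zero>\<^bsub>?H\<^esub>"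
      and detect: "\<And>r::nat. chi N (GL2_class (?cls (y [^]\<^bsub>?Z\<^esub> d))) [^]\<^bsub>H_GL N\<^esub> r = \<zero>\<^bsub>H_GL N\<^esub>
        \<Longrightarrow> (y [^]\<^bsub>?Z\<^esub> d) [^]\<^bsub>?Z\<^esub> r \<in> coboundaries add_group" for y and d :: nat
  proof
    assume "nilpotent_elem (H_GL N) (chi N (GL2_class (?cls y [^]\<^bsub>?H\<^esub> d)))"
    then obtain r :: nat where "chi N (GL2_class (?cls (y [^]\<^bsub>?Z\<^esub> d))) [^]\<^bsub>H_GL N\<^esub> r = \<zero>\<^bsub>H_GL N\<^esub>"
      by (auto simp: nilpotent_elem_def cohom_class_pow[OF group_add_group y])
    from detect[OF this] have "y [^]\<^bsub>?Z\<^esub> (d * r) \<in> coboundaries add_group"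
      using Z.nat_pow_pow[OF y] by simp
    then have "?cls y [^]\<^bsub>?H\<^esub> (d * r) = \<zero>\<^bsub>?H\<^esub>"
      by (simp add: cohom_class_eq_zero_iff flip: cohom_class_pow[OF group_add_group y])
    then show False using nz by blast
  qed
  have part1: "chi N (GL2_class (Y [^]\<^bsub>H_Fp\<^esub> d)) \<in> cohom_degree (GL N) d \<and>
      \<not> nilpotent_elem (H_GL N) (chi N (GL2_class (Y [^]\<^bsub>H_Fp\<^esub> d)))"
    if p2: "p = 2" and gen: "polynomial_generator Y" and ds: "n \<le> digit_sum 2 d"
    for Y :: "('p mod_ring, 'p mod_ring) cohom_class" and d
  proof -
    obtain y where y: "y \<in> carrier ?Z" "Y = ?cls y" and y_len: "\<And>xs. y xs \<noteq> 0 \<Longrightarrow> length xs = Suc 1"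
      using gen unfolding polynomial_generator_def Fp_group_eq by (auto elim: cohom_degreeE)
    have basis: "cohom_basis add_group UNIV (\<lambda>b::nat. ?cls y [^]\<^bsub>?H\<^esub> b)"
      using gen unfolding polynomial_generator_def Fp_group_eq y(2) by blast
    let ?z = "y [^]\<^bsub>?Z\<^esub> d"
    have z: "?z \<in> carrier ?Z" using y(1) by simp
    have z_len: "\<forall>xs. ?z xs \<noteq> 0 \<longrightarrow> length xs = Suc d"
      using pow_length[OF y_len] by fastforce
    have w: "has_weight ?z d" using has_weight_pow[OF y(1) has_weight_degree_one[OF y(1) y_len], of d] by simp
    \<comment> \<open>For p = 2 the generator has degree one and weight one, so d itself is the
      weight. As p - 1 = 1, the digit sum can play the role of k.\<close>
    have ds': "digit_sum CARD('p) d = digit_sum 2 d * (CARD('p) - 1)" using p p2 by simp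
    note chi = chi_detection[OF z z_len w ds' n ds N(1) N']
    show ?thesis
      using chi(1) not_nilpotent[OF y(1) cohom_basis_nonzero[OF group_add_group basis UNIV_I] chi(2)]
      unfolding Fp_group_eq y(2) by (simp add: cohom_class_pow[OF group_add_group y(1)])
  qed
  have generators: "\<exists>x y. x \<in> carrier ?Z \<and> X = ?cls x \<and> (\<forall>xs. x xs \<noteq> 0 \<longrightarrow> length xs = Suc 1)
      \<and> y \<in> carrier ?Z \<and> Y = ?cls y \<and> (\<forall>xs. y xs \<noteq> 0 \<longrightarrow> length xs = Suc 2) \<and> has_weight y p
      \<and> cohom_basis add_group ({0, 1} \<times> UNIV) (\<lambda>(a::nat, b::nat). ?cls x [^]\<^bsub>?H\<^esub> a \<otimes>\<^bsub>?H\<^esub> ?cls y [^]\<^bsub>?H\<^esub> b)"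
    if gen: "exterior_polynomial_generators X Y" for X Y :: "('p mod_ring, 'p mod_ring) cohom_class"
  proof -
    obtain x where x: "x \<in> carrier ?Z" "X = ?cls x" and x_len: "\<And>xs. x xs \<noteq> 0 \<Longrightarrow> length xs = Suc 1"
      using gen unfolding exterior_polynomial_generators_def Fp_group_eq by (auto elim: cohom_degreeE)
    obtain y where y: "y \<in> carrier ?Z" "Y = ?cls y" and y_len: "\<And>xs. y xs \<noteq> 0 \<Longrightarrow> length xs = Suc 2"
      using gen unfolding exterior_polynomial_generators_def Fp_group_eq by (auto elim: cohom_degreeE)
    have basis: "cohom_basis add_group ({0, 1} \<times> UNIV) (\<lambda>(a::nat, b::nat). ?cls x [^]\<^bsub>?H\<^esub> a \<otimes>\<^bsub>?H\<^esub> ?cls y [^]\<^bsub>?H\<^esub> b)"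
      using gen unfolding exterior_polynomial_generators_def Fp_group_eq x(2) y(2) by blast
    have "has_weight y p"
      unfolding p by (rule has_weight_degree_two[OF x(1) x_len y(1) y_len basis])
    then show ?thesis using x x_len y y_len basis by blast
  qed
  have part2: "chi N (GL2_class (Y [^]\<^bsub>H_Fp\<^esub> d)) \<in> cohom_degree (GL N) (2 * d) \<and>
      \<not> nilpotent_elem (H_GL N) (chi N (GL2_class (Y [^]\<^bsub>H_Fp\<^esub> d)))"
    if gen: "exterior_polynomial_generators X Y" and k: "n \<le> k" "digit_sum p d = k * (p - 1)"
    for X Y :: "('p mod_ring, 'p mod_ring) cohom_class" and d k
  proof -
    obtain x y where x: "x \<in> carrier ?Z" and y: "y \<in> carrier ?Z" "Y = ?cls y"
      and y_len: "\<And>xs. y xs \<noteq> 0 \<Longrightarrow> length xs = Suc 2" and y_weight: "has_weight y p"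
      and basis: "cohom_basis add_group ({0, 1} \<times> UNIV) (\<lambda>(a::nat, b::nat). ?cls x [^]\<^bsub>?H\<^esub> a \<otimes>\<^bsub>?H\<^esub> ?cls y [^]\<^bsub>?H\<^esub> b)"
      using generators[OF gen] by blast
    let ?z = "y [^]\<^bsub>?Z\<^esub> d"
    have z: "?z \<in> carrier ?Z" using y(1) by simp
    have z_len: "\<forall>xs. ?z xs \<noteq> 0 \<longrightarrow> length xs = Suc (2 * d)"
      using pow_length[OF y_len] by blast
    \<comment> \<open>The weight of y^d is p d, whose expansion is that of d with a digit 0
      appended; hence the digit condition on d carries over unchanged.\<close>
    have w: "has_weight ?z (p * d)" by (rule has_weight_pow[OF y(1) y_weight])
    have ds: "digit_sum CARD('p) (p * d) = k * (CARD('p) - 1)"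
      using digit_sum_step[of p 0 d] p1 k(2) p by simp
    have cy: "?cls y \<in> carrier ?H" using y(1) by (simp add: carrier_cohom_ring)
    have nz: "?cls y [^]\<^bsub>?H\<^esub> b \<noteq> \<zero>\<^bsub>?H\<^esub>" for b :: nat
      using cohom_basis_nonzero[OF group_add_group basis, of "(0, b)"] cy by simp
    note chi = chi_detection[OF z z_len w ds n k(1) N(1) N']
    show ?thesis
      using chi(1) not_nilpotent[OF y(1) nz chi(2)]
      unfolding Fp_group_eq y(2) by (simp add: cohom_class_pow[OF group_add_group y(1)])
  qed
  have part3: "chi N (GL2_class (X \<otimes>\<^bsub>H_Fp\<^esub> Y [^]\<^bsub>H_Fp\<^esub> d)) \<in> cohom_degree (GL N) (2 * d + 1) \<and>
      chi N (GL2_class (X \<otimes>\<^bsub>H_Fp\<^esub> Y [^]\<^bsub>H_Fp\<^esub> d)) \<noteq> \<zero>\<^bsub>H_GL N\<^esub>"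
    if gen: "exterior_polynomial_generators X Y" and k: "n \<le> k" "digit_sum p d = k * (p - 1) - 1"
    for X Y :: "('p mod_ring, 'p mod_ring) cohom_class" and d k
  proof -
    obtain x y where x: "x \<in> carrier ?Z" "X = ?cls x" and x_len: "\<And>xs. x xs \<noteq> 0 \<Longrightarrow> length xs = Suc 1"
      and y: "y \<in> carrier ?Z" "Y = ?cls y"
      and y_len: "\<And>xs. y xs \<noteq> 0 \<Longrightarrow> length xs = Suc 2" and y_weight: "has_weight y p"
      and basis: "cohom_basis add_group ({0, 1} \<times> UNIV) (\<lambda>(a::nat, b::nat). ?cls x [^]\<^bsub>?H\<^esub> a \<otimes>\<^bsub>?H\<^esub> ?cls y [^]\<^bsub>?H\<^esub> b)"
      using generators[OF gen] by blast
    let ?z = "cup x (y [^]\<^bsub>?Z\<^esub> d)"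
    have yd: "y [^]\<^bsub>?Z\<^esub> d \<in> carrier ?Z" using y(1) by simp
    have z: "?z \<in> carrier ?Z" by (rule cup_cocycle[OF group_add_group x(1) yd])
    have z_len: "\<forall>xs. ?z xs \<noteq> 0 \<longrightarrow> length xs = Suc (2 * d + 1)"
      using cup_length[OF x_len pow_length[OF y_len]] by fastforce
    \<comment> \<open>The factor x turns the last digit 0 of p d into 1. This raises the digit sum
      by one and compensates for the -1 in the hypothesis.\<close>
    have w: "has_weight ?z (1 + p * d)"
      by (rule has_weight_cup[OF x(1) yd has_weight_degree_one[OF x(1) x_len] has_weight_pow[OF y(1) y_weight]])
    \<comment> \<open>Positivity ensures that the subtraction of natural numbers in the digit
      condition is not truncated.\<close>
    have "0 < k * (p - 1)" using k(1) n p1 by simp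
    then have ds: "digit_sum CARD('p) (1 + p * d) = k * (CARD('p) - 1)"
      using digit_sum_step[of p 1 d] p1 k(2) p by simp
    have cls: "?cls ?z = ?cls x \<otimes>\<^bsub>?H\<^esub> ?cls y [^]\<^bsub>?H\<^esub> d"
      by (simp add: cohom_class_cup[OF group_add_group x(1) yd] cohom_class_pow[OF group_add_group y(1)])
    have cx: "?cls x \<in> carrier ?H" using x(1) by (simp add: carrier_cohom_ring)
    have nz: "?cls ?z \<noteq> \<zero>\<^bsub>?H\<^esub>"
      using cohom_basis_nonzero[OF group_add_group basis, of "(1, d)"] cx unfolding cls by simp
    note chi = chi_detection[OF z z_len w ds n k(1) N(1) N']
    have "chi N (GL2_class (?cls ?z)) \<noteq> \<zero>\<^bsub>H_GL N\<^esub>"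
    proof
      assume zero: "chi N (GL2_class (?cls ?z)) = \<zero>\<^bsub>H_GL N\<^esub>"
      interpret HN: ring "H_GL N :: ('p mod_ring mat, 'p mod_ring) cohom_class ring" by (rule ring_cohom_ring[OF group_GL])
      have "chi N (GL2_class (?cls ?z)) [^]\<^bsub>H_GL N\<^esub> (1::nat) = \<zero>\<^bsub>H_GL N\<^esub>" by (simp add: zero)
      from chi(2)[OF this] have "?z \<in> coboundaries add_group" using Z.nat_pow_eone[OF z] by simp
      then show False using nz by (simp add: cohom_class_eq_zero_iff)
    qed
    then show ?thesis using chi(1) unfolding Fp_group_eq x(2) y(2) cls by simp
  qed
  show ?thesis using part1 part2 part3 by blast
qed

end
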